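(* Let $G\subset\mathbb{D}$ be a simply connected domain with locally connected boundary. The following conditions are equivalent: (i) $G$ is horocyclically convex. (ii) For every $a,b\in G$ with $a\neq b$, there is an admissible Jordan arc $\Gamma\subset G$ joining $a$ and $b$.
   Context: $\mathbb{D}=\{z\in\mathbb{C}:|z|<1\}$ and $\mathbb{T}=\partial\mathbb{D}$. A domain is a nonempty open connected set; boundaries are taken in $\mathbb{C}$. A horodisk is an open Euclidean disk $H\subset\mathbb{D}$ whose boundary circle is internally tangent to $\mathbb{T}$ at exactly one point. A domain $G\subset\mathbb{D}$ is horocyclically convex (horo-convex) if for every $\omega\in\mathbb{D}\cap\partial G$ there exists a horodisk $H$ such that $\omega\in\partial H$ and $G\cap H=\emptyset$. Hyperbolic curvature is geodesic curvature with respect to the metric $|dz|/(1-|z|^2)$ on $\mathbb{D}$ (Gaussian curvature $-4$): for a smooth arc $z(t)$ with Euclidean curvature $\kappa_e$ it equals $(1-|z|^2)\kappa_e+2\operatorname{Im}\big(\overline{z}\,z'/|z'|\big)$. With this normalization horocycles have hyperbolic curvature $\pm 2$, and arcs of constant hyperbolic curvature in $(-2,2)$ are exactly the arcs in $\mathbb{D}$ of Euclidean circles or lines that meet $\mathbb{T}$ in two distinct points. An admissible Jordan arc is a Jordan arc $\Gamma=\Gamma_1\cup\cdots\cup\Gamma_n$ contained in $\mathbb{D}$, where each $\Gamma_k$ is a smooth Jordan arc from $p_{k-1}$ to $p_k$ of constant hyperbolic curvature in the open interval $(-2,2)$, the $\Gamma_k$ are otherwise disjoint, and consecutive arcs join smoothly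 at their common point, so that $\Gamma$ is of class $C^1$ (as a regular curve, i.e. the unit tangent is continuous along $\Gamma$). *)

theory Defs
  imports "HOL-Analysis.Analysis"
begin

definition horodisk :: "complex set \<Rightarrow> bool" where
  "horodisk H \<longleftrightarrow>
     (\<exists>c r. 0 < r \<and> H = ball c r \<and> H \<subseteq> ball 0 1 \<and> (\<exists>\<zeta>. sphere c r \<inter> sphere 0 1 = {\<zeta>}))"

definition horo_convex :: "complex set \<Rightarrow> bool" where
  "horo_convex G \<longleftrightarrow>
     (\<forall>\<omega>\<in>ball 0 1 \<inter> frontier G. \<exists>H. horodisk H \<and> \<omega> \<in> frontier H \<and> G \<inter> H = {})"

text \<open>Derivatives of a path are taken within the closed unit interval, hence are one-sided at
  the two endpoints.\<close>

definition velocity :: "(real \<Rightarrow> complex) \<Rightarrow> real \<Rightarrow> complex" where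
  "velocity \<gamma> t = vector_derivative \<gamma> (at t within {0..1})"

definition acceleration :: "(real \<Rightarrow> complex) \<Rightarrow> real \<Rightarrow> complex" where
  "acceleration \<gamma> t = vector_derivative (velocity \<gamma>) (at t within {0..1})"

definition unit_tangent :: "(real \<Rightarrow> complex) \<Rightarrow> real \<Rightarrow> complex" where
  "unit_tangent \<gamma> t = velocity \<gamma> t / of_real (cmod (velocity \<gamma> t))"

text \<open>Signed curvature, positive for counterclockwise circles.\<close>

definition euclidean_curvature :: "(real \<Rightarrow> complex) \<Rightarrow> real \<Rightarrow> real" where
  "euclidean_curvature \<gamma> t =
     Im (cnj (velocity \<gamma> t) * acceleration \<gamma> t) / cmod (velocity \<gamma> t) ^ 3"

definition hyperbolic_curvature :: "(real \<Rightarrow> complex) \<Rightarrow> real \<Rightarrow> real" where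
  "hyperbolic_curvature \<gamma> t =
     (1 - (cmod (\<gamma> t))\<^sup>2) * euclidean_curvature \<gamma> t + 2 * Im (cnj (\<gamma> t) * unit_tangent \<gamma> t)"

text \<open>A regular \<open>C\<^sup>\<infinity>\<close> parametrized Jordan arc; \<open>D k\<close> is the \<open>k\<close>-th derivative of \<open>\<gamma>\<close>.\<close>

definition smooth_arc :: "(real \<Rightarrow> complex) \<Rightarrow> bool" where
  "smooth_arc \<gamma> \<longleftrightarrow> arc \<gamma> \<and>
     (\<exists>D :: nat \<Rightarrow> real \<Rightarrow> complex. D 0 = \<gamma> \<and>
        (\<forall>k. \<forall>t\<in>{0..1}. (D k has_vector_derivative D (Suc k) t) (at t within {0..1}))) \<and>
     (\<forall>t\<in>{0..1}. velocity \<gamma> t \<noteq> 0)"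

definition Jordan_arc :: "complex set \<Rightarrow> complex \<Rightarrow> complex \<Rightarrow> bool" where
  "Jordan_arc \<Gamma> a b \<longleftrightarrow> (\<exists>g. arc g \<and> path_image g = \<Gamma> \<and> pathstart g = a \<and> pathfinish g = b)"

text \<open>The pieces are numbered from \<open>0\<close>: the piece \<open>\<gamma> k\<close> runs from \<open>p k\<close> to \<open>p (Suc k)\<close>. The
  constant \<open>\<kappa>\<close> may differ from piece to piece. Equality of the unit tangents at the joints says
  that the concatenation is \<open>C\<^sup>1\<close> as a regular curve.\<close>

definition admissible_Jordan_arc :: "complex set \<Rightarrow> complex \<Rightarrow> complex \<Rightarrow> bool" where
  "admissible_Jordan_arc \<Gamma> a b \<longleftrightarrow>
     Jordan_arc \<Gamma> a b \<and> \<Gamma> \<subseteq> ball 0 1 \<and>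
     (\<exists>(n::nat) (p :: nat \<Rightarrow> complex) (\<gamma> :: nat \<Rightarrow> real \<Rightarrow> complex).
        0 < n \<and> p 0 = a \<and> p n = b \<and>
        \<Gamma> = (\<Union>k<n. path_image (\<gamma> k)) \<and>
        (\<forall>k<n. smooth_arc (\<gamma> k) \<and> pathstart (\<gamma> k) = p k \<and> pathfinish (\<gamma> k) = p (Suc k) \<and>
           (\<exists>\<kappa>. -2 < \<kappa> \<and> \<kappa> < 2 \<and> (\<forall>t\<in>{0..1}. hyperbolic_curvature (\<gamma> k) t = \<kappa>))) \<and>
        (\<forall>j k. j < k \<and> k < n \<longrightarrow>
           path_image (\<gamma> j) \<inter> path_image (\<gamma> k) = (if k = Suc j then {p k} else {})) \<and>
        (\<forall>k. Suc k < n \<longrightarrow> unit_tangent (\<gamma> k) 1 = unit_tangent (\<gamma> (Suc k)) 0))"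

end

theory Submission
  imports Defs
begin

text \<open>
  A horodisk touching the unit circle at \<open>\<zeta>\<close> is a superlevel set of the Poisson kernel with pole
  \<open>\<zeta>\<close>, and along a \<open>C\<^sup>1\<close> curve of hyperbolic curvature in \<open>(-2, 2)\<close> the Poisson kernel has no
  interior local minimum. So an admissible arc that leaves a horodisk never returns to it.

  Suppose \<open>G\<close> contains admissible arcs between its points, but every horodisk with \<open>\<omega>\<close> on its boundary
  meets \<open>G\<close>. A continuous branch on \<open>G\<close> of the argument of \<open>(z - \<omega>) / (1 - cnj \<omega> * z)\<close> then shows
  that some such horodisk contains two points of \<open>G\<close> whose arguments belong to branches that differ
  by \<open>2 * pi\<close>. An admissible arc between them would have to leave the horodisk and return.

  Conversely, let \<open>G\<close> be horocyclically convex and join \<open>a\<close> to \<open>b\<close> by a path in \<open>G\<close>. The boundary of \<open>G\<close> in a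
  large concentric disk is covered by finitely many slightly enlarged horodisks that avoid this path; these
  are disks whose circles have hyperbolic curvature less than two. Euclidean segments have hyperbolic
  curvature in \<open>(-2, 2)\<close> as well, so a Euclidean taut string around these obstacles would do.
  To approximate it, among the polygons with \<open>N\<close> edges and vertices
  outside the obstacles, minimise the sum of the squared edge lengths. Each vertex is then the point of the
  obstacle-free set nearest to the midpoint of its neighbours, which bounds its turning
  angle by the curvature of the obstacle, and rounding the corners by circular arcs yields the curve. It
  has no self-intersections because it has no interior minima of any Poisson kernel.
\<close>

subsection \<open>Arcs of hyperbolic curvature less than two and horodisks\<close>

text \<open>Squares of the edge lengths, rather than lengths, keep all edges of a minimiser short:
  its energy is at most that of a sampled path, and so is every single summand. The obstacles need
  three kinds of slack. Rounding a corner of a polygon with edges of length at most \<open>h\<close>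
  exceeds the curvature of an obstacle by a relative error of order \<open>h / r\<close>, where
  \<open>r\<close> is the smallest radius; a finite cover provides a common gap
  \<open>\<eta>\<close> below 2 that absorbs it. Edges and rounding arcs dip into the obstacles, so
  these are chosen larger than the disks that cover the boundary, with a margin
  \<open>\<delta>\<close>. Finally, a vertex squeezed between two obstacles might turn more sharply
  than either of them; the radii are perturbed until no two of the circles, the outer one included,
  are tangent. A short chord is then almost tangent to at most one of them, so every vertex with a
  turn is governed by a single obstacle. The outer circle causes no turn, because the midpoint of
  two points of a disk stays in the disk.\<close>

definition subhoro_piece :: "(real \<Rightarrow> complex) \<Rightarrow> bool" where
  "subhoro_piece \<gamma> \<longleftrightarrow>
     (\<exists>D :: nat \<Rightarrow> real \<Rightarrow> complex. D 0 = \<gamma> \<and>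
        (\<forall>k. \<forall>t\<in>{0..1}. (D k has_vector_derivative D (Suc k) t) (at t within {0..1}))) \<and>
     (\<forall>t\<in>{0..1}. velocity \<gamma> t \<noteq> 0 \<and> cmod (\<gamma> t) < 1) \<and>
     (\<exists>\<kappa>. -2 < \<kappa> \<and> \<kappa> < 2 \<and> (\<forall>t\<in>{0..1}. hyperbolic_curvature \<gamma> t = \<kappa>))"

lemma velocity_eqI:
  assumes "(\<gamma> has_vector_derivative d) (at t within {0..1})" "t \<in> {0..1}"
  shows "velocity \<gamma> t = d"
  unfolding velocity_def
  using vector_derivative_within_closed_interval[OF _ assms(2,1)] by simp

lemma derivatives_of_smooth:
  assumes D: "D 0 = \<gamma>"
    "\<And>k t. t \<in> {0..1} \<Longrightarrow> (D k has_vector_derivative D (Suc k) t) (at t within {0..1})"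
    and t: "t \<in> {0..1::real}"
  shows "(\<gamma> has_vector_derivative velocity \<gamma> t) (at t within {0..1})"
    and "(velocity \<gamma> has_vector_derivative acceleration \<gamma> t) (at t within {0..1})"
    and "velocity \<gamma> t = D 1 t" and "acceleration \<gamma> t = D 2 t"
proof -
  have 1: "velocity \<gamma> s = D 1 s" if "s \<in> {0..1}" for s
    using D(2)[OF that, of 0] that by (auto simp: D(1) intro: velocity_eqI)
  show "velocity \<gamma> t = D 1 t" by (rule 1[OF t])
  show "(\<gamma> has_vector_derivative velocity \<gamma> t) (at t within {0..1})"
    using D(2)[OF t, of 0] 1[OF t] D(1) by simp
  have 2: "(velocity \<gamma> has_vector_derivative D 2 t) (at t within {0..1})"
    using has_vector_derivative_transform[OF t _ D(2)[OF t, of 1]] 1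
    by (simp add: numeral_2_eq_2)
  then show "acceleration \<gamma> t = D 2 t"
    unfolding acceleration_def
    using vector_derivative_within_closed_interval[OF _ t] by simp
  with 2 show "(velocity \<gamma> has_vector_derivative acceleration \<gamma> t) (at t within {0..1})" by simp
qed

lemma subhoro_pieceD:
  assumes "subhoro_piece \<gamma>" "t \<in> {0..1}"
  shows "(\<gamma> has_vector_derivative velocity \<gamma> t) (at t within {0..1})"
    and "(velocity \<gamma> has_vector_derivative acceleration \<gamma> t) (at t within {0..1})"
    and "velocity \<gamma> t \<noteq> 0" and "cmod (\<gamma> t) < 1" and "\<bar>hyperbolic_curvature \<gamma> t\<bar> < 2"
proof -
  obtain D where D: "D 0 = \<gamma>"
    "\<And>k t. t \<in> {0..1} \<Longrightarrow> (D k has_vector_derivative D (Suc k) t) (at t within {0..1})"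
    using assms(1) unfolding subhoro_piece_def by blast
  show "(\<gamma> has_vector_derivative velocity \<gamma> t) (at t within {0..1})"
    by (rule derivatives_of_smooth(1)[OF D assms(2)])
  show "(velocity \<gamma> has_vector_derivative acceleration \<gamma> t) (at t within {0..1})"
    by (rule derivatives_of_smooth(2)[OF D assms(2)])
  show "velocity \<gamma> t \<noteq> 0" "cmod (\<gamma> t) < 1" "\<bar>hyperbolic_curvature \<gamma> t\<bar> < 2"
    using assms unfolding subhoro_piece_def by auto
qed

lemma continuous_on_subhoro_piece:
  assumes "subhoro_piece \<gamma>" shows "continuous_on {0..1} \<gamma>"
  using subhoro_pieceD(1)[OF assms]
  by (meson continuous_on_eq_continuous_within has_vector_derivative_continuous)

text \<open>The sign of this quadratic is the sign of the Poisson kernel with pole \<open>\<zeta>\<close> minus \<open>c\<close>; it replaces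
  the kernel because its derivatives along a curve are simpler.\<close>

definition horo_fun :: "complex \<Rightarrow> real \<Rightarrow> complex \<Rightarrow> real" where
  "horo_fun \<zeta> c z = 1 - (cmod z)\<^sup>2 - c * (cmod (\<zeta> - z))\<^sup>2"

definition horo_slope :: "complex \<Rightarrow> real \<Rightarrow> complex \<Rightarrow> complex \<Rightarrow> real" where
  "horo_slope \<zeta> c z v =
     2 * ((c * Re \<zeta> - (1 + c) * Re z) * Re v + (c * Im \<zeta> - (1 + c) * Im z) * Im v)"

lemma has_vector_derivative_Re_Im:
  assumes "(f has_vector_derivative f') F"
  shows "((\<lambda>t. Re (f t)) has_vector_derivative Re f') F"
    "((\<lambda>t. Im (f t)) has_vector_derivative Im f') F"
  using bounded_linear.has_vector_derivative[OF bounded_linear_Re assms]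
    bounded_linear.has_vector_derivative[OF bounded_linear_Im assms] by auto

lemma horo_fun_deriv:
  assumes "(\<gamma> has_vector_derivative v) (at t within S)"
  shows "((\<lambda>s. horo_fun \<zeta> c (\<gamma> s)) has_real_derivative horo_slope \<zeta> c (\<gamma> t) v) (at t within S)"
proof -
  note * = has_vector_derivative_Re_Im[OF assms, folded has_real_derivative_iff_has_vector_derivative]
  show ?thesis
    unfolding horo_fun_def horo_slope_def cmod_power2 minus_complex.simps
    by (rule derivative_eq_intros * refl)+ (simp add: algebra_simps)
qed

lemma horo_slope_deriv:
  assumes "(\<gamma> has_vector_derivative v t) (at t within S)" "(v has_vector_derivative w) (at t within S)"
  shows "((\<lambda>s. horo_slope \<zeta> c (\<gamma> s) (v s)) has_real_derivative
            horo_slope \<zeta> c (\<gamma> t) w - 2 * (1 + c) * (cmod (v t))\<^sup>2) (at t within S)"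
proof -
  note * = has_vector_derivative_Re_Im[OF assms(1), folded has_real_derivative_iff_has_vector_derivative]
    has_vector_derivative_Re_Im[OF assms(2), folded has_real_derivative_iff_has_vector_derivative]
  show ?thesis
    unfolding horo_slope_def cmod_power2
    by (rule DERIV_cong, (rule derivative_intros *)+) (simp add: algebra_simps power2_eq_square)
qed

lemma horo_slope_scale: "horo_slope \<zeta> c z (of_real r * v) = r * horo_slope \<zeta> c z v"
  by (simp add: horo_slope_def algebra_simps)

text \<open>At such a point the curve touches the horocycle \<open>horo_fun \<zeta> c = 0\<close>,
  which has Euclidean curvature \<open>1 + c\<close> and hyperbolic curvature 2. Measured towards
  the common normal, the curve bends less than the horocycle, so to second order it stays outside
  the horodisk. In the notation of the proof the left side is
  \<open>2 * \<rho>\<^sup>2 * (s * K - (1 + c))\<close>.\<close>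

lemma critical_is_concave:
  fixes z v w :: complex
  assumes \<zeta>: "cmod \<zeta> = 1" and z: "cmod z < 1" and v: "v \<noteq> 0"
    and h0: "horo_fun \<zeta> c z = 0" and h1: "horo_slope \<zeta> c z v = 0"
    and \<kappa>: "\<bar>(1 - (cmod z)\<^sup>2) * (Im (cnj v * w) / cmod v ^ 3) + 2 * Im (cnj z * (v / of_real (cmod v)))\<bar> < 2"
  shows "horo_slope \<zeta> c z w - 2 * (1 + c) * (cmod v)\<^sup>2 < 0"
proof -
  define \<rho> where "\<rho> = cmod v"
  define T where "T = v / of_real \<rho>"
  \<comment> \<open>The horocycle has centre \<open>c / (1 + c) * \<zeta>\<close> and radius
    \<open>1 / (1 + c)\<close>, so this is its inner unit normal at \<open>z\<close>.\<close>
  define N where "N = Complex (c * Re \<zeta> - (1 + c) * Re z) (c * Im \<zeta> - (1 + c) * Im z)"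
  define K where "K = Im (cnj v * w) / \<rho> ^ 3"
  have \<rho>: "\<rho> > 0" using v by (simp add: \<rho>_def)
  have vT: "v = of_real \<rho> * T" using \<rho> by (simp add: T_def)
  have T1: "cmod T = 1" using \<rho> by (simp add: T_def norm_divide \<rho>_def)
  have \<zeta>1: "(Re \<zeta>)\<^sup>2 + (Im \<zeta>)\<^sup>2 = 1" using \<zeta> by (metis cmod_power2 one_power2)
  have h0': "1 - ((Re z)\<^sup>2 + (Im z)\<^sup>2) = c * (1 - 2 * (Re \<zeta> * Re z + Im \<zeta> * Im z) + ((Re z)\<^sup>2 + (Im z)\<^sup>2))"
    using h0 \<zeta>1 unfolding horo_fun_def cmod_power2 minus_complex.simps by algebra
  have N1: "(Re N)\<^sup>2 + (Im N)\<^sup>2 = 1"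
    using h0' \<zeta>1 unfolding N_def complex.sel by algebra
  have T1': "(Re T)\<^sup>2 + (Im T)\<^sup>2 = 1" using T1 by (metis cmod_power2 one_power2)
  have NT: "Re N * Re T + Im N * Im T = 0"
  proof -
    have "horo_slope \<zeta> c z v = 2 * \<rho> * (Re N * Re T + Im N * Im T)"
      unfolding horo_slope_def N_def vT by (simp add: algebra_simps)
    then show ?thesis using h1 \<rho> by simp
  qed
  \<comment> \<open>\<open>s\<close> is 1 or -1 and \<open>N = s * \<i> * T\<close>: the sign tells
    on which side of the curve the horodisk lies.\<close>
  define s where "s = Im N * Re T - Re N * Im T"
  have s1: "s * s = 1" using N1 T1' NT unfolding s_def by algebra
  have ReN: "Re N = - s * Im T" and ImN: "Im N = s * Re T"
    using N1 T1' NT unfolding s_def by algebra+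
  have KT: "Im (cnj T * w) = K * \<rho>\<^sup>2"
    using \<rho> by (simp add: K_def vT field_simps power2_eq_square power3_eq_cube)
  have slope: "horo_slope \<zeta> c z w = 2 * s * (K * \<rho>\<^sup>2)"
  proof -
    have "horo_slope \<zeta> c z w = 2 * (Re N * Re w + Im N * Im w)"
      by (simp add: horo_slope_def N_def)
    then show ?thesis unfolding KT[symmetric] ReN ImN by (simp add: algebra_simps)
  qed
  have Imz: "2 * Im (cnj z * T) = s * ((1 + c) * ((Re z)\<^sup>2 + (Im z)\<^sup>2) - (c - 1))"
  proof -
    have "2 * Im (cnj z * T) * 1 = - 2 * s * (Re z * Re N + Im z * Im N)"
      using s1 unfolding ReN ImN by simp algebra
    also have "\<dots> = s * ((1 + c) * ((Re z)\<^sup>2 + (Im z)\<^sup>2) - (c - 1))"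
      using h0' unfolding N_def complex.sel by algebra
    finally show ?thesis by simp
  qed
  define \<kappa> where "\<kappa> = (1 - ((Re z)\<^sup>2 + (Im z)\<^sup>2)) * K + s * ((1 + c) * ((Re z)\<^sup>2 + (Im z)\<^sup>2) - (c - 1))"
  have "\<bar>\<kappa>\<bar> < 2"
    using \<kappa> unfolding \<kappa>_def Imz[symmetric] K_def T_def \<rho>_def cmod_power2 by simp
  moreover have "\<bar>s\<bar> = 1" using s1 by (metis abs_mult_self_eq abs_of_nonneg abs_one power2_eq_1_iff power2_eq_square abs_minus_cancel)
  ultimately have "s * \<kappa> < 2"
    by (metis abs_le_D1 abs_mult dual_order.strict_trans2 leI mult_1 abs_ge_self)
  moreover have "s * \<kappa> = (1 - ((Re z)\<^sup>2 + (Im z)\<^sup>2)) * (s * K) + ((1 + c) * ((Re z)\<^sup>2 + (Im z)\<^sup>2) - (c - 1))"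
    using s1 unfolding \<kappa>_def by algebra
  ultimately have "(1 - ((Re z)\<^sup>2 + (Im z)\<^sup>2)) * (s * K - (1 + c)) < 0"
    by (simp add: algebra_simps)
  moreover have "(cmod z)\<^sup>2 < 1" using z by (simp add: abs_square_less_1)
  ultimately have "s * K - (1 + c) < 0"
    unfolding cmod_power2 by (auto simp: mult_less_0_iff)
  then have "(s * K - (1 + c)) * \<rho>\<^sup>2 < 0" using \<rho> by (simp add: mult_less_0_iff)
  then show ?thesis unfolding slope \<rho>_def[symmetric] by (simp add: algebra_simps)
qed

text \<open>Slope zero is assigned to the right-hand side: there \<open>critical_is_concave\<close>
  makes the slope negative just after \<open>t\<close>. Together with
  \<open>horo_fun_not_min_left\<close> for positive slope this covers every sign, also at a joint,
  where the two sides belong to different pieces.\<close>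

lemma horo_fun_not_min_right:
  assumes \<gamma>: "subhoro_piece \<gamma>" and \<zeta>: "cmod \<zeta> = 1" and t: "0 \<le> t" "t < 1"
    and h0: "horo_fun \<zeta> c (\<gamma> t) = 0" and h1: "horo_slope \<zeta> c (\<gamma> t) (velocity \<gamma> t) \<le> 0" and e: "0 < e"
  shows "\<exists>s. t < s \<and> s < 1 \<and> s < t + e \<and> horo_fun \<zeta> c (\<gamma> s) < 0"
proof -
  let ?f = "\<lambda>s. horo_fun \<zeta> c (\<gamma> s)" and ?f' = "\<lambda>s. horo_slope \<zeta> c (\<gamma> s) (velocity \<gamma> s)"
  have t01: "t \<in> {0..1}" using t by auto
  have d1: "(?f has_real_derivative ?f' s) (at s within {0..1})" if "s \<in> {0..1}" for s
    by (rule horo_fun_deriv[OF subhoro_pieceD(1)[OF \<gamma> that]])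
  define f2 where "f2 = horo_slope \<zeta> c (\<gamma> t) (acceleration \<gamma> t) - 2 * (1 + c) * (cmod (velocity \<gamma> t))\<^sup>2"
  have d2: "(?f' has_real_derivative f2) (at t within {0..1})"
    unfolding f2_def by (rule horo_slope_deriv[OF subhoro_pieceD(1,2)[OF \<gamma> t01]])
  \<comment> \<open>Negative slope at \<open>t\<close> gives negative values nearby at once; slope
    zero only gives negative slopes nearby. The disjunction lets the mean value argument below treat
    both cases together.\<close>
  obtain d where d: "d > 0" "\<And>s. t < s \<Longrightarrow> s \<in> {0..1} \<Longrightarrow> s < t + d \<Longrightarrow> ?f' s < 0 \<or> ?f s < 0"
  proof (cases "?f' t < 0")
    case True
    from has_real_derivative_neg_dec_right[OF d1[OF t01] True] obtain d where
      "d > 0" "\<And>h. h > 0 \<Longrightarrow> t + h \<in> {0..1} \<Longrightarrow> h < d \<Longrightarrow> ?f t > ?f (t + h)" by blast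
    then show ?thesis using that[of d] h0 by (smt (verit) add_diff_cancel_left' diff_add_cancel)
  next
    case False
    with h1 have z: "?f' t = 0" by simp
    have "f2 < 0"
      unfolding f2_def
      using subhoro_pieceD(5)[OF \<gamma> t01]
      by (intro critical_is_concave[OF \<zeta> subhoro_pieceD(4,3)[OF \<gamma> t01] h0 z])
        (simp add: hyperbolic_curvature_def euclidean_curvature_def unit_tangent_def)
    from has_real_derivative_neg_dec_right[OF d2 this] obtain d where
      "d > 0" "\<And>h. h > 0 \<Longrightarrow> t + h \<in> {0..1} \<Longrightarrow> h < d \<Longrightarrow> ?f' t > ?f' (t + h)" by blast
    then show ?thesis using that[of d] z by (smt (verit) add_diff_cancel_left' diff_add_cancel)
  qed
  define s where "s = t + min (min d e) (1 - t) / 2"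
  have s: "t < s" "s < 1" "s < t + e" "s < t + d"
    using d(1) e t unfolding s_def by (auto simp: min_def field_simps)
  have "\<exists>s'. t < s' \<and> s' \<le> s \<and> ?f s' < 0"
  proof (rule ccontr)
    assume no: "\<not> ?thesis"
    have neg: "?f' x < 0" if "t < x" "x < s" for x
      using no d(2)[of x] that s t by fastforce
    have cont: "continuous_on {t..s} ?f"
      by (rule continuous_on_subset[of "{0..1}"])
        (use s t DERIV_continuous_on[OF d1] in auto)
    have "\<exists>l z. t < z \<and> z < s \<and> (?f has_real_derivative l) (at z) \<and> ?f s - ?f t = (s - t) * l"
    proof (rule MVT[OF s(1) cont])
      fix x assume x: "t < x" "x < s"
      have "(?f has_real_derivative ?f' x) (at x)"
        using d1[of x] x s t at_within_Icc_at[of 0 x 1] by auto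
      then show "?f differentiable (at x)" using real_differentiable_def by blast
    qed
    then obtain l z where z: "t < z" "z < s" "(?f has_real_derivative l) (at z)" "?f s - ?f t = (s - t) * l"
      by blast
    have "(?f has_real_derivative ?f' z) (at z)"
      using d1[of z] z s t at_within_Icc_at[of 0 z 1] by auto
    then have "l = ?f' z" using z(3) DERIV_unique by blast
    then have "?f s < ?f t" using z neg[OF z(1,2)] s(1)
      by (smt (verit) mult_pos_neg)
    then show False using no s(1) h0 by auto
  qed
  then show ?thesis using s by force
qed

lemma horo_fun_not_min_left:
  assumes \<gamma>: "subhoro_piece \<gamma>" and t: "0 < t" "t \<le> 1"
    and h0: "horo_fun \<zeta> c (\<gamma> t) = 0" and h1: "horo_slope \<zeta> c (\<gamma> t) (velocity \<gamma> t) > 0" and e: "0 < e"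
  shows "\<exists>s. 0 < s \<and> s < t \<and> t - e < s \<and> horo_fun \<zeta> c (\<gamma> s) < 0"
proof -
  have t01: "t \<in> {0..1}" using t by auto
  from has_real_derivative_pos_inc_left[OF horo_fun_deriv[OF subhoro_pieceD(1)[OF \<gamma> t01]] h1] obtain d where
    d: "d > 0" "\<And>h. h > 0 \<Longrightarrow> t - h \<in> {0..1} \<Longrightarrow> h < d \<Longrightarrow> horo_fun \<zeta> c (\<gamma> (t - h)) < horo_fun \<zeta> c (\<gamma> t)" by blast
  define h where "h = min (min d e) t / 2"
  have "h > 0" "h < d" "h < e" "h < t" using d(1) e t unfolding h_def by (auto simp: min_def field_simps)
  then show ?thesis using d(2)[of h] t h0 by (intro exI[of _ "t - h"]) auto
qed

section \<open>Chains of pieces and their concatenation\<close>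

definition subhoro_chain :: "nat \<Rightarrow> (nat \<Rightarrow> real \<Rightarrow> complex) \<Rightarrow> bool" where
  "subhoro_chain n \<gamma> \<longleftrightarrow> 0 < n \<and> (\<forall>k<n. subhoro_piece (\<gamma> k)) \<and>
     (\<forall>k. Suc k < n \<longrightarrow> \<gamma> k 1 = \<gamma> (Suc k) 0 \<and> unit_tangent (\<gamma> k) 1 = unit_tangent (\<gamma> (Suc k)) 0)"

text \<open>Piece \<open>k\<close> occupies \<open>[k, k + 1]\<close> without rescaling, so that its
  derivatives can be used as they are. The \<open>min\<close> assigns the right end
  \<open>x = n\<close> to the last piece.\<close>

definition concat_pieces :: "nat \<Rightarrow> (nat \<Rightarrow> real \<Rightarrow> complex) \<Rightarrow> real \<Rightarrow> complex" where
  "concat_pieces n \<gamma> x = (let k = min (nat \<lfloor>x\<rfloor>) (n - 1) in \<gamma> k (x - real k))"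

lemma concat_pieces_eq:
  assumes "subhoro_chain n \<gamma>" "k < n" "real k \<le> x" "x \<le> real k + 1"
  shows "concat_pieces n \<gamma> x = \<gamma> k (x - real k)"
proof (cases "x = real k + 1")
  case False
  then have "nat \<lfloor>x\<rfloor> = k" using assms(3,4) by (intro floor_unique[THEN arg_cong[of _ _ nat], of "int k", simplified]) auto
  then show ?thesis using assms(2) by (simp add: concat_pieces_def Let_def min_absorb1)
next
  case True
  then have "nat \<lfloor>x\<rfloor> = Suc k" by (simp add: nat_add_distrib)
  moreover have "\<gamma> k 1 = \<gamma> (Suc k) 0" if "Suc k < n"
    using assms(1) that by (simp add: subhoro_chain_def)
  ultimately show ?thesis using assms(2) True
    by (cases "Suc k < n") (auto simp: concat_pieces_def Let_def min_def not_less le_Suc_eq)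
qed

lemma piece_index:
  assumes "0 < n" "0 \<le> x" "x \<le> real n"
  obtains k where "k < n" "real k \<le> x" "x \<le> real k + 1" "x < real n \<Longrightarrow> x < real k + 1"
proof (cases "x = real n")
  case True
  then show ?thesis using that[of "n - 1"] assms by (auto simp: of_nat_diff)
next
  case False
  then have x: "x < real n" using assms by simp
  have "real (nat \<lfloor>x\<rfloor>) \<le> x" "x < real (nat \<lfloor>x\<rfloor>) + 1" using assms(2) by linarith+
  moreover from this have "nat \<lfloor>x\<rfloor> < n" using x by linarith
  ultimately show ?thesis using that by (meson less_imp_le)
qed

lemma interval_pieces: "0 < n \<Longrightarrow> {0..real n} = (\<Union>k<n. {real k..real k + 1})"
proof (intro set_eqI iffI)
  fix x assume "0 < n" "x \<in> {0..real n}"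
  then obtain k where "k < n" "real k \<le> x" "x \<le> real k + 1"
    using piece_index[of n x] by (metis atLeastAtMost_iff)
  then show "x \<in> (\<Union>k<n. {real k..real k + 1})" by auto
next
  fix x assume "x \<in> (\<Union>k<n. {real k..real k + 1})"
  then obtain k where "k < n" "real k \<le> x" "x \<le> real k + 1" by auto
  moreover have "real k + 1 \<le> real n" using \<open>k < n\<close> by linarith
  ultimately show "x \<in> {0..real n}" by auto
qed

lemma continuous_on_concat_pieces:
  assumes "subhoro_chain n \<gamma>"
  shows "continuous_on {0..real n} (concat_pieces n \<gamma>)"
proof -
  have "{0..real n} = (\<Union>k<n. {real k..real k + 1})"
    using assms by (intro interval_pieces) (simp add: subhoro_chain_def)
  moreover have "continuous_on {real k..real k + 1} (concat_pieces n \<gamma>)" if "k < n" for k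
  proof -
    have "continuous_on {real k..real k + 1} (\<lambda>x. \<gamma> k (x - real k))"
      using assms that
      by (intro continuous_on_compose2[OF continuous_on_subhoro_piece[of "\<gamma> k"]] continuous_intros)
        (auto simp: subhoro_chain_def)
    then show ?thesis
      by (rule continuous_on_eq) (use concat_pieces_eq[OF assms that] in auto)
  qed
  ultimately show ?thesis
    using continuous_on_closed_Union[of "{..<n}" "\<lambda>k. {real k..real k + 1}" "concat_pieces n \<gamma>"]
    by (metis closed_atLeastAtMost finite_lessThan lessThan_iff)
qed

lemma concat_pieces_in_disk:
  assumes "subhoro_chain n \<gamma>" "0 \<le> x" "x \<le> real n"
  shows "cmod (concat_pieces n \<gamma> x) < 1"
proof -
  have "0 < n" using assms by (simp add: subhoro_chain_def)
  then obtain k where k: "k < n" "real k \<le> x" "x \<le> real k + 1"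
    using piece_index[OF _ assms(2,3)] by blast
  then show ?thesis
    using subhoro_pieceD(4)[of "\<gamma> k" "x - real k"] concat_pieces_eq[OF assms(1) k] assms(1)
    by (simp add: subhoro_chain_def)
qed

lemma no_interior_min:
  assumes ch: "subhoro_chain n \<gamma>" and \<zeta>: "cmod \<zeta> = 1" and x: "0 < x" "x < real n"
    and h0: "horo_fun \<zeta> c (concat_pieces n \<gamma> x) = 0" and e: "0 < e"
  shows "\<exists>y. \<bar>y - x\<bar> < e \<and> 0 < y \<and> y < real n \<and> horo_fun \<zeta> c (concat_pieces n \<gamma> y) < 0"
proof -
  have "0 < n" using ch by (simp add: subhoro_chain_def)
  then obtain k where k: "k < n" "real k \<le> x" "x \<le> real k + 1" "x < real k + 1"
    using piece_index[OF _ less_imp_le[OF x(1)] less_imp_le[OF x(2)]] x(2) by blast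
  have kn: "real k + 1 \<le> real n" using k(1) by linarith
  have pk: "subhoro_piece (\<gamma> k)" using ch k(1) by (simp add: subhoro_chain_def)
  define t where "t = x - real k"
  have t: "0 \<le> t" "t < 1" using k by (auto simp: t_def)
  have h0': "horo_fun \<zeta> c (\<gamma> k t) = 0" using h0 concat_pieces_eq[OF ch k(1-3)] by (simp add: t_def)
  show ?thesis
  proof (cases "horo_slope \<zeta> c (\<gamma> k t) (velocity (\<gamma> k) t) \<le> 0")
    case True
    from horo_fun_not_min_right[OF pk \<zeta> t h0' True e] obtain s where
      s: "t < s" "s < 1" "s < t + e" "horo_fun \<zeta> c (\<gamma> k s) < 0" by blast
    then show ?thesis
      using concat_pieces_eq[OF ch k(1), of "real k + s"] t kn x
      by (intro exI[of _ "real k + s"]) (auto simp: t_def)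
  next
    case False
    show ?thesis
    proof (cases "t = 0")
      case f: False
      from horo_fun_not_min_left[OF pk _ _ h0' _ e] False f t obtain s where
        s: "0 < s" "s < t" "t - e < s" "horo_fun \<zeta> c (\<gamma> k s) < 0" by force
      then show ?thesis
        using concat_pieces_eq[OF ch k(1), of "real k + s"] t kn x
        by (intro exI[of _ "real k + s"]) (auto simp: t_def)
    next
      case True
      then have xk: "x = real k" by (simp add: t_def)
      then obtain j where j: "k = Suc j" using x by (cases k) auto
      have pj: "subhoro_piece (\<gamma> j)" using ch k(1) j by (simp add: subhoro_chain_def)
      have jn: "\<gamma> j 1 = \<gamma> k 0" "unit_tangent (\<gamma> j) 1 = unit_tangent (\<gamma> k) 0"
        using ch k(1) j by (auto simp: subhoro_chain_def)
      \<comment> \<open>Only the unit tangents agree at the joint. The velocities on the two sides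
        differ by the positive factor \<open>r\<close>, which preserves the sign of the
        slope.\<close>
      define r where "r = cmod (velocity (\<gamma> j) 1) / cmod (velocity (\<gamma> k) 0)"
      have r: "r > 0"
        using subhoro_pieceD(3)[OF pj, of 1] subhoro_pieceD(3)[OF pk, of 0] by (simp add: r_def)
      have vv: "velocity (\<gamma> j) 1 = of_real r * velocity (\<gamma> k) 0"
      proof -
        have "velocity (\<gamma> j) 1 = of_real (cmod (velocity (\<gamma> j) 1)) * unit_tangent (\<gamma> j) 1"
          using subhoro_pieceD(3)[OF pj, of 1] by (simp add: unit_tangent_def)
        then show ?thesis unfolding jn(2) by (simp add: unit_tangent_def r_def)
      qed
      have "horo_slope \<zeta> c (\<gamma> j 1) (velocity (\<gamma> j) 1) > 0"
        unfolding vv horo_slope_scale jn(1)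
        using False True r by (simp add: zero_less_mult_iff)
      from horo_fun_not_min_left[OF pj _ _ _ this e] h0' jn True obtain s where
        s: "0 < s" "s < 1" "1 - e < s" "horo_fun \<zeta> c (\<gamma> j s) < 0" by force
      then show ?thesis
        using concat_pieces_eq[OF ch, of j "real j + s"] j kn xk k(1)
        by (intro exI[of _ "real j + s"]) auto
    qed
  qed
qed

text \<open>The level \<open>c\<close> is the value at \<open>z\<close> of the Poisson kernel with
  pole \<open>\<zeta>\<close>.\<close>

lemma horo_fun_zero_level:
  assumes "cmod \<zeta> = 1" "cmod z < 1"
  obtains c where "c > 0" "horo_fun \<zeta> c z = 0"
    "\<And>b. horo_fun \<zeta> b z = (c - b) * (cmod (\<zeta> - z))\<^sup>2" "(cmod (\<zeta> - z))\<^sup>2 > 0"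
proof -
  have ne: "\<zeta> \<noteq> z" using assms by auto
  have "(cmod z)\<^sup>2 < 1" using assms by (simp add: abs_square_less_1)
  with ne show ?thesis
    by (intro that[of "(1 - (cmod z)\<^sup>2) / (cmod (\<zeta> - z))\<^sup>2"]) (auto simp: horo_fun_def field_simps)
qed

text \<open>Along a chain the Poisson kernel with pole \<open>\<zeta>\<close> has no interior minimum, so its minimum over
  a stretch is attained at an end only.\<close>

lemma horo_fun_between:
  assumes ch: "subhoro_chain n \<gamma>" and \<zeta>: "cmod \<zeta> = 1" and ab: "0 \<le> \<alpha>" "\<beta> \<le> real n"
    and xy: "\<alpha> < x" "x < \<beta>"
    and "horo_fun \<zeta> c (concat_pieces n \<gamma> \<alpha>) \<ge> 0" "horo_fun \<zeta> c (concat_pieces n \<gamma> \<beta>) \<ge> 0"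
  shows "horo_fun \<zeta> c (concat_pieces n \<gamma> x) > 0"
proof (rule ccontr)
  let ?g = "concat_pieces n \<gamma>"
  let ?P = "\<lambda>z. (1 - (cmod z)\<^sup>2) / (cmod (\<zeta> - z))\<^sup>2"
  assume neg: "\<not> ?thesis"
  have disk: "cmod (?g y) < 1" if "y \<in> {\<alpha>..\<beta>}" for y
    using concat_pieces_in_disk[OF ch, of y] that ab by auto
  have ne: "\<zeta> \<noteq> ?g y" if "y \<in> {\<alpha>..\<beta>}" for y using disk[OF that] \<zeta> by auto
  have "continuous_on {\<alpha>..\<beta>} ?g"
    by (rule continuous_on_subset[OF continuous_on_concat_pieces[OF ch]]) (use ab in auto)
  then have "continuous_on {\<alpha>..\<beta>} (\<lambda>y. ?P (?g y))"
    using ne by (intro continuous_intros) auto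
  then obtain m where m: "m \<in> {\<alpha>..\<beta>}" "\<And>y. y \<in> {\<alpha>..\<beta>} \<Longrightarrow> ?P (?g m) \<le> ?P (?g y)"
    using continuous_attains_inf[of "{\<alpha>..\<beta>}" "\<lambda>y. ?P (?g y)"] xy by auto
  have sgn: "horo_fun \<zeta> b (?g y) = (?P (?g y) - b) * (cmod (\<zeta> - ?g y))\<^sup>2" if "y \<in> {\<alpha>..\<beta>}" for y b
    using ne[OF that] by (simp add: horo_fun_def field_simps)
  have ge: "horo_fun \<zeta> (?P (?g m)) (?g y) \<ge> 0" if "y \<in> {\<alpha>..\<beta>}" for y
    unfolding sgn[OF that] using m(2)[OF that] by simp
  \<comment> \<open>Used twice: for \<open>m\<close> it forces the minimum to an end, where the
    kernel is at least \<open>c\<close>; for \<open>x\<close>, which then attains the minimum as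
    well, it gives the contradiction.\<close>
  have interior: False if "y \<in> {\<alpha>..\<beta>}" "?P (?g y) = ?P (?g m)" "\<alpha> < y" "y < \<beta>" for y
  proof -
    have "horo_fun \<zeta> (?P (?g m)) (?g y) = 0" unfolding sgn[OF that(1)] that(2) by simp
    from no_interior_min[OF ch \<zeta> _ _ this, of "min (y - \<alpha>) (\<beta> - y)"] that ab
    obtain z where "\<bar>z - y\<bar> < min (y - \<alpha>) (\<beta> - y)" "horo_fun \<zeta> (?P (?g m)) (?g z) < 0" by auto
    moreover from this have "z \<in> {\<alpha>..\<beta>}" by (auto simp: abs_less_iff)
    ultimately show False using ge[of z] by auto
  qed
  have Pc: "?P (?g y) \<ge> c \<longleftrightarrow> horo_fun \<zeta> c (?g y) \<ge> 0" if "y \<in> {\<alpha>..\<beta>}" for y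
    unfolding sgn[OF that] using ne[OF that] by (simp add: zero_le_mult_iff)
  have "horo_fun \<zeta> c (?g x) \<le> 0" using neg by simp
  then have "?P (?g x) \<le> c" using ne[of x] xy unfolding sgn[of x, simplified]
    by (auto simp: sgn mult_le_0_iff)
  moreover have "?P (?g m) \<ge> c"
  proof -
    have "m = \<alpha> \<or> m = \<beta>" using interior[OF m(1)] m(1) by fastforce
    then show ?thesis using assms(7,8) Pc[OF m(1)] by auto
  qed
  ultimately have "?P (?g x) = ?P (?g m)" using m(2)[of x] xy by auto
  then show False using interior[of x] xy by auto
qed

text \<open>If the concatenation returned to a point \<open>p\<close>, then at an intermediate point
  \<open>q\<close> the Poisson kernel of every pole would be larger than at \<open>p\<close>, by
  \<open>horo_fun_between\<close>. This is impossible, since the mean of the kernel over all poles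
  is 1 at every point of the disk. The proof replaces the integration by one well-chosen
  pole.\<close>

lemma inj_concat_pieces:
  assumes ch: "subhoro_chain n \<gamma>"
  shows "inj_on (concat_pieces n \<gamma>) {0..real n}"
proof -
  let ?g = "concat_pieces n \<gamma>"
  have main: False if ab: "0 \<le> \<alpha>" "\<beta> \<le> real n" "\<alpha> < \<beta>" and eq: "?g \<alpha> = ?g \<beta>" for \<alpha> \<beta>
  proof -
    define x where "x = (\<alpha> + \<beta>) / 2"
    have x: "\<alpha> < x" "x < \<beta>" using ab by (auto simp: x_def)
    define p q where "p = ?g \<alpha>" and "q = ?g x"
    have p: "cmod p < 1" and q: "cmod q < 1"
      using concat_pieces_in_disk[OF ch] ab x by (auto simp: p_def q_def)
    define W where "W = of_real (1 - (cmod q)\<^sup>2) * p - of_real (1 - (cmod p)\<^sup>2) * q"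
    have closer: "(1 - (cmod q)\<^sup>2) * (cmod (\<zeta> - p))\<^sup>2 > (1 - (cmod p)\<^sup>2) * (cmod (\<zeta> - q))\<^sup>2" if \<zeta>: "cmod \<zeta> = 1" for \<zeta>
    proof -
      obtain c where c: "c > 0" "horo_fun \<zeta> c p = 0"
        "\<And>b. horo_fun \<zeta> b p = (c - b) * (cmod (\<zeta> - p))\<^sup>2" "(cmod (\<zeta> - p))\<^sup>2 > 0"
        using horo_fun_zero_level[OF \<zeta> p] by metis
      have "horo_fun \<zeta> c q > 0"
        unfolding q_def using c(2) eq ab x
        by (intro horo_fun_between[OF ch \<zeta>, of \<alpha> \<beta>]) (auto simp: p_def)
      then have "1 - (cmod q)\<^sup>2 > c * (cmod (\<zeta> - q))\<^sup>2" by (simp add: horo_fun_def)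
      then have "(1 - (cmod q)\<^sup>2) * (cmod (\<zeta> - p))\<^sup>2 > c * (cmod (\<zeta> - q))\<^sup>2 * (cmod (\<zeta> - p))\<^sup>2"
        using c(4) by (rule mult_strict_right_mono)
      also have "c * (cmod (\<zeta> - q))\<^sup>2 * (cmod (\<zeta> - p))\<^sup>2 = (1 - (cmod p)\<^sup>2) * (cmod (\<zeta> - q))\<^sup>2"
        using c(2) by (simp add: horo_fun_def)
      finally show ?thesis .
    qed
    \<comment> \<open>Once the squared distances are expanded, the comparison is affine in
      \<open>\<zeta>\<close>; its strongest instance is the pole in the direction of
      \<open>W\<close>.\<close>
    have dir: "(cmod p)\<^sup>2 - (cmod q)\<^sup>2 > Re (cnj \<zeta> * W)" if \<zeta>: "cmod \<zeta> = 1" for \<zeta>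
    proof -
      have \<zeta>1: "(Re \<zeta>)\<^sup>2 + (Im \<zeta>)\<^sup>2 = 1" using \<zeta> by (metis cmod_power2 one_power2)
      have ex: "(cmod (\<zeta> - z))\<^sup>2 = 1 + (cmod z)\<^sup>2 - 2 * Re (cnj \<zeta> * z)" for z
        unfolding cmod_power2 using \<zeta>1 by (simp add: power2_eq_square algebra_simps)
      show ?thesis using closer[OF \<zeta>] unfolding ex W_def by (simp add: algebra_simps)
    qed
    have W: "(cmod p)\<^sup>2 - (cmod q)\<^sup>2 > cmod W"
    proof (cases "W = 0")
      case True then show ?thesis using dir[of 1] by simp
    next
      case False
      then have "Re (cnj (W / of_real (cmod W)) * W) = cmod W"
        by (simp add: complex_mult_cnj[of W, symmetric] cmod_power2[symmetric] power2_eq_square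
            mult.commute[of _ W] complex_norm_square[symmetric] field_simps)
      then show ?thesis using dir[of "W / of_real (cmod W)"] False by (simp add: norm_divide)
    qed
    have sq: "(cmod p)\<^sup>2 < 1" "(cmod q)\<^sup>2 < 1" using p q by (auto simp: abs_square_less_1)
    have "cmod W \<ge> cmod (of_real (1 - (cmod q)\<^sup>2) * p) - cmod (of_real (1 - (cmod p)\<^sup>2) * q)"
      unfolding W_def by (rule norm_triangle_ineq2)
    also have "cmod (of_real (1 - (cmod q)\<^sup>2) * p) - cmod (of_real (1 - (cmod p)\<^sup>2) * q) =
      (cmod p - cmod q) * (1 + cmod p * cmod q)"
      unfolding norm_mult norm_of_real using sq by (simp add: algebra_simps power2_eq_square)
    finally have 1: "(cmod p - cmod q) * (1 + cmod p * cmod q) < (cmod p - cmod q) * (cmod p + cmod q)"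
      using W by (simp add: algebra_simps power2_eq_square)
    have "(cmod p)\<^sup>2 > (cmod q)\<^sup>2" using W norm_ge_zero[of W] by linarith
    then have "cmod p > cmod q" by (simp add: power2_less_imp_less)
    then have "1 + cmod p * cmod q < cmod p + cmod q" using 1 by simp
    then have "(1 - cmod p) * (1 - cmod q) < 0" by (simp add: algebra_simps)
    then show False using p q by (simp add: mult_less_0_iff)
  qed
  show ?thesis
    by (rule inj_onI) (use main in \<open>metis atLeastAtMost_iff linorder_neqE\<close>)
qed

subsection \<open>Supporting horodisks from admissible arcs\<close>

lemma image_concat_pieces:
  assumes "subhoro_chain n \<gamma>" "k < n" "0 \<le> \<alpha>" "\<beta> \<le> 1"
  shows "concat_pieces n \<gamma> ` {real k + \<alpha>..real k + \<beta>} = \<gamma> k ` {\<alpha>..\<beta>}"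
proof -
  have "concat_pieces n \<gamma> ` {real k + \<alpha>..real k + \<beta>} = (\<lambda>x. \<gamma> k (x - real k)) ` {real k + \<alpha>..real k + \<beta>}"
    using concat_pieces_eq[OF assms(1,2)] assms(3,4) by (intro image_cong) auto
  also have "\<dots> = \<gamma> k ` (\<lambda>x. x - real k) ` {real k + \<alpha>..real k + \<beta>}" by (rule image_image[symmetric])
  also have "(\<lambda>x. x - real k) ` {real k + \<alpha>..real k + \<beta>} = {\<alpha>..\<beta>}" by simp
  finally show ?thesis .
qed

lemma image_concat_pieces_all:
  assumes "subhoro_chain n \<gamma>"
  shows "concat_pieces n \<gamma> ` {0..real n} = (\<Union>k<n. path_image (\<gamma> k))"
proof -
  have "0 < n" using assms by (simp add: subhoro_chain_def)
  then have "concat_pieces n \<gamma> ` {0..real n} = (\<Union>k<n. concat_pieces n \<gamma> ` {real k..real k + 1})"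
    by (simp add: interval_pieces image_UN)
  also have "\<dots> = (\<Union>k<n. path_image (\<gamma> k))"
    using image_concat_pieces[OF assms, of _ 0 1] by (intro SUP_cong) (auto simp: path_image_def)
  finally show ?thesis .
qed

lemma concat_pieces_ends:
  assumes "subhoro_chain n \<gamma>"
  shows "concat_pieces n \<gamma> 0 = \<gamma> 0 0" "concat_pieces n \<gamma> (real n) = \<gamma> (n - 1) 1"
  using assms concat_pieces_eq[OF assms, of 0 0] concat_pieces_eq[OF assms, of "n - 1" "real n"]
  by (auto simp: subhoro_chain_def of_nat_diff)

lemma admissible_Jordan_arc_chainE:
  assumes "admissible_Jordan_arc \<Gamma> a b"
  obtains n \<gamma> where "subhoro_chain n \<gamma>" "\<Gamma> = concat_pieces n \<gamma> ` {0..real n}"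
    "concat_pieces n \<gamma> 0 = a" "concat_pieces n \<gamma> (real n) = b"
proof -
  from assms obtain n p \<gamma> where n: "0 < n" "p 0 = a" "p n = b" and \<Gamma>: "\<Gamma> = (\<Union>k<n. path_image (\<gamma> k))"
    and pc: "\<And>k. k < n \<Longrightarrow> smooth_arc (\<gamma> k) \<and> pathstart (\<gamma> k) = p k \<and> pathfinish (\<gamma> k) = p (Suc k) \<and>
           (\<exists>\<kappa>. -2 < \<kappa> \<and> \<kappa> < 2 \<and> (\<forall>t\<in>{0..1}. hyperbolic_curvature (\<gamma> k) t = \<kappa>))"
    and tg: "\<And>k. Suc k < n \<Longrightarrow> unit_tangent (\<gamma> k) 1 = unit_tangent (\<gamma> (Suc k)) 0"
    and disk: "\<Gamma> \<subseteq> ball 0 1"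
    unfolding admissible_Jordan_arc_def by metis
  have "subhoro_piece (\<gamma> k)" if "k < n" for k
  proof -
    have "cmod (\<gamma> k t) < 1" if "t \<in> {0..1}" for t
    proof -
      have "\<gamma> k t \<in> \<Gamma>" using \<Gamma> \<open>k < n\<close> that by (auto simp: path_image_def intro!: bexI[of _ k])
      then show ?thesis using disk by auto
    qed
    then show ?thesis using pc[OF that] unfolding subhoro_piece_def smooth_arc_def by blast
  qed
  moreover have "\<gamma> k 1 = \<gamma> (Suc k) 0" if "Suc k < n" for k
    using pc[of k] pc[of "Suc k"] that by (simp add: pathstart_def pathfinish_def)
  ultimately have ch: "subhoro_chain n \<gamma>" using n tg by (simp add: subhoro_chain_def)
  have "\<gamma> 0 0 = a" using pc[of 0] n by (simp add: pathstart_def)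
  moreover have "\<gamma> (n - 1) 1 = b" using pc[of "n - 1"] n by (simp add: pathfinish_def)
  ultimately show ?thesis
    using that[OF ch] concat_pieces_ends[OF ch] image_concat_pieces_all[OF ch] \<Gamma> by simp
qed

lemma horo_fun_eq_ball:
  assumes "cmod \<zeta> = 1" "c > 0"
  shows "horo_fun \<zeta> c z = (1 + c) * ((1 / (1 + c))\<^sup>2 - (dist (of_real (c / (1 + c)) * \<zeta>) z)\<^sup>2)"
proof -
  have \<zeta>1: "(Re \<zeta>)\<^sup>2 + (Im \<zeta>)\<^sup>2 = 1" using assms by (metis cmod_power2 one_power2)
  define d where "d = 1 / (1 + c)"
  have d: "d * (1 + c) = 1" using assms by (simp add: d_def)
  have cd: "c / (1 + c) = c * d" by (simp add: d_def)
  have "Re (of_real (c * d) * \<zeta>) = c * d * Re \<zeta>" "Im (of_real (c * d) * \<zeta>) = c * d * Im \<zeta>"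
    by simp_all
  then show ?thesis
    using \<zeta>1 d unfolding horo_fun_def dist_norm cmod_power2 minus_complex.simps cd d_def[symmetric]
    by algebra
qed

lemma horo_level:
  assumes "cmod \<zeta> = 1" "c > 0"
  shows "horodisk {z. horo_fun \<zeta> c z > 0}"
    and "horo_fun \<zeta> c \<omega> = 0 \<Longrightarrow> \<omega> \<in> frontier {z. horo_fun \<zeta> c z > 0}"
proof -
  define C r where "C = of_real (c / (1 + c)) * \<zeta>" and "r = 1 / (1 + c)"
  note ball = horo_fun_eq_ball[OF assms, folded C_def r_def]
  have r: "r > 0" using assms by (simp add: r_def)
  have sg: "(0 < k * x) = (0 < x)" "(k * x = 0) = (x = 0)" if "0 < k" for k x :: real
    using that by (auto simp: zero_less_mult_iff)
  have sq: "(0 < (1 + c) * (r\<^sup>2 - d\<^sup>2)) = (d < r)" "((1 + c) * (r\<^sup>2 - d\<^sup>2) = 0) = (d = r)"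
    if "0 < r" "0 \<le> d" for r d :: real
  proof -
    have e: "(1 + c) * (r\<^sup>2 - d\<^sup>2) = ((1 + c) * (r + d)) * (r - d)" by algebra
    have k: "(1 + c) * (r + d) > 0" using assms(2) that by simp
    show "(0 < (1 + c) * (r\<^sup>2 - d\<^sup>2)) = (d < r)" unfolding e sg(1)[OF k] by simp
    show "((1 + c) * (r\<^sup>2 - d\<^sup>2) = 0) = (d = r)" unfolding e sg(2)[OF k] by auto
  qed
  have pos: "horo_fun \<zeta> c z > 0 \<longleftrightarrow> z \<in> ball C r" for z
    unfolding ball mem_ball by (rule sq(1)[OF r zero_le_dist])
  have zero: "horo_fun \<zeta> c z = 0 \<longleftrightarrow> z \<in> sphere C r" for z
    unfolding ball mem_sphere by (rule sq(2)[OF r zero_le_dist])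
  have eq: "{z. horo_fun \<zeta> c z > 0} = ball C r" by (rule set_eqI) (simp only: mem_Collect_eq pos)
  have "ball C r \<subseteq> ball 0 1"
  proof
    fix z assume "z \<in> ball C r"
    then have "horo_fun \<zeta> c z > 0" by (simp only: pos)
    moreover have "0 \<le> c * (cmod (\<zeta> - z))\<^sup>2" using assms by simp
    ultimately have "(cmod z)\<^sup>2 < 1" unfolding horo_fun_def by linarith
    then show "z \<in> ball 0 1" by (simp add: abs_square_less_1)
  qed
  moreover have "sphere C r \<inter> sphere 0 1 = {\<zeta>}"
  proof -
    have "horo_fun \<zeta> c z = 0 \<and> cmod z = 1 \<longleftrightarrow> z = \<zeta>" for z
      using assms by (auto simp: horo_fun_def)
    then show ?thesis
      by (intro set_eqI) (simp only: Int_iff zero[symmetric] mem_sphere_0 singleton_iff)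
  qed
  ultimately show "horodisk {z. horo_fun \<zeta> c z > 0}"
    unfolding eq horodisk_def using r by blast
  show "\<omega> \<in> frontier {z. horo_fun \<zeta> c z > 0}" if "horo_fun \<zeta> c \<omega> = 0"
    using that r unfolding eq by (simp add: zero)
qed

section \<open>The disk automorphism that takes \<open>\<omega>\<close> to 0, and horodisks through
  \<open>\<omega>\<close>\<close>

definition disk_shift :: "complex \<Rightarrow> complex \<Rightarrow> complex" where
  "disk_shift \<omega> z = (z - \<omega>) / (1 - cnj \<omega> * z)"

lemma disk_shift_denom:
  assumes "cmod \<omega> < 1" "cmod z \<le> 1" shows "1 - cnj \<omega> * z \<noteq> 0"
proof
  assume "1 - cnj \<omega> * z = 0"
  then have "cmod (cnj \<omega> * z) = 1" by simp
  then have "cmod \<omega> * cmod z = 1" by (simp add: norm_mult)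
  then show False using assms
    using mult_left_mono[OF assms(2) norm_ge_zero[of \<omega>]] by simp
qed

lemma disk_shift_norm:
  assumes "cmod \<omega> < 1" "cmod z \<le> 1"
  shows "(1 - (cmod (disk_shift \<omega> z))\<^sup>2) * (cmod (1 - cnj \<omega> * z))\<^sup>2 = (1 - (cmod \<omega>)\<^sup>2) * (1 - (cmod z)\<^sup>2)"
proof -
  have "(cmod (disk_shift \<omega> z))\<^sup>2 * (cmod (1 - cnj \<omega> * z))\<^sup>2 = (cmod (z - \<omega>))\<^sup>2"
    using disk_shift_denom[OF assms] by (simp add: disk_shift_def norm_divide power_divide)
  moreover have "(cmod (1 - cnj \<omega> * z))\<^sup>2 - (cmod (z - \<omega>))\<^sup>2 = (1 - (cmod \<omega>)\<^sup>2) * (1 - (cmod z)\<^sup>2)"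
    unfolding cmod_power2 by (simp add: power2_eq_square algebra_simps)
  ultimately show ?thesis by (simp add: algebra_simps)
qed

text \<open>Besides the difference formula for a Moebius map this uses \<open>cmod (1 - cnj \<omega>
  * \<zeta>) = cmod (\<zeta> - \<omega>)\<close> on the unit circle. Together with
  \<open>disk_shift_norm\<close> it says, without divisions, that the automorphism preserves Poisson
  kernels up to a factor that depends on the pole alone.\<close>

lemma disk_shift_diff:
  assumes "cmod \<omega> < 1" "cmod z \<le> 1" "cmod \<zeta> = 1"
  shows "(cmod (disk_shift \<omega> \<zeta> - disk_shift \<omega> z))\<^sup>2 * (cmod (1 - cnj \<omega> * z))\<^sup>2 * (cmod (\<zeta> - \<omega>))\<^sup>2
    = (1 - (cmod \<omega>)\<^sup>2)\<^sup>2 * (cmod (\<zeta> - z))\<^sup>2"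
proof -
  have n1: "1 - cnj \<omega> * z \<noteq> 0" "1 - cnj \<omega> * \<zeta> \<noteq> 0" using disk_shift_denom assms by auto
  have "(disk_shift \<omega> \<zeta> - disk_shift \<omega> z) * (1 - cnj \<omega> * z) * (1 - cnj \<omega> * \<zeta>) =
     (\<zeta> - \<omega>) * (1 - cnj \<omega> * z) - (z - \<omega>) * (1 - cnj \<omega> * \<zeta>)"
  proof -
    have "disk_shift \<omega> z * (1 - cnj \<omega> * z) = z - \<omega>" "disk_shift \<omega> \<zeta> * (1 - cnj \<omega> * \<zeta>) = \<zeta> - \<omega>"
      using n1 by (auto simp: disk_shift_def)
    then show ?thesis by algebra
  qed
  also have "\<dots> = (1 - \<omega> * cnj \<omega>) * (\<zeta> - z)" by (simp add: algebra_simps)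
  also have "1 - \<omega> * cnj \<omega> = of_real (1 - (cmod \<omega>)\<^sup>2)"
    by (simp only: of_real_diff of_real_1 complex_norm_square)
  finally have *: "(disk_shift \<omega> \<zeta> - disk_shift \<omega> z) * (1 - cnj \<omega> * z) * (1 - cnj \<omega> * \<zeta>) = of_real (1 - (cmod \<omega>)\<^sup>2) * (\<zeta> - z)" .
  have "cmod (1 - cnj \<omega> * \<zeta>) = cmod (\<zeta> - \<omega>)"
  proof -
    have "cmod (1 - cnj \<omega> * \<zeta>) = cmod (cnj \<zeta> * \<zeta> - cnj \<omega> * \<zeta>)"
      using assms(3) by (metis complex_norm_square mult.commute of_real_1 one_power2)
    also have "\<dots> = cmod (cnj (\<zeta> - \<omega>) * \<zeta>)" by (simp add: algebra_simps)
    also have "\<dots> = cmod (\<zeta> - \<omega>)" using assms(3) by (metis complex_mod_cnj mult.right_neutral norm_mult)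
    finally show ?thesis .
  qed
  then show ?thesis
    using arg_cong[OF *, of "\<lambda>x. (cmod x)\<^sup>2"]
    by (simp only: norm_mult norm_of_real power_mult_distrib power2_abs)
qed

lemma disk_shift_ne0: "cmod \<omega> < 1 \<Longrightarrow> cmod z \<le> 1 \<Longrightarrow> z \<noteq> \<omega> \<Longrightarrow> disk_shift \<omega> z \<noteq> 0"
  using disk_shift_denom by (simp add: disk_shift_def)

text \<open>Moving \<open>\<omega>\<close> to the origin, horodisks with \<open>\<omega>\<close> on their boundary become the disks of
  diameter one through the origin.\<close>

lemma horo_fun_disk_shift:
  assumes \<omega>: "cmod \<omega> < 1" and z: "cmod z < 1" and \<zeta>: "cmod \<zeta> = 1" and c: "horo_fun \<zeta> c \<omega> = 0"
  shows "cmod (disk_shift \<omega> \<zeta>) = 1"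
    and "horo_fun \<zeta> c z > 0 \<longleftrightarrow> Re (disk_shift \<omega> \<zeta> * cnj (disk_shift \<omega> z)) > (cmod (disk_shift \<omega> z))\<^sup>2"
proof -
  have n1: "1 - cnj \<omega> * z \<noteq> 0" "1 - cnj \<omega> * \<zeta> \<noteq> 0" using disk_shift_denom assms by auto
  show 1: "cmod (disk_shift \<omega> \<zeta>) = 1"
    using disk_shift_norm[OF \<omega>, of \<zeta>] \<zeta> n1 power2_eq_imp_eq[of "cmod (disk_shift \<omega> \<zeta>)" 1] by simp
  define \<phi> \<eta> where "\<phi> = disk_shift \<omega> z" and "\<eta> = disk_shift \<omega> \<zeta>"
  define A B C where "A = (cmod (1 - cnj \<omega> * z))\<^sup>2" and "B = (cmod (\<zeta> - \<omega>))\<^sup>2" and "C = 1 - (cmod \<omega>)\<^sup>2"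
  have pos: "A > 0" "B > 0" "C > 0"
    using n1 \<omega> \<zeta> by (auto simp: A_def B_def C_def abs_square_less_1)
  have e1: "(1 - (cmod \<phi>)\<^sup>2) * A = C * (1 - (cmod z)\<^sup>2)"
    using disk_shift_norm[OF \<omega>, of z] z by (simp add: \<phi>_def A_def C_def)
  have e2: "(cmod (\<eta> - \<phi>))\<^sup>2 * A * B = C\<^sup>2 * (cmod (\<zeta> - z))\<^sup>2"
    using disk_shift_diff[OF \<omega> _ \<zeta>, of z] z by (simp add: \<phi>_def \<eta>_def A_def B_def C_def)
  have e3: "C = c * B" using c by (simp add: horo_fun_def C_def B_def)
  have "C * horo_fun \<zeta> c z * B = C * (1 - (cmod z)\<^sup>2) * B - c * B * C * (cmod (\<zeta> - z))\<^sup>2"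
    by (simp add: horo_fun_def algebra_simps)
  also have "\<dots> = ((1 - (cmod \<phi>)\<^sup>2) - (cmod (\<eta> - \<phi>))\<^sup>2) * A * B"
    unfolding e3[symmetric] e1[symmetric] using e2 by (simp add: algebra_simps power2_eq_square)
  also have "(1 - (cmod \<phi>)\<^sup>2) - (cmod (\<eta> - \<phi>))\<^sup>2 = 2 * (Re (\<eta> * cnj \<phi>) - (cmod \<phi>)\<^sup>2)"
  proof -
    have "(Re \<eta>)\<^sup>2 + (Im \<eta>)\<^sup>2 = 1" using 1 by (metis \<eta>_def cmod_power2 one_power2)
    then show ?thesis unfolding cmod_power2 by (simp add: power2_eq_square algebra_simps)
  qed
  finally have "C * horo_fun \<zeta> c z * B = 2 * (Re (\<eta> * cnj \<phi>) - (cmod \<phi>)\<^sup>2) * A * B" .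
  then have "horo_fun \<zeta> c z > 0 \<longleftrightarrow> Re (\<eta> * cnj \<phi>) - (cmod \<phi>)\<^sup>2 > 0"
    using pos by (smt (verit) mult_pos_pos zero_less_mult_pos zero_less_mult_pos2 mult_less_0_iff)
  then show "horo_fun \<zeta> c z > 0 \<longleftrightarrow> Re (disk_shift \<omega> \<zeta> * cnj (disk_shift \<omega> z)) > (cmod (disk_shift \<omega> z))\<^sup>2"
    by (simp add: \<eta>_def \<phi>_def)
qed

lemma disk_shift_surj:
  assumes "cmod \<omega> < 1" "cmod \<eta> = 1"
  obtains \<zeta> where "cmod \<zeta> = 1" "disk_shift \<omega> \<zeta> = \<eta>"
proof -
  define \<zeta> where "\<zeta> = disk_shift (- \<omega>) \<eta>"
  have n: "1 + cnj \<omega> * \<eta> \<noteq> 0" using disk_shift_denom[of "- \<omega>" \<eta>] assms by simp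
  have "(1 - (cmod \<zeta>)\<^sup>2) * (cmod (1 + cnj \<omega> * \<eta>))\<^sup>2 = 0"
    using disk_shift_norm[of "- \<omega>" \<eta>] assms by (simp add: \<zeta>_def)
  then have 1: "cmod \<zeta> = 1" using n by (simp add: power2_eq_1_iff) (metis norm_ge_zero neg_0_le_iff_le not_one_le_zero)
  have q: "\<zeta> * (1 + cnj \<omega> * \<eta>) = \<eta> + \<omega>" using n by (simp add: \<zeta>_def disk_shift_def)
  have n2: "1 - cnj \<omega> * \<zeta> \<noteq> 0" using disk_shift_denom[of \<omega> \<zeta>] assms 1 by simp
  have "\<zeta> - \<omega> = \<eta> * (1 - cnj \<omega> * \<zeta>)" using q by (simp add: algebra_simps)
  then have "disk_shift \<omega> \<zeta> = \<eta>" using n2 by (simp add: disk_shift_def)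
  with 1 show ?thesis using that by blast
qed

text \<open>If the interval \<open>U\<close> had length at most \<open>2 * pi\<close>, then, being
  open, neither it nor any of its translates by multiples of \<open>2 * pi\<close> would contain its
  supremum.\<close>

lemma open_interval_mod_2pi:
  fixes U :: "real set"
  assumes "open U" and iv: "\<And>x y z. x \<in> U \<Longrightarrow> y \<in> U \<Longrightarrow> x \<le> z \<Longrightarrow> z \<le> y \<Longrightarrow> z \<in> U"
    and cover: "\<And>t. \<exists>k::int. t + 2 * pi * of_int k \<in> U"
  obtains t where "t \<in> U" "t + 2 * pi \<in> U"
proof (rule ccontr)
  assume "\<not> thesis"
  with that have no: "t + 2 * pi \<notin> U" if "t \<in> U" for t using that by blast
  obtain u where u: "u \<in> U" using cover by blast
  have small: "y < x + 2 * pi" if "x \<in> U" "y \<in> U" for x y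
    using no[OF that(1)] iv[OF that, of "x + 2 * pi"] pi_gt_zero by force
  define M where "M = Sup U"
  have bdd: "bdd_above U" using small[OF u] by (intro bdd_aboveI[of _ "u + 2 * pi"]) force
  have le: "x \<le> M" if "x \<in> U" for x using cSup_upper[OF that bdd] by (simp add: M_def)
  have "M \<notin> U"
  proof
    assume "M \<in> U"
    then obtain e where "e > 0" "ball M e \<subseteq> U" using assms(1) open_contains_ball by blast
    then have "M + e / 2 \<in> U" by (auto simp: dist_real_def)
    then show False using le \<open>e > 0\<close> by force
  qed
  obtain k :: int where k: "M + 2 * pi * of_int k \<in> U" using cover by blast
  then have "k \<noteq> 0" using \<open>M \<notin> U\<close> by auto
  moreover have "k \<le> 0"
    using le[OF k] pi_gt_zero by (simp add: mult_le_0_iff)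
  ultimately have "k \<le> -1" by simp
  then have "real_of_int k \<le> -1" by linarith
  then have "2 * pi * real_of_int k \<le> 2 * pi * (-1)" using pi_gt_zero by (intro mult_left_mono) auto
  then have low: "M + 2 * pi * of_int k \<le> M - 2 * pi" by simp
  obtain e where e: "e > 0" "ball (M + 2 * pi * of_int k) e \<subseteq> U"
    using assms(1) k open_contains_ball by blast
  then have "M + 2 * pi * of_int k - e / 2 \<in> U" by (auto simp: dist_real_def)
  from small[OF this] have "\<And>y. y \<in> U \<Longrightarrow> y < M - e / 2" using low by fastforce
  then have "M \<le> M - e / 2" unfolding M_def using u by (intro cSup_least) force+
  then show False using e(1) by simp
qed

lemma horo_convex_if_arcs:
  fixes G :: "complex set"
  assumes opn: "open G" and con: "connected G" and disk: "G \<subseteq> ball 0 1"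
    and sc: "simply_connected G"
    and arcs: "\<And>a b. a \<in> G \<Longrightarrow> b \<in> G \<Longrightarrow> a \<noteq> b \<Longrightarrow> \<exists>\<Gamma>. admissible_Jordan_arc \<Gamma> a b \<and> \<Gamma> \<subseteq> G"
  shows "horo_convex G"
  unfolding horo_convex_def
proof (rule ballI, rule ccontr)
  fix \<omega> assume "\<omega> \<in> ball 0 1 \<inter> frontier G"
    and no: "\<nexists>H. horodisk H \<and> \<omega> \<in> frontier H \<and> G \<inter> H = {}"
  then have \<omega>: "cmod \<omega> < 1" and \<omega>G: "\<omega> \<notin> G" using opn frontier_disjoint_eq by auto
  have Gd: "cmod z < 1" if "z \<in> G" for z using disk that by auto
  have meets: "\<exists>z\<in>G. horo_fun \<zeta> c z > 0" if l: "cmod \<zeta> = 1" "horo_fun \<zeta> c \<omega> = 0" for \<zeta> c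
  proof -
    have "c > 0"
    proof -
      obtain d where "d > 0" "\<And>b. horo_fun \<zeta> b \<omega> = (d - b) * (cmod (\<zeta> - \<omega>))\<^sup>2" "(cmod (\<zeta> - \<omega>))\<^sup>2 > 0"
        using horo_fun_zero_level[OF l(1) \<omega>] by metis
      then show ?thesis using l(2) by (metis less_irrefl mult_eq_0_iff right_minus_eq)
    qed
    then show ?thesis using no horo_level[OF l(1), of c] l(2) by blast
  qed
  define \<phi> where "\<phi> = disk_shift \<omega>"
  have "continuous_on G \<phi>"
    unfolding \<phi>_def disk_shift_def using disk_shift_denom[OF \<omega>] Gd less_imp_le
    by (intro continuous_intros) blast
  moreover have "\<phi> z \<noteq> 0" if "z \<in> G" for z
    unfolding \<phi>_def using disk_shift_ne0[OF \<omega>] Gd[OF that] \<omega>G that by (metis less_imp_le)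
  ultimately obtain g where g: "continuous_on G g" "\<And>z. z \<in> G \<Longrightarrow> \<phi> z = exp (g z)"
    using continuous_logarithm_on_simply_connected[OF _ sc open_imp_locally_path_connected[OF opn]] by metis
  define A where "A = (\<lambda>z. Im (g z))"
  have contA: "continuous_on G A" unfolding A_def using g(1) by (intro continuous_intros)
  have \<phi>pos: "cmod (\<phi> z) > 0" if "z \<in> G" for z using g(2)[OF that] by simp
  have \<phi>1: "cmod (\<phi> z) < 1" if "z \<in> G" for z
  proof -
    have "(1 - (cmod (\<phi> z))\<^sup>2) * (cmod (1 - cnj \<omega> * z))\<^sup>2 > 0"
      unfolding \<phi>_def disk_shift_norm[OF \<omega> less_imp_le[OF Gd[OF that]]]
      using \<omega> Gd[OF that] by (simp add: abs_square_less_1)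
    then show ?thesis by (simp add: zero_less_mult_iff abs_square_less_1)
  qed
  have re: "Re (exp (\<i> * of_real t) * cnj (\<phi> z)) = cmod (\<phi> z) * cos (t - A z)" if "z \<in> G" for t z
    unfolding g(2)[OF that] A_def
    by (simp add: Re_exp Im_exp cos_diff algebra_simps)
  have crit: "horo_fun \<zeta> c z > 0 \<longleftrightarrow> cos (t - A z) > cmod (\<phi> z)"
    if "z \<in> G" "cmod \<zeta> = 1" "horo_fun \<zeta> c \<omega> = 0" "disk_shift \<omega> \<zeta> = exp (\<i> * of_real t)" for z \<zeta> c t
  proof -
    have "horo_fun \<zeta> c z > 0 \<longleftrightarrow> cmod (\<phi> z) * cmod (\<phi> z) < cmod (\<phi> z) * cos (t - A z)"
      using horo_fun_disk_shift(2)[OF \<omega> Gd[OF that(1)] that(2,3)]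
      unfolding \<phi>_def[symmetric] that(4)[folded \<phi>_def] re[OF that(1)] power2_eq_square .
    then show ?thesis using \<phi>pos[OF that(1)] by simp
  qed
  have pole: "\<exists>\<zeta> c. cmod \<zeta> = 1 \<and> horo_fun \<zeta> c \<omega> = 0 \<and> disk_shift \<omega> \<zeta> = exp (\<i> * of_real t)" for t
    using disk_shift_surj[OF \<omega>, of "exp (\<i> * of_real t)"] horo_fun_zero_level[OF _ \<omega>]
    by (metis norm_exp_i_times)
  \<comment> \<open>In the coordinate \<open>\<phi>\<close> the horodisk of direction
    \<open>t\<close> lies in the half-plane of points whose argument differs from \<open>t\<close>
    by less than a quarter turn. \<open>U\<close> collects the real numbers \<open>t\<close> for
    which it contains a point of \<open>G\<close> whose branch \<open>A\<close> is this close to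
    \<open>t\<close> itself, not merely modulo \<open>2 * pi\<close>.\<close>
  define U where "U = {t. \<exists>z\<in>G. \<bar>t - A z\<bar> < pi / 2 \<and> cos (t - A z) > cmod (\<phi> z)}"
  have "open U"
  proof -
    have "open {t. \<bar>t - A z\<bar> < pi / 2 \<and> cos (t - A z) > cmod (\<phi> z)}" for z
      by (intro open_Collect_conj open_Collect_less continuous_intros)
    moreover have "U = (\<Union>z\<in>G. {t. \<bar>t - A z\<bar> < pi / 2 \<and> cos (t - A z) > cmod (\<phi> z)})"
      by (auto simp: U_def)
    ultimately show ?thesis by auto
  qed
  moreover have "z \<in> U" if xy: "x \<in> U" "y \<in> U" "x \<le> z" "z \<le> y" for x y z
  proof -
    obtain p where p: "p \<in> G" "\<bar>x - A p\<bar> < pi / 2" "cos (x - A p) > cmod (\<phi> p)" using xy(1) by (auto simp: U_def)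
    obtain q where q: "q \<in> G" "\<bar>y - A q\<bar> < pi / 2" "cos (y - A q) > cmod (\<phi> q)" using xy(2) by (auto simp: U_def)
    have nearer: "cos (s - A r) \<ge> cos (t - A r)" if "\<bar>s - A r\<bar> \<le> \<bar>t - A r\<bar>" "\<bar>t - A r\<bar> < pi / 2" for s t r
    proof -
      have "\<bar>t - A r\<bar> \<le> pi" using that(2) pi_gt_zero by linarith
      then show ?thesis
        using that(1) cos_monotone_0_pi_le[of "\<bar>s - A r\<bar>" "\<bar>t - A r\<bar>"] by (simp add: cos_abs_real)
    qed
    \<comment> \<open>Turning the direction towards the argument of a point keeps that point in the
      horodisk, which settles the first two cases. In the third, connectedness gives a point of
      \<open>G\<close> whose argument is exactly \<open>z\<close>; it lies on the axis of the
      horodisk.\<close>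
    consider "z \<le> A p" | "z \<ge> A q" | "A p \<le> z" "z \<le> A q" by linarith
    then show ?thesis
    proof cases
      case 1
      then have "\<bar>z - A p\<bar> \<le> \<bar>x - A p\<bar>" using xy by linarith
      then have "\<bar>z - A p\<bar> < pi / 2" "cos (z - A p) > cmod (\<phi> p)"
        using p(2,3) nearer[of z p x] by linarith+
      then show ?thesis unfolding U_def using p(1) by blast
    next
      case 2
      then have "\<bar>z - A q\<bar> \<le> \<bar>y - A q\<bar>" using xy by linarith
      then have "\<bar>z - A q\<bar> < pi / 2" "cos (z - A q) > cmod (\<phi> q)"
        using q(2,3) nearer[of z q y] by linarith+
      then show ?thesis unfolding U_def using q(1) by blast
    next
      case 3
      have "z \<in> A ` G"
        by (rule connectedD_interval[OF connected_continuous_image[OF contA con] imageI[OF p(1)] imageI[OF q(1)] 3])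
      then obtain r where "r \<in> G" "A r = z" by blast
      then have "\<bar>z - A r\<bar> < pi / 2" "cos (z - A r) > cmod (\<phi> r)" using \<phi>1[of r] by auto
      then show ?thesis unfolding U_def using \<open>r \<in> G\<close> by blast
    qed
  qed
  moreover have "\<exists>k::int. t + 2 * pi * of_int k \<in> U" for t
  proof -
    obtain \<zeta> c where \<zeta>: "cmod \<zeta> = 1" "horo_fun \<zeta> c \<omega> = 0" "disk_shift \<omega> \<zeta> = exp (\<i> * of_real t)"
      using pole by blast
    obtain z where z: "z \<in> G" "horo_fun \<zeta> c z > 0" using meets[OF \<zeta>(1,2)] by blast
    then have cz: "cos (t - A z) > cmod (\<phi> z)" using crit[OF z(1) \<zeta>] by simp
    \<comment> \<open>Rounding moves the difference of the arguments into \<open>[-pi, pi]\<close>;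
      the positive cosine then confines it to a quarter turn on either side.\<close>
    define k where "k = - round ((t - A z) / (2 * pi))"
    define s where "s = t + 2 * pi * of_int k - A z"
    have "cos s = cos (t - A z)"
      unfolding s_def using cos_int_2pin[of k] sin_int_2pin[of k]
      by (metis (no_types, opaque_lifting) add_diff_eq add.commute diff_add_eq cos_add mult.right_neutral mult_zero_right diff_zero)
    then have cs: "cos s > cmod (\<phi> z)" using cz by simp
    have "\<bar>(t - A z) / (2 * pi) - round ((t - A z) / (2 * pi))\<bar> \<le> 1 / 2"
      using of_int_round_abs_le[of "(t - A z) / (2 * pi)"] by (simp add: abs_minus_commute)
    moreover have "s = 2 * pi * ((t - A z) / (2 * pi) - round ((t - A z) / (2 * pi)))"
      by (simp add: s_def k_def field_simps)
    ultimately have "\<bar>s\<bar> \<le> pi" by (simp add: abs_mult)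
    have "\<bar>s\<bar> < pi / 2"
    proof (rule ccontr)
      assume "\<not> ?thesis"
      then have "cos \<bar>s\<bar> \<le> cos (pi / 2)" using \<open>\<bar>s\<bar> \<le> pi\<close> by (intro cos_monotone_0_pi_le) auto
      then show False using cs \<phi>pos[OF z(1)] by (simp add: cos_abs_real)
    qed
    then show ?thesis unfolding U_def using cs z(1) s_def by blast
  qed
  ultimately obtain t where "t \<in> U" "t + 2 * pi \<in> U"
    using open_interval_mod_2pi[of U] by metis
  then obtain p q where p: "p \<in> G" "\<bar>t - A p\<bar> < pi / 2" "cos (t - A p) > cmod (\<phi> p)"
    and q: "q \<in> G" "\<bar>t + 2 * pi - A q\<bar> < pi / 2" "cos (t + 2 * pi - A q) > cmod (\<phi> q)"
    by (auto simp: U_def)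
  have "cos (t + 2 * pi - A q) = cos (t - A q)"
    using cos_periodic[of "t - A q"] by (simp add: algebra_simps)
  with q(3) have q3: "cos (t - A q) > cmod (\<phi> q)" by simp
  have "A p < A q" using p(2) q(2) pi_gt_zero by linarith
  then have "p \<noteq> q" by auto
  then obtain \<Gamma> where \<Gamma>: "admissible_Jordan_arc \<Gamma> p q" "\<Gamma> \<subseteq> G" using arcs p(1) q(1) by blast
  obtain n \<gamma> where ch: "subhoro_chain n \<gamma>" and im: "\<Gamma> = concat_pieces n \<gamma> ` {0..real n}"
    and ends: "concat_pieces n \<gamma> 0 = p" "concat_pieces n \<gamma> (real n) = q"
    using admissible_Jordan_arc_chainE[OF \<Gamma>(1)] .
  obtain \<zeta> c where \<zeta>: "cmod \<zeta> = 1" "horo_fun \<zeta> c \<omega> = 0" "disk_shift \<omega> \<zeta> = exp (\<i> * of_real t)"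
    using pole by blast
  have stay: "cos (t - A z) > 0" if "z \<in> \<Gamma>" for z
  proof -
    obtain x where x: "x \<in> {0..real n}" "z = concat_pieces n \<gamma> x" using \<open>z \<in> \<Gamma>\<close> unfolding im by blast
    have pq: "horo_fun \<zeta> c p > 0" "horo_fun \<zeta> c q > 0"
      using crit[OF _ \<zeta>] p q q3 by auto
    have "horo_fun \<zeta> c z > 0"
    proof (cases "x = 0 \<or> x = real n")
      case True then show ?thesis using pq ends x(2) by auto
    next
      case False
      then show ?thesis
        unfolding x(2) using x(1) pq ends
        by (intro horo_fun_between[OF ch \<zeta>(1), of 0 "real n"]) auto
    qed
    moreover have "z \<in> G" using that \<Gamma>(2) by blast
    ultimately show ?thesis using crit[OF _ \<zeta>, of z] \<phi>pos[of z] by linarith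
  qed
  have "connected \<Gamma>"
    unfolding im by (intro connected_continuous_image continuous_on_concat_pieces[OF ch]) auto
  then have c: "connected (A ` \<Gamma>)"
    using contA \<Gamma>(2) by (intro connected_continuous_image) (auto intro: continuous_on_subset)
  have pq: "p \<in> \<Gamma>" "q \<in> \<Gamma>" using im ends by force+
  \<comment> \<open>Along \<open>\<Gamma>\<close> the branch \<open>A\<close> has to pass the value
    \<open>t + pi / 2\<close>, which belongs to the edge of the half-plane that contains the
    horodisk.\<close>
  have "A p \<le> t + pi / 2" "t + pi / 2 \<le> A q" using p(2) q(2) pi_gt_zero by linarith+
  then have "t + pi / 2 \<in> A ` \<Gamma>"
    by (rule connectedD_interval[OF c imageI[OF pq(1)] imageI[OF pq(2)]])
  then obtain z where "z \<in> \<Gamma>" "A z = t + pi / 2" by (metis imageE)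
  then show False using stay[of z] by simp
qed

subsection \<open>Chains of circular arcs\<close>

text \<open>All disjointness requirements come from \<open>inj_concat_pieces\<close>: equal points
  have equal parameters \<open>j + s = k + t\<close>, which for \<open>j < k\<close> leaves only the
  joint of consecutive pieces.\<close>

lemma admissible_Jordan_arc_of_chain:
  assumes ch: "subhoro_chain n \<gamma>"
  shows "admissible_Jordan_arc (\<Union>k<n. path_image (\<gamma> k)) (\<gamma> 0 0) (\<gamma> (n - 1) 1)"
proof -
  let ?g = "concat_pieces n \<gamma>"
  have n: "0 < n" using ch by (simp add: subhoro_chain_def)
  note inj = inj_concat_pieces[OF ch] and eq = concat_pieces_eq[OF ch]
  have kn: "real k + 1 \<le> real n" if "k < n" for k using that by linarith
  define g where "g = (\<lambda>t. ?g (real n * t))"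
  have sc: "(\<lambda>t. real n * t) ` {0..1} = {0..real n}"
    using n image_mult_atLeastAtMost[of "real n" 0 1] by simp
  have "arc g"
    unfolding arc_def path_def
  proof
    show "continuous_on {0..1} g"
      unfolding g_def
      by (rule continuous_on_compose2[OF continuous_on_concat_pieces[OF ch]])
        (use sc in \<open>auto intro!: continuous_intros\<close>)
    have "inj_on (?g \<circ> (\<lambda>t. real n * t)) {0..1}"
      by (rule comp_inj_on) (use n sc inj in \<open>auto simp: inj_on_def\<close>)
    then show "inj_on g {0..1}" by (simp add: g_def comp_def)
  qed
  moreover have "path_image g = (\<Union>k<n. path_image (\<gamma> k))"
  proof -
    have "path_image g = ?g ` ((\<lambda>t. real n * t) ` {0..1})"
      by (simp only: path_image_def g_def image_image)
    then show ?thesis by (simp only: sc image_concat_pieces_all[OF ch])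
  qed
  moreover have "pathstart g = \<gamma> 0 0" "pathfinish g = \<gamma> (n - 1) 1"
    using concat_pieces_ends[OF ch] by (auto simp: g_def pathstart_def pathfinish_def)
  ultimately have J: "Jordan_arc (\<Union>k<n. path_image (\<gamma> k)) (\<gamma> 0 0) (\<gamma> (n - 1) 1)"
    unfolding Jordan_arc_def by blast
  have pc: "subhoro_piece (\<gamma> k)" if "k < n" for k using ch that by (simp add: subhoro_chain_def)
  have disk: "(\<Union>k<n. path_image (\<gamma> k)) \<subseteq> ball 0 1"
    using subhoro_pieceD(4)[OF pc] by (auto simp: path_image_def)
  have same: "real j + s = real k + t"
    if "j < n" "k < n" "s \<in> {0..1}" "t \<in> {0..1}" "\<gamma> j s = \<gamma> k t" for j k s t
  proof (rule inj_onD[OF inj])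
    show "?g (real j + s) = ?g (real k + t)"
      using eq[of j "real j + s"] eq[of k "real k + t"] that by simp
    show "real j + s \<in> {0..real n}" "real k + t \<in> {0..real n}" using kn[OF that(1)] kn[OF that(2)] that by auto
  qed
  \<comment> \<open>Joints are read off as end points of pieces, since \<open>\<gamma> n\<close>
    lies beyond the chain and cannot supply \<open>p n\<close>.\<close>
  define p where "p = (\<lambda>k. if k = 0 then \<gamma> 0 0 else \<gamma> (k - 1) 1)"
  have joint: "\<gamma> k 1 = \<gamma> (Suc k) 0" "unit_tangent (\<gamma> k) 1 = unit_tangent (\<gamma> (Suc k)) 0" if "Suc k < n" for k
    using ch that by (auto simp: subhoro_chain_def)
  have start: "pathstart (\<gamma> k) = p k" if "k < n" for k
    using that joint(1)[of "k - 1"] by (cases k) (auto simp: p_def pathstart_def)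
  have smooth: "smooth_arc (\<gamma> k)" if "k < n" for k
  proof -
    have "inj_on (\<gamma> k) {0..1}" by (rule inj_onI) (use same[OF that that] in auto)
    then have "arc (\<gamma> k)"
      using continuous_on_subhoro_piece[OF pc[OF that]] by (simp add: arc_def path_def)
    then show ?thesis using pc[OF that] unfolding smooth_arc_def subhoro_piece_def by blast
  qed
  have meet: "path_image (\<gamma> j) \<inter> path_image (\<gamma> k) = (if k = Suc j then {p k} else {})"
    if jk: "j < k" "k < n" for j k
  proof -
    have "s = 1 \<and> t = 0 \<and> k = Suc j" if "s \<in> {0..1}" "t \<in> {0..1}" "\<gamma> j s = \<gamma> k t" for s t
    proof -
      have e: "real j + s = real k + t" using same[of j k s t] jk that by auto
      have "real j + 1 \<le> real k" using jk(1) by linarith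
      then have "s = 1" "t = 0" "real k = real j + 1" using e that by auto
      then show ?thesis by linarith
    qed
    moreover have "\<gamma> j 1 = \<gamma> k 0" "p k = \<gamma> j 1" if "k = Suc j"
      using joint(1)[of j] jk that by (auto simp: p_def)
    ultimately show ?thesis
    proof -
      assume u: "\<And>s t. s \<in> {0..1} \<Longrightarrow> t \<in> {0..1} \<Longrightarrow> \<gamma> j s = \<gamma> k t \<Longrightarrow> s = 1 \<and> t = 0 \<and> k = Suc j"
        and v: "k = Suc j \<Longrightarrow> \<gamma> j 1 = \<gamma> k 0" "k = Suc j \<Longrightarrow> p k = \<gamma> j 1"
      show ?thesis
      proof (cases "k = Suc j")
        case True
        have "p k \<in> path_image (\<gamma> j) \<inter> path_image (\<gamma> k)"
          using v[OF True] unfolding path_image_def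
          by (metis IntI atLeastAtMost_iff imageI order_refl zero_le_one)
        moreover have "x = p k" if x: "x \<in> path_image (\<gamma> j) \<inter> path_image (\<gamma> k)" for x
        proof -
          obtain s t where st: "s \<in> {0..1}" "t \<in> {0..1}" "x = \<gamma> j s" "x = \<gamma> k t"
            using x unfolding path_image_def by blast
          then have "s = 1" using u[of s t] by auto
          then show ?thesis using st v[OF True] by simp
        qed
        ultimately have "path_image (\<gamma> j) \<inter> path_image (\<gamma> k) = {p k}" by blast
        then show ?thesis unfolding if_P[OF True] .
      next
        case False
        then have "path_image (\<gamma> j) \<inter> path_image (\<gamma> k) = {}" using u unfolding path_image_def by blast
        then show ?thesis unfolding if_not_P[OF False] .
      qed
    qed
  qed
  have curv: "\<exists>\<kappa>. -2 < \<kappa> \<and> \<kappa> < 2 \<and> (\<forall>t\<in>{0..1}. hyperbolic_curvature (\<gamma> k) t = \<kappa>)" if "k < n" for k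
    using pc[OF that] unfolding subhoro_piece_def by blast
  have fin: "pathfinish (\<gamma> k) = p (Suc k)" for k by (simp add: p_def pathfinish_def)
  have ends: "p 0 = \<gamma> 0 0" "p n = \<gamma> (n - 1) 1" using n by (auto simp: p_def)
  show ?thesis
    unfolding admissible_Jordan_arc_def
    by (intro conjI J disk exI[of _ n] exI[of _ p] exI[of _ \<gamma>] allI impI refl n ends; (elim conjE)?)
      (assumption | rule smooth start fin curv meet joint(2))+
qed

text \<open>The arc of signed Euclidean curvature \<open>k\<close> and length \<open>l\<close> that leaves \<open>P\<close> in the direction
  \<open>e\<close>, followed at constant speed.\<close>

definition circ_arc :: "complex \<Rightarrow> complex \<Rightarrow> real \<Rightarrow> real \<Rightarrow> real \<Rightarrow> complex" where
  "circ_arc P e k l t =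
     (if k = 0 then P + of_real (l * t) * e
      else P + e * (exp (\<i> * of_real (k * l * t)) - 1) / (\<i> * of_real k))"

text \<open>These are the derivatives of all orders that \<open>subhoro_piece\<close> asks for. For
  \<open>k = 0\<close> the formula remains correct because the zeroth power of 0 is 1.\<close>

definition circ_arc_deriv :: "complex \<Rightarrow> complex \<Rightarrow> real \<Rightarrow> real \<Rightarrow> nat \<Rightarrow> real \<Rightarrow> complex" where
  "circ_arc_deriv P e k l m t =
     (if m = 0 then circ_arc P e k l t
      else of_real l * e * (\<i> * of_real (k * l)) ^ (m - 1) * exp (\<i> * of_real (k * l * t)))"

lemma has_vector_derivative_exp_ii:
  "((\<lambda>t. exp (\<i> * of_real (c * t))) has_vector_derivative \<i> * of_real c * exp (\<i> * of_real (c * t))) (at t within S)"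
proof -
  have "((\<lambda>z. exp (\<i> * (of_real c * z))) has_field_derivative \<i> * of_real c * exp (\<i> * (of_real c * of_real t)))
      (at (of_real t))"
    by (auto intro!: derivative_eq_intros)
  from has_vector_derivative_real_field[OF this] show ?thesis by simp
qed

lemma circ_arc_has_derivs:
  "(circ_arc_deriv P e k l m has_vector_derivative circ_arc_deriv P e k l (Suc m) t) (at t within S)"
proof (cases m)
  case 0
  show ?thesis
  proof (cases "k = 0")
    case True
    have "((\<lambda>t. P + of_real t * (of_real l * e)) has_vector_derivative of_real l * e) (at t within S)"
      by (auto intro!: derivative_eq_intros simp: has_vector_derivative_of_real)
    then show ?thesis using 0 True
      by (simp add: circ_arc_deriv_def[abs_def] circ_arc_def[abs_def] mult_ac)
  next
    case False
    have "((\<lambda>t. P + e * (exp (\<i> * of_real (k * l * t)) - 1) / (\<i> * of_real k)) has_vector_derivative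
       e * (\<i> * of_real (k * l) * exp (\<i> * of_real (k * l * t))) / (\<i> * of_real k)) (at t within S)"
      by (rule derivative_eq_intros has_vector_derivative_exp_ii refl | simp)+
    then show ?thesis using 0 False
      by (simp add: circ_arc_deriv_def[abs_def] circ_arc_def[abs_def] mult_ac)
  qed
next
  case (Suc j)
  have "((\<lambda>t. of_real l * e * (\<i> * of_real (k * l)) ^ j * exp (\<i> * of_real (k * l * t))) has_vector_derivative
     of_real l * e * (\<i> * of_real (k * l)) ^ j * (\<i> * of_real (k * l) * exp (\<i> * of_real (k * l * t)))) (at t within S)"
    by (rule has_vector_derivative_mult_right) (rule has_vector_derivative_exp_ii)
  then show ?thesis using Suc by (simp add: circ_arc_deriv_def[abs_def] mult_ac)
qed

lemma circ_arc_0 [simp]: "circ_arc P e k l 0 = P"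
  by (simp add: circ_arc_def)

lemma circ_arc_velocity:
  assumes "t \<in> {0..1}"
  shows "velocity (circ_arc P e k l) t = of_real l * e * exp (\<i> * of_real (k * l * t))"
    and "acceleration (circ_arc P e k l) t = \<i> * of_real (k * l) * (of_real l * e * exp (\<i> * of_real (k * l * t)))"
proof -
  have D: "circ_arc_deriv P e k l 0 = circ_arc P e k l" by (simp add: circ_arc_deriv_def fun_eq_iff)
  note * = derivatives_of_smooth(3,4)[OF D circ_arc_has_derivs assms]
  show "velocity (circ_arc P e k l) t = of_real l * e * exp (\<i> * of_real (k * l * t))"
    unfolding * by (simp add: circ_arc_deriv_def)
  show "acceleration (circ_arc P e k l) t = \<i> * of_real (k * l) * (of_real l * e * exp (\<i> * of_real (k * l * t)))"
    unfolding * by (simp add: circ_arc_deriv_def)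
qed

lemma circ_arc_unit_tangent:
  assumes "t \<in> {0..1}" "l > 0" "cmod e = 1"
  shows "unit_tangent (circ_arc P e k l) t = e * exp (\<i> * of_real (k * l * t))"
  using assms unfolding unit_tangent_def circ_arc_velocity[OF assms(1)] by (simp add: norm_mult)

lemma circ_arc_eq:
  assumes "k \<noteq> 0"
  shows "\<i> * of_real k * circ_arc P e k l t = \<i> * of_real k * P + e * exp (\<i> * of_real (k * l * t)) - e"
  using assms by (simp add: circ_arc_def field_simps)

text \<open>Along the arc the unit tangent satisfies \<open>T - e = \<i> * k * (z - P)\<close>. With
  \<open>cmod T = cmod e = 1\<close> this makes the curvature at \<open>z\<close> equal to that at
  the starting point.\<close>

lemma circ_arc_hyperbolic_curvature:
  assumes t: "t \<in> {0..1}" and l: "l > 0" and e: "cmod e = 1"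
  shows "hyperbolic_curvature (circ_arc P e k l) t = (1 - (cmod P)\<^sup>2) * k + 2 * Im (cnj P * e)"
proof -
  define T where "T = e * exp (\<i> * of_real (k * l * t))"
  define z where "z = circ_arc P e k l t"
  have T1: "cmod T = 1" using e by (simp add: T_def norm_mult)
  have v: "velocity (circ_arc P e k l) t = of_real l * T"
    unfolding circ_arc_velocity[OF t] by (simp add: T_def)
  have a: "acceleration (circ_arc P e k l) t = \<i> * of_real (k * l) * (of_real l * T)"
    unfolding circ_arc_velocity[OF t] by (simp add: T_def)
  have TT: "(Re T)\<^sup>2 + (Im T)\<^sup>2 = 1" using T1 by (metis cmod_power2 one_power2)
  have ee: "(Re e)\<^sup>2 + (Im e)\<^sup>2 = 1" using e by (metis cmod_power2 one_power2)
  have "euclidean_curvature (circ_arc P e k l) t = Im (cnj (of_real l * T) * (\<i> * of_real (k * l) * (of_real l * T))) / l ^ 3"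
    unfolding euclidean_curvature_def v a using l T1 by (simp add: norm_mult)
  also have "cnj (of_real l * T) * (\<i> * of_real (k * l) * (of_real l * T)) = \<i> * of_real (k * l ^ 3) * (T * cnj T)"
    by (simp add: power3_eq_cube mult_ac)
  also have "T * cnj T = 1" using T1 by (simp add: complex_norm_square[symmetric])
  finally have K: "euclidean_curvature (circ_arc P e k l) t = k" using l by simp
  have U: "unit_tangent (circ_arc P e k l) t = T"
    unfolding T_def by (rule circ_arc_unit_tangent[OF t l e])
  have "(1 - (cmod z)\<^sup>2) * k + 2 * Im (cnj z * T) = (1 - (cmod P)\<^sup>2) * k + 2 * Im (cnj P * e)"
  proof (cases "k = 0")
    case True
    then have "z = P + of_real (l * t) * e" "T = e" by (auto simp: z_def T_def circ_arc_def)
    then show ?thesis using True by (simp add: algebra_simps)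
  next
    case False
    have "\<i> * of_real k * z = \<i> * of_real k * P + T - e"
      unfolding z_def T_def by (rule circ_arc_eq[OF False])
    then have "Re T = Re e - k * Im z + k * Im P" "Im T = Im e + k * Re z - k * Re P"
      by (auto simp: complex_eq_iff)
    then have Te: "Re T = Re e - k * (Im z - Im P)" "Im T = Im e + k * (Re z - Re P)"
      by (auto simp: algebra_simps)
    have "k * (k * ((Re z - Re P)\<^sup>2 + (Im z - Im P)\<^sup>2) + 2 * (Im e * (Re z - Re P) - Re e * (Im z - Im P))) = 0"
      using TT ee unfolding Te by algebra
    then have q: "k * ((Re z - Re P)\<^sup>2 + (Im z - Im P)\<^sup>2) + 2 * (Im e * (Re z - Re P) - Re e * (Im z - Im P)) = 0"
      using False by simp
    have "Im (cnj z * T) = Re z * Im T - Im z * Re T" "Im (cnj P * e) = Re P * Im e - Im P * Re e" by simp_all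
    then show ?thesis using q unfolding cmod_power2 Te by algebra
  qed
  then show ?thesis unfolding hyperbolic_curvature_def K U z_def .
qed

lemma subhoro_piece_circ_arc:
  assumes "l > 0" "cmod e = 1" "\<And>t. t \<in> {0..1} \<Longrightarrow> cmod (circ_arc P e k l t) < 1"
    and "\<bar>(1 - (cmod P)\<^sup>2) * k + 2 * Im (cnj P * e)\<bar> < 2"
  shows "subhoro_piece (circ_arc P e k l)"
  unfolding subhoro_piece_def
proof (intro conjI)
  show "\<exists>D. D 0 = circ_arc P e k l \<and>
      (\<forall>m. \<forall>t\<in>{0..1::real}. (D m has_vector_derivative D (Suc m) t) (at t within {0..1}))"
    using circ_arc_has_derivs by (intro exI[of _ "circ_arc_deriv P e k l"]) (auto simp: circ_arc_deriv_def)
  show "\<forall>t\<in>{0..1}. velocity (circ_arc P e k l) t \<noteq> 0 \<and> cmod (circ_arc P e k l t) < 1"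
    using assms by (auto simp: circ_arc_velocity)
  show "\<exists>\<kappa>>-2. \<kappa> < 2 \<and> (\<forall>t\<in>{0..1}. hyperbolic_curvature (circ_arc P e k l) t = \<kappa>)"
    using assms(4) circ_arc_hyperbolic_curvature[OF _ assms(1,2), of _ P k]
    by (intro exI[of _ "(1 - (cmod P)\<^sup>2) * k + 2 * Im (cnj P * e)"]) auto
qed

lemma cmod_exp_ii_diff_le: "cmod (exp (\<i> * of_real x) - 1) \<le> \<bar>x\<bar>"
proof -
  have "exp (\<i> * of_real x) = cis x" by (simp add: cis_conv_exp)
  then have "(cmod (exp (\<i> * of_real x) - 1))\<^sup>2 = (cos x - 1)\<^sup>2 + (sin x)\<^sup>2"
    by (simp add: cmod_power2)
  also have "\<dots> = 2 - 2 * cos x" using sin_cos_squared_add[of x] by (simp add: power2_eq_square algebra_simps)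
  also have "\<dots> = (2 * sin (x / 2))\<^sup>2"
    using cos_double_sin[of "x / 2"] by (simp add: power2_eq_square)
  also have "\<dots> \<le> x\<^sup>2"
    using abs_sin_x_le_abs_x[of "x / 2"] by (intro abs_le_square_iff[THEN iffD1]) (simp add: abs_mult)
  finally show ?thesis by (metis abs_le_square_iff abs_norm_cancel)
qed

lemma circ_arc_near:
  assumes "l > 0" "cmod e = 1" "t \<in> {0..1}"
  shows "cmod (circ_arc P e k l t - P) \<le> l"
proof (cases "k = 0")
  case True
  then show ?thesis using assms by (simp add: circ_arc_def norm_mult)
next
  case False
  have "cmod (circ_arc P e k l t - P) = cmod (exp (\<i> * of_real (k * l * t)) - 1) / \<bar>k\<bar>"
    using False assms by (simp add: circ_arc_def norm_mult norm_divide)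
  also have "\<dots> \<le> \<bar>k * l * t\<bar> / \<bar>k\<bar>" by (intro divide_right_mono cmod_exp_ii_diff_le) auto
  also have "\<dots> = l * t" using False assms by (simp add: abs_mult)
  also have "\<dots> \<le> l" using assms by simp
  finally show ?thesis .
qed

text \<open>Rounding a corner: the circle tangent to both legs at distance \<open>\<tau>\<close> from the vertex has
  curvature \<open>x / \<tau>\<close>, where \<open>x\<close> is the tangent of half the turning angle.\<close>

lemma circ_arc_corner:
  assumes g: "cmod g = 1" "g \<noteq> -1" and \<tau>: "\<tau> > 0" and e: "cmod e = 1"
    and x: "x = Im g / (1 + Re g)"
  obtains l where "0 < l" "l \<le> 2 * \<tau>" "e * exp (\<i> * of_real (x / \<tau> * l)) = e * g"
    "circ_arc P e (x / \<tau>) l 1 = P + of_real \<tau> * e + of_real \<tau> * (e * g)"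
proof -
  have gg: "(Re g)\<^sup>2 + (Im g)\<^sup>2 = 1" using g by (metis cmod_power2 one_power2)
  have "Re g \<noteq> -1"
  proof
    assume "Re g = -1"
    then have "Im g = 0" using gg by simp
    then show False using \<open>Re g = -1\<close> g(2) by (simp add: complex_eq_iff)
  qed
  then have n: "1 + Re g \<noteq> 0" by linarith
  \<comment> \<open>Half the turning angle: \<open>g = exp (2 * \<i> * \<theta>)\<close>, as
    \<open>ex\<close> shows.\<close>
  define \<theta> where "\<theta> = arctan x"
  have xI: "x * (1 + Re g) = Im g" using n x by simp
  have "(1 + x\<^sup>2) * (1 + Re g) = 2"
  proof -
    have "(1 + Re g) * ((1 + x\<^sup>2) * (1 + Re g) - 2) = (1 + Re g)\<^sup>2 + (x * (1 + Re g))\<^sup>2 - 2 * (1 + Re g)"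
      by (simp add: power2_eq_square algebra_simps)
    also have "\<dots> = 0" unfolding xI using gg by (simp add: power2_eq_square algebra_simps)
    finally have "(1 + Re g) * ((1 + x\<^sup>2) * (1 + Re g) - 2) = 0" .
    then show ?thesis using n by simp
  qed
  moreover have "1 + x\<^sup>2 > 0" by (simp add: add_pos_nonneg)
  ultimately have "1 + Re g = 2 / (1 + x\<^sup>2)"
    by (metis less_irrefl mult.commute nonzero_eq_divide_eq)
  moreover have "(cos \<theta>)\<^sup>2 = 1 / (1 + x\<^sup>2)"
    by (simp add: \<theta>_def cos_arctan power_divide)
  ultimately have sq: "1 + Re g = 2 * (cos \<theta>)\<^sup>2" by simp
  have tn: "sin \<theta> = x * cos \<theta>" and c0: "cos \<theta> > 0"
    using sin_arctan[of x] cos_arctan[of x] by (auto simp: \<theta>_def add_pos_nonneg)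
  have ex: "exp (\<i> * of_real (2 * \<theta>)) = g"
  proof -
    have "cos (2 * \<theta>) = Re g" using sq cos_double_cos[of \<theta>] by simp
    moreover have "sin (2 * \<theta>) = Im g" using sin_double[of \<theta>] tn xI sq by (simp add: power2_eq_square algebra_simps)
    ultimately show ?thesis by (simp add: complex_eq_iff Re_exp Im_exp)
  qed
  show ?thesis
  proof (cases "x = 0")
    case True
    then have "g = 1" using ex by (simp add: \<theta>_def)
    then show ?thesis using True \<tau> by (intro that[of "2 * \<tau>"]) (auto simp: circ_arc_def algebra_simps)
  next
    case False
    \<comment> \<open>The turning angle \<open>2 * \<theta>\<close> times the signed radius
      \<open>\<tau> / x\<close>. It is at most \<open>2 * \<tau>\<close> because
      \<open>arctan x / x \<le> 1\<close>.\<close>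
    define l where "l = 2 * \<theta> * \<tau> / x"
    have kl: "x / \<tau> * l = 2 * \<theta>" using False \<tau> by (simp add: l_def)
    have exl: "exp (\<i> * of_real (x / \<tau> * l)) = g" unfolding kl by (rule ex)
    have "\<theta> / x > 0" using False by (cases "x > 0") (auto simp: \<theta>_def zero_less_divide_iff)
    then have "2 * \<tau> * (\<theta> / x) > 0" using \<tau> by (intro mult_pos_pos) auto
    then have l0: "l > 0" by (simp add: l_def mult_ac)
    have "\<theta> / x \<le> 1"
    proof (cases "x > 0")
      case True
      then show ?thesis using arctan_le_self[of x] by (simp add: \<theta>_def)
    next
      case F: False
      then have "- \<theta> \<le> - x" using arctan_le_self[of "- x"] False by (simp add: \<theta>_def arctan_minus)
      then show ?thesis using F False by (simp add: divide_le_eq_1)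
    qed
    then have "2 * \<tau> * (\<theta> / x) \<le> 2 * \<tau> * 1" using \<tau> by (intro mult_left_mono) auto
    then have l2: "l \<le> 2 * \<tau>" by (simp add: l_def mult_ac)
    have k0: "x / \<tau> \<noteq> 0" using False \<tau> by simp
    have "\<i> * of_real (x / \<tau>) * circ_arc P e (x / \<tau>) l 1 = \<i> * of_real (x / \<tau>) * P + e * g - e"
      using circ_arc_eq[OF k0, of P e l 1] exl by (simp only: mult_1_right)
    moreover have "x * Im g = 1 - Re g"
    proof -
      have "(1 + Re g) * (x * Im g - (1 - Re g)) = (x * (1 + Re g)) * Im g - (1 - (Re g)\<^sup>2)"
        by (simp add: power2_eq_square algebra_simps)
      also have "\<dots> = 0" unfolding xI using gg by (simp add: power2_eq_square)
      finally show ?thesis using n by simp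
    qed
    then have "\<i> * of_real x * (1 + g) = g - 1"
      using xI by (simp add: complex_eq_iff)
    then have "\<i> * of_real (x / \<tau>) * (of_real \<tau> * e + of_real \<tau> * (e * g)) = e * g - e"
    proof -
      assume a: "\<i> * of_real x * (1 + g) = g - 1"
      have "\<i> * of_real (x / \<tau>) * (of_real \<tau> * e + of_real \<tau> * (e * g)) = e * (\<i> * of_real x * (1 + g))"
        using \<tau> by (simp add: field_simps)
      then show ?thesis unfolding a by (simp add: algebra_simps)
    qed
    ultimately have "\<i> * of_real (x / \<tau>) * circ_arc P e (x / \<tau>) l 1 =
      \<i> * of_real (x / \<tau>) * (P + of_real \<tau> * e + of_real \<tau> * (e * g))"
      unfolding distrib_left add.assoc by algebra
    then have "circ_arc P e (x / \<tau>) l 1 = P + of_real \<tau> * e + of_real \<tau> * (e * g)" using k0 by simp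
    then show ?thesis using that[OF l0 l2] by (simp only: exl)
  qed
qed

text \<open>The final direction is recorded so that the next piece can be attached
  tangentially.\<close>

definition chain_to :: "complex set \<Rightarrow> complex \<Rightarrow> complex \<Rightarrow> complex \<Rightarrow> bool" where
  "chain_to U a q f \<longleftrightarrow> (\<exists>n \<gamma>. subhoro_chain n \<gamma> \<and> (\<Union>k<n. path_image (\<gamma> k)) \<subseteq> U \<and>
     \<gamma> 0 0 = a \<and> \<gamma> (n - 1) 1 = q \<and> unit_tangent (\<gamma> (n - 1)) 1 = f)"

lemma chain_to_start:
  assumes "l > 0" "cmod e = 1" "\<And>t. t \<in> {0..1} \<Longrightarrow> circ_arc P e k l t \<in> U" "U \<subseteq> ball 0 1"
    and "\<bar>(1 - (cmod P)\<^sup>2) * k + 2 * Im (cnj P * e)\<bar> < 2"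
  shows "chain_to U P (circ_arc P e k l 1) (e * exp (\<i> * of_real (k * l)))"
proof -
  have "cmod (circ_arc P e k l t) < 1" if "t \<in> {0..1}" for t using assms(3)[OF that] assms(4) by auto
  then have "subhoro_piece (circ_arc P e k l)" using subhoro_piece_circ_arc assms by blast
  then show ?thesis
    unfolding chain_to_def
    using assms circ_arc_unit_tangent[OF _ assms(1,2), of 1 P k]
    by (intro exI[of _ 1] exI[of _ "\<lambda>_. circ_arc P e k l"]) (auto simp: subhoro_chain_def path_image_def)
qed

lemma chain_to_extend:
  assumes "chain_to U a P e" "l > 0" "cmod e = 1" "\<And>t. t \<in> {0..1} \<Longrightarrow> circ_arc P e k l t \<in> U" "U \<subseteq> ball 0 1"
    and "\<bar>(1 - (cmod P)\<^sup>2) * k + 2 * Im (cnj P * e)\<bar> < 2"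
  shows "chain_to U a (circ_arc P e k l 1) (e * exp (\<i> * of_real (k * l)))"
proof -
  have "cmod (circ_arc P e k l t) < 1" if "t \<in> {0..1}" for t using assms(4)[OF that] assms(5) by auto
  then have new: "subhoro_piece (circ_arc P e k l)" using subhoro_piece_circ_arc assms by blast
  obtain n \<gamma> where ch: "subhoro_chain n \<gamma>" and im: "(\<Union>k<n. path_image (\<gamma> k)) \<subseteq> U"
    and st: "\<gamma> 0 0 = a" and fi: "\<gamma> (n - 1) 1 = P" and ut: "unit_tangent (\<gamma> (n - 1)) 1 = e"
    using assms(1) unfolding chain_to_def by blast
  have n: "0 < n" using ch by (simp add: subhoro_chain_def)
  define \<delta> where "\<delta> = \<gamma>(n := circ_arc P e k l)"
  have old: "\<delta> j = \<gamma> j" if "j < n" for j using that by (simp add: \<delta>_def)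
  have last: "\<delta> n = circ_arc P e k l" by (simp add: \<delta>_def)
  have "subhoro_chain (Suc n) \<delta>"
    unfolding subhoro_chain_def
  proof (intro conjI allI impI)
    fix j assume "j < Suc n"
    then show "subhoro_piece (\<delta> j)"
      using new last old[of j] ch by (cases "j = n") (auto simp: subhoro_chain_def)
  next
    fix j assume j: "Suc j < Suc n"
    show "\<delta> j 1 = \<delta> (Suc j) 0" "unit_tangent (\<delta> j) 1 = unit_tangent (\<delta> (Suc j)) 0"
    proof (atomize (full), cases "Suc j = n")
      case True
      then have "\<delta> j = \<gamma> (n - 1)" using old[of j] by auto
      then show "\<delta> j 1 = \<delta> (Suc j) 0 \<and> unit_tangent (\<delta> j) 1 = unit_tangent (\<delta> (Suc j)) 0"
        using True last fi ut circ_arc_unit_tangent[OF _ assms(2,3), of 0 P k] by simp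
    next
      case False
      then show "\<delta> j 1 = \<delta> (Suc j) 0 \<and> unit_tangent (\<delta> j) 1 = unit_tangent (\<delta> (Suc j)) 0"
        using j old[of j] old[of "Suc j"] ch by (auto simp: subhoro_chain_def)
    qed
  qed simp
  moreover have "(\<Union>k<Suc n. path_image (\<delta> k)) \<subseteq> U"
  proof -
    have "(\<Union>k<n. path_image (\<delta> k)) = (\<Union>k<n. path_image (\<gamma> k))" using old by (intro SUP_cong) auto
    moreover have "path_image (\<delta> n) \<subseteq> U" using assms(4) by (auto simp: last path_image_def)
    ultimately show ?thesis using im by (simp add: lessThan_Suc)
  qed
  ultimately show ?thesis
    unfolding chain_to_def
    using old[OF n] st last circ_arc_unit_tangent[OF _ assms(2,3), of 1 P k]
    by (intro exI[of _ "Suc n"] exI[of _ \<delta>]) auto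
qed

subsection \<open>Discrete taut strings and their rounding\<close>

text \<open>Each edge is shortened by \<open>\<tau>\<close> at its two ends and a circular arc
  bridges the gap at each inner vertex; \<open>g j\<close> is the rotation from edge
  \<open>j\<close> to edge \<open>j + 1\<close>, so it belongs to vertex \<open>j + 1\<close>. The
  condition \<open>curv\<close> refers to the first point \<open>P\<close> of the rounding arc only,
  because hyperbolic curvature is constant along the arc. The arc has length at most
  \<open>2 * \<tau>\<close> and starts at distance \<open>\<tau>\<close> from the vertex, whence the
  radius \<open>3 * \<tau>\<close> in \<open>near\<close>. A straight piece has hyperbolic curvature
  at most twice the modulus of its starting point.\<close>

lemma round_polygon:
  fixes v e g :: "nat \<Rightarrow> complex" and \<tau> :: "nat \<Rightarrow> real"
  assumes N: "0 < N" and U: "U \<subseteq> ball 0 1"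
    and e: "\<And>j. j < N \<Longrightarrow> cmod (e j) = 1"
    and edge: "\<And>j. j < N \<Longrightarrow> v (Suc j) = v j + of_real (len j) * e j"
    and \<tau>0: "\<tau> 0 = 0" "\<tau> N = 0" and \<tau>: "\<And>j. 0 < j \<Longrightarrow> j < N \<Longrightarrow> 0 < \<tau> j"
    and short: "\<And>j. j < N \<Longrightarrow> \<tau> j + \<tau> (Suc j) < len j"
    and turn: "\<And>j. Suc j < N \<Longrightarrow> e (Suc j) = e j * g j \<and> g j \<noteq> -1"
    and curv: "\<And>j P. Suc j < N \<Longrightarrow> P = v (Suc j) - of_real (\<tau> (Suc j)) * e j \<Longrightarrow> cmod P < 1 \<Longrightarrow>
      \<bar>(1 - (cmod P)\<^sup>2) * (Im (g j) / (1 + Re (g j)) / \<tau> (Suc j)) + 2 * Im (cnj P * e j)\<bar> < 2"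
    and near: "\<And>j z. 0 < j \<Longrightarrow> j < N \<Longrightarrow> cmod (z - v j) \<le> 3 * \<tau> j \<Longrightarrow> z \<in> U"
    and seg: "\<And>j t. j < N \<Longrightarrow> 0 \<le> t \<Longrightarrow> t \<le> len j \<Longrightarrow> v j + of_real t * e j \<in> U"
  shows "chain_to U (v 0) (v N) (e (N - 1))"
proof -
  have \<tau>ge: "0 \<le> \<tau> j" if "j \<le> N" for j
    using \<tau>0 \<tau>[of j] that by (cases "j = 0 \<or> j = N") auto
  have straight: "circ_arc (v j + of_real (\<tau> j) * e j) (e j) 0 (len j - \<tau> j - \<tau> (Suc j)) 1 = v (Suc j) - of_real (\<tau> (Suc j)) * e j"
    "\<And>t. t \<in> {0..1} \<Longrightarrow> circ_arc (v j + of_real (\<tau> j) * e j) (e j) 0 (len j - \<tau> j - \<tau> (Suc j)) t \<in> U"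
    "\<bar>(1 - (cmod (v j + of_real (\<tau> j) * e j))\<^sup>2) * 0 + 2 * Im (cnj (v j + of_real (\<tau> j) * e j) * e j)\<bar> < 2"
    if j: "j < N" for j
  proof -
    show "circ_arc (v j + of_real (\<tau> j) * e j) (e j) 0 (len j - \<tau> j - \<tau> (Suc j)) 1 = v (Suc j) - of_real (\<tau> (Suc j)) * e j"
      unfolding edge[OF j] by (simp add: circ_arc_def algebra_simps)
    have p: "0 \<le> \<tau> j" "0 \<le> \<tau> (Suc j)" "0 < len j - \<tau> j - \<tau> (Suc j)" using \<tau>ge[of j] \<tau>ge[of "Suc j"] j short[OF j] by auto
    show "circ_arc (v j + of_real (\<tau> j) * e j) (e j) 0 (len j - \<tau> j - \<tau> (Suc j)) t \<in> U" if t: "t \<in> {0..1}" for t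
    proof -
      have "(len j - \<tau> j - \<tau> (Suc j)) * t \<le> len j - \<tau> j - \<tau> (Suc j)" using p t by (intro mult_left_le) auto
      moreover have "0 \<le> (len j - \<tau> j - \<tau> (Suc j)) * t" using p t by (intro mult_nonneg_nonneg) auto
      ultimately have "0 \<le> \<tau> j + (len j - \<tau> j - \<tau> (Suc j)) * t" "\<tau> j + (len j - \<tau> j - \<tau> (Suc j)) * t \<le> len j"
        using p by linarith+
      from seg[OF j this] show ?thesis by (simp add: circ_arc_def algebra_simps)
    qed
    have "v j + of_real (\<tau> j) * e j \<in> U" using p by (intro seg[OF j]) auto
    then have "cmod (v j + of_real (\<tau> j) * e j) < 1" using U by auto
    moreover have "\<bar>Im (cnj (v j + of_real (\<tau> j) * e j) * e j)\<bar> \<le> cmod (cnj (v j + of_real (\<tau> j) * e j) * e j)"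
      by (rule abs_Im_le_cmod)
    moreover have "cmod (cnj (v j + of_real (\<tau> j) * e j) * e j) = cmod (v j + of_real (\<tau> j) * e j)"
      using e[OF j] by (simp only: norm_mult complex_mod_cnj mult_1_right)
    ultimately show "\<bar>(1 - (cmod (v j + of_real (\<tau> j) * e j))\<^sup>2) * 0 + 2 * Im (cnj (v j + of_real (\<tau> j) * e j) * e j)\<bar> < 2"
      by linarith
  qed
  have len: "0 < len j - \<tau> j - \<tau> (Suc j)" if "j < N" for j using short[OF that] by simp
  \<comment> \<open>The chain is built up to the start of the next rounding arc; on the last edge
    this is the end point itself, as \<open>\<tau> N = 0\<close>.\<close>
  have "chain_to U (v 0) (v (Suc j) - of_real (\<tau> (Suc j)) * e j) (e j)" if "j < N" for j
    using that
  proof (induction j)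
    case 0
    from chain_to_start[OF len[OF 0] e[OF 0] straight(2)[OF 0] U straight(3)[OF 0]]
    show ?case using straight(1)[OF 0] by (simp add: \<tau>0)
  next
    case (Suc j)
    then have j: "j < N" "Suc j < N" by auto
    define P where "P = v (Suc j) - of_real (\<tau> (Suc j)) * e j"
    define x where "x = Im (g j) / (1 + Re (g j))"
    have t: "0 < \<tau> (Suc j)" using \<tau> j by simp
    have g1: "cmod (g j) = 1" using turn[OF j(2)] e[OF j(1)] e[OF j(2)] by (simp add: norm_mult)
    obtain l where l: "0 < l" "l \<le> 2 * \<tau> (Suc j)"
      "e j * exp (\<i> * of_real (x / \<tau> (Suc j) * l)) = e j * g j"
      "circ_arc P (e j) (x / \<tau> (Suc j)) l 1 = P + of_real (\<tau> (Suc j)) * e j + of_real (\<tau> (Suc j)) * (e j * g j)"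
      using circ_arc_corner[OF g1 _ t e[OF j(1)] x_def, of P] turn[OF j(2)] by blast
    have near': "circ_arc P (e j) (x / \<tau> (Suc j)) l s \<in> U" if "s \<in> {0..1}" for s
    proof (rule near[of "Suc j"])
      have "cmod (circ_arc P (e j) (x / \<tau> (Suc j)) l s - P) \<le> l" by (rule circ_arc_near[OF l(1) e[OF j(1)] that])
      moreover have "cmod (P - v (Suc j)) = \<tau> (Suc j)" using t e[OF j(1)] by (simp add: P_def norm_mult)
      ultimately show "cmod (circ_arc P (e j) (x / \<tau> (Suc j)) l s - v (Suc j)) \<le> 3 * \<tau> (Suc j)"
        using norm_triangle_ineq[of "circ_arc P (e j) (x / \<tau> (Suc j)) l s - P" "P - v (Suc j)"] l(2) by simp
    qed (use j in auto)
    have "P \<in> U" using near'[of 0] by simp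
    then have P1: "cmod P < 1" using U by auto
    have c1: "chain_to U (v 0) P (e j)" using Suc.IH[OF j(1)] by (simp add: P_def)
    from chain_to_extend[OF c1 l(1) e[OF j(1)] near' U curv[OF j(2) P_def P1, folded x_def]]
    have "chain_to U (v 0) (P + of_real (\<tau> (Suc j)) * e j + of_real (\<tau> (Suc j)) * (e j * g j)) (e j * g j)"
      by (simp only: l(3,4))
    moreover have "P + of_real (\<tau> (Suc j)) * e j + of_real (\<tau> (Suc j)) * (e j * g j) = v (Suc j) + of_real (\<tau> (Suc j)) * e (Suc j)"
      using turn[OF j(2)] by (simp add: P_def)
    ultimately have c2: "chain_to U (v 0) (v (Suc j) + of_real (\<tau> (Suc j)) * e (Suc j)) (e (Suc j))"
      using turn[OF j(2)] by simp
    from chain_to_extend[OF c2 len[OF j(2)] e[OF j(2)] straight(2)[OF j(2)] U straight(3)[OF j(2)]]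
    show ?case unfolding straight(1)[OF j(2)] by simp
  qed
  from this[of "N - 1"] show ?thesis using N \<tau>0 by simp
qed

section \<open>Polygons of least energy\<close>

lemma parallelogram_midpoint:
  fixes z p q :: complex
  shows "(cmod (z - p))\<^sup>2 + (cmod (q - z))\<^sup>2 = 2 * (cmod (z - (p + q) / 2))\<^sup>2 + (cmod (q - p))\<^sup>2 / 2"
  unfolding cmod_power2 by (simp add: power2_eq_square field_simps)

text \<open>The polygon sampled from \<open>p\<close> at equal times has energy at most
  \<open>N * (M / N)\<^sup>2\<close>, which bounds each squared edge of the minimiser. Moving a
  single vertex affects two summands, and \<open>parallelogram_midpoint\<close> turns minimality of
  their sum into minimality of the distance to the midpoint.\<close>

lemma energy_minimizer:
  fixes X :: "complex set" and p :: "real \<Rightarrow> complex"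
  assumes X: "compact X" and N: "0 < N"
    and p: "\<And>t. t \<in> {0..1} \<Longrightarrow> p t \<in> X" "\<And>s t. s \<in> {0..1} \<Longrightarrow> t \<in> {0..1} \<Longrightarrow> cmod (p s - p t) \<le> M * \<bar>s - t\<bar>"
  obtains v :: "nat \<Rightarrow> complex" where "v 0 = p 0" "v N = p 1" "\<And>j. j \<le> N \<Longrightarrow> v j \<in> X"
    "\<And>j. j < N \<Longrightarrow> (cmod (v (Suc j) - v j))\<^sup>2 \<le> M\<^sup>2 / N"
    "\<And>j z. Suc j < N \<Longrightarrow> z \<in> X \<Longrightarrow>
        cmod (v (Suc j) - (v j + v (Suc (Suc j))) / 2) \<le> cmod (z - (v j + v (Suc (Suc j))) / 2)"
proof -
  \<comment> \<open>Coordinates from \<open>N\<close> on are pinned to \<open>p 1\<close>: this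
    fixes the last vertex and makes the product over all natural numbers compact.\<close>
  define Y where "Y = (\<lambda>j. if j = 0 then {p 0} else if N \<le> j then {p 1} else X)"
  define K where "K = PiE UNIV Y"
  define E where "E = (\<lambda>v :: nat \<Rightarrow> complex. \<Sum>j<N. (cmod (v (Suc j) - v j))\<^sup>2)"
  have memK: "v \<in> K \<longleftrightarrow> (\<forall>j. v j \<in> Y j)" for v by (auto simp: K_def)
  have "compactin (product_topology (\<lambda>i. euclidean) UNIV) K"
    unfolding K_def compactin_PiE using X by (auto simp: Y_def)
  then have K: "compact K" by (simp add: euclidean_product_topology)
  define u where "u = (\<lambda>j. p (min 1 (real j / N)))"
  have u01: "min 1 (real j / N) \<in> {0..1}" for j by auto
  have "u \<in> K"
    unfolding memK
  proof
    fix j show "u j \<in> Y j"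
      using N p(1)[OF u01[of j]] by (auto simp: u_def Y_def min_def field_simps)
  qed
  have "continuous_on K E"
    unfolding E_def by (intro continuous_intros continuous_on_product_coordinates[THEN continuous_on_subset]) auto
  then obtain v where v: "v \<in> K" "\<And>x. x \<in> K \<Longrightarrow> E v \<le> E x"
    using continuous_attains_inf[OF K] \<open>u \<in> K\<close> by blast
  have "E u \<le> (\<Sum>j<N. (M / N)\<^sup>2)"
    unfolding E_def
  proof (rule sum_mono)
    fix j assume "j \<in> {..<N}"
    then have j: "real (Suc j) \<le> N" by auto
    have mm: "min 1 (real (Suc j) / N) = real (Suc j) / N" "min 1 (real j / N) = real j / N"
      using j N by (auto simp: min_def field_simps)
    have "cmod (u (Suc j) - u j) \<le> M * \<bar>real (Suc j) / N - real j / N\<bar>"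
      using p(2)[OF u01[of "Suc j"] u01[of j]] unfolding u_def mm .
    also have "\<bar>real (Suc j) / N - real j / N\<bar> = 1 / N" using N by (simp add: field_simps)
    finally show "(cmod (u (Suc j) - u j))\<^sup>2 \<le> (M / N)\<^sup>2" by (intro power_mono) auto
  qed
  also have "\<dots> = M\<^sup>2 / N" using N by (simp add: power2_eq_square field_simps)
  finally have Eu: "E v \<le> M\<^sup>2 / N" using v(2)[OF \<open>u \<in> K\<close>] by linarith
  have p01: "p 0 \<in> X" "p 1 \<in> X" using p(1) by auto
  have vY: "v j \<in> Y j" for j using v(1) by (simp add: memK)
  show ?thesis
  proof (rule that)
    show "v 0 = p 0" using vY[of 0] by (simp add: Y_def)
    show "v N = p 1" using vY[of N] N by (simp add: Y_def)
    show "v j \<in> X" if "j \<le> N" for j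
      using vY[of j] p01 by (auto simp: Y_def split: if_splits)
    show "(cmod (v (Suc j) - v j))\<^sup>2 \<le> M\<^sup>2 / N" if "j < N" for j
    proof -
      have "(cmod (v (Suc j) - v j))\<^sup>2 \<le> E v"
        unfolding E_def by (rule member_le_sum) (use that in auto)
      then show ?thesis using Eu by linarith
    qed
    show "cmod (v (Suc j) - (v j + v (Suc (Suc j))) / 2) \<le> cmod (z - (v j + v (Suc (Suc j))) / 2)"
      if j: "Suc j < N" and z: "z \<in> X" for j z
    proof -
      define x where "x = v(Suc j := z)"
      have "x i \<in> Y i" for i using vY[of i] z j by (cases "i = Suc j") (auto simp: x_def Y_def)
      then have "x \<in> K" by (simp add: memK)
      then have le: "E v \<le> E x" by (rule v(2))
      have split: "E y = (cmod (y (Suc j) - y j))\<^sup>2 + ((cmod (y (Suc (Suc j)) - y (Suc j)))\<^sup>2 +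
          (\<Sum>i\<in>{..<N} - {j} - {Suc j}. (cmod (y (Suc i) - y i))\<^sup>2))" for y
        unfolding E_def using j
        by (subst sum.remove[of _ j], simp, simp, subst sum.remove[of _ "Suc j"]) auto
      have "(\<Sum>i\<in>{..<N} - {j} - {Suc j}. (cmod (x (Suc i) - x i))\<^sup>2) = (\<Sum>i\<in>{..<N} - {j} - {Suc j}. (cmod (v (Suc i) - v i))\<^sup>2)"
        by (rule sum.cong) (auto simp: x_def)
      then have "(cmod (v (Suc j) - v j))\<^sup>2 + (cmod (v (Suc (Suc j)) - v (Suc j)))\<^sup>2
          \<le> (cmod (z - v j))\<^sup>2 + (cmod (v (Suc (Suc j)) - z))\<^sup>2"
        using le unfolding split[of v] split[of x] by (simp add: x_def)
      then have "(cmod (v (Suc j) - (v j + v (Suc (Suc j))) / 2))\<^sup>2 \<le> (cmod (z - (v j + v (Suc (Suc j))) / 2))\<^sup>2"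
        unfolding parallelogram_midpoint by simp
      then show ?thesis by (rule power2_le_imp_le) simp
    qed
  qed
qed

text \<open>Here the vertex \<open>v\<close> lies on the obstacle circle with centre
  \<open>c\<close>, radius \<open>R\<close> and outer normal \<open>n\<close>; \<open>w\<close> is
  half the vector between its neighbours, \<open>s\<close> the distance of \<open>v\<close> from
  their midpoint, and \<open>L\<close> the product of the adjacent edge lengths. The fraction over
  \<open>L + (d\<^sup>2 - s\<^sup>2)\<close> is the tangent of half the turning angle, of modulus
  about \<open>s / d\<close>, while \<open>\<tau>\<close> is about \<open>d / 2\<close>. Since
  \<open>s\<close> is at most about \<open>d\<^sup>2 / (2 * R)\<close>, the rounding arc has
  Euclidean curvature at most about \<open>1 / R\<close>. So its hyperbolic curvature hardly exceeds
  that of the obstacle, which is the left side of the bound by \<open>2 - \<eta>\<close>. The bound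
  on \<open>cmod v\<close> prevents too much curvature of the opposite sign.\<close>

lemma corner_curvature:
  fixes c n w v P e :: complex and R r s d y \<eta> \<tau> L :: real
  assumes n: "cmod n = 1" and v: "v = c + of_real R * n" and w: "cmod w = d" "0 < d"
    and y: "d \<le> y * r" "0 < y" "y \<le> 1 / 8" and R: "0 < r" "r \<le> R" "R \<le> 1"
    and s: "0 \<le> s" "s * (2 * R - s) \<le> d\<^sup>2" "s \<le> d\<^sup>2 / R" and tan: "\<bar>Re (cnj n * w)\<bar> \<le> d\<^sup>2 / R"
    and \<kappa>: "(1 - (cmod c)\<^sup>2 + R\<^sup>2) / R \<le> 2 - \<eta>" and v2: "2 * cmod v \<le> 2 - \<eta>" and small: "22 * y / r < \<eta>"
    and e: "e = (w + of_real s * n) / of_real (cmod (w + of_real s * n))"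
    and \<tau>: "\<tau> = (1 - 2 * y) * d / 2" and P: "P = v - of_real \<tau> * e" "cmod P < 1"
    and L: "L \<ge> d\<^sup>2 - s\<^sup>2"
  shows "\<bar>(1 - (cmod P)\<^sup>2) * (2 * s * Im (w * cnj n) / (L + (d\<^sup>2 - s\<^sup>2)) / \<tau>) + 2 * Im (cnj P * e)\<bar> < 2"
proof -
  define x where "x = 2 * s * Im (w * cnj n) / (L + (d\<^sup>2 - s\<^sup>2))"
  have dR: "d / R \<le> y"
  proof -
    have "d \<le> y * R" using y R mult_left_mono[of r R y] by linarith
    then show ?thesis using R by (simp add: divide_le_eq)
  qed
  have d2R: "d\<^sup>2 / R \<le> d * y"
  proof -
    have "d\<^sup>2 / R = d * (d / R)" by (simp add: power2_eq_square)
    also have "\<dots> \<le> d * y" using dR w(2) by (intro mult_left_mono) auto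
    finally show ?thesis .
  qed
  have sdy: "s \<le> d * y" using s(3) d2R by linarith
  have dy1: "d * y < d" using w(2) y by simp
  have sd: "s < d" using sdy dy1 by linarith
  define \<Delta> where "\<Delta> = w + of_real s * n"
  have \<Delta>s: "cmod (\<Delta> - w) = s" using s(1) n by (simp add: \<Delta>_def norm_mult)
  have \<Delta>ge: "cmod \<Delta> \<ge> d - s" "cmod \<Delta> \<le> d + s"
    using norm_triangle_ineq2[of w "w - \<Delta>"] norm_triangle_ineq[of w "\<Delta> - w"] \<Delta>s w(1) by (auto simp: norm_minus_commute)
  have \<Delta>0: "cmod \<Delta> > 0" using \<Delta>ge sd by linarith
  have e1: "cmod e = 1" using \<Delta>0 unfolding e \<Delta>_def[symmetric] by (simp add: norm_divide)
  have \<tau>0: "\<tau> > 0" unfolding \<tau> using w(2) y by simp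
  have \<tau>y: "\<tau> \<le> y"
  proof -
    have "(1 - 2 * y) * d \<le> 1 * d" using w(2) y by (intro mult_right_mono) auto
    moreover have "y * r \<le> y * 1" using y R by (intro mult_left_mono) auto
    ultimately show ?thesis unfolding \<tau> using y w(2) by linarith
  qed
  have Im1: "\<bar>Im (cnj P * e)\<bar> \<le> cmod P"
    using abs_Im_le_cmod[of "cnj P * e"] e1 by (simp add: norm_mult del: times_complex.simps)
  show ?thesis
  proof (cases "s * Im (w * cnj n) = 0")
    case True
    then have "x = 0" unfolding x_def by (metis mult.assoc mult_zero_left mult_zero_right div_0)
    then show ?thesis using Im1 P(2) unfolding x_def[symmetric] by (simp del: times_complex.simps)
  next
    case False
    \<comment> \<open>The orientation: 1 if the polygon passes the obstacle counterclockwise, -1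
      otherwise. The incoming direction \<open>e\<close> is then close to
      \<open>\<i> * \<sigma> * n\<close>.\<close>
    define \<sigma> where "\<sigma> = sgn (Im (w * cnj n))"
    have \<sigma>: "\<bar>\<sigma>\<bar> = 1" "\<sigma> * \<sigma> = 1" "\<bar>Im (w * cnj n)\<bar> = \<sigma> * Im (w * cnj n)"
      using False by (auto simp: \<sigma>_def sgn_if simp del: times_complex.simps)
    have wn: "cmod (w * cnj n) = d" using w n by (simp add: norm_mult)
    have Re_wn: "\<bar>Re (w * cnj n)\<bar> \<le> d\<^sup>2 / R" using tan by (simp add: mult.commute)
    have "cmod (w * cnj n - \<i> * of_real (\<sigma> * d)) \<le> \<bar>Re (w * cnj n)\<bar> + \<bar>Im (w * cnj n) - \<sigma> * d\<bar>"
      using cmod_le[of "w * cnj n - \<i> * of_real (\<sigma> * d)"] by simp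
    also have "\<bar>Im (w * cnj n) - \<sigma> * d\<bar> = \<bar>\<sigma> * (\<sigma> * Im (w * cnj n) - d)\<bar>"
      using \<sigma>(2) by (simp add: right_diff_distrib mult.assoc[symmetric] del: times_complex.simps)
    also have "\<dots> = \<bar>\<bar>Im (w * cnj n)\<bar> - d\<bar>" unfolding abs_mult \<sigma>(1) \<sigma>(3) by simp
    also have "\<dots> \<le> \<bar>Re (w * cnj n)\<bar>"
      using cmod_le[of "w * cnj n"] abs_Im_le_cmod[of "w * cnj n"] unfolding wn by linarith
    finally have "cmod (w * cnj n - \<i> * of_real (\<sigma> * d)) \<le> 2 * (d\<^sup>2 / R)" using Re_wn by linarith
    moreover have "w - \<i> * of_real (\<sigma> * d) * n = (w * cnj n - \<i> * of_real (\<sigma> * d)) * n"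
    proof -
      have "cnj n * n = 1" using n by (metis complex_norm_square mult.commute of_real_1 one_power2)
      then show ?thesis by (simp add: left_diff_distrib mult.assoc)
    qed
    ultimately have wd: "cmod (w - \<i> * of_real (\<sigma> * d) * n) \<le> 2 * (d\<^sup>2 / R)" using n by (simp add: norm_mult)
    have "e * of_real d - w = (\<Delta> - w) + \<Delta> * of_real ((d - cmod \<Delta>) / cmod \<Delta>)"
      unfolding e \<Delta>_def[symmetric] using \<Delta>0 by (simp add: field_simps)
    then have "cmod (e * of_real d - w) \<le> cmod (\<Delta> - w) + cmod (\<Delta> * of_real ((d - cmod \<Delta>) / cmod \<Delta>))"
      by (metis norm_triangle_ineq)
    also have "cmod (\<Delta> * of_real ((d - cmod \<Delta>) / cmod \<Delta>)) = \<bar>d - cmod \<Delta>\<bar>"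
      using \<Delta>0 unfolding norm_mult norm_of_real by (simp add: abs_divide)
    finally have "cmod (e * of_real d - w) \<le> 2 * s" using \<Delta>ge \<Delta>s by linarith
    then have "cmod (e * of_real d - \<i> * of_real (\<sigma> * d) * n) \<le> 4 * (d * y)"
      using wd norm_triangle_ineq[of "e * of_real d - w" "w - \<i> * of_real (\<sigma> * d) * n"] sdy d2R by simp
    moreover have "e * of_real d - \<i> * of_real (\<sigma> * d) * n = of_real d * (e - \<i> * of_real \<sigma> * n)"
      by (simp add: algebra_simps)
    ultimately have "d * cmod (e - \<i> * of_real \<sigma> * n) \<le> d * (4 * y)" using w(2) by (simp add: norm_mult)
    then have e\<sigma>: "cmod (e - \<i> * of_real \<sigma> * n) \<le> 4 * y" using w(2) by simp
    define E where "E = of_real \<sigma> * (e - \<i> * of_real \<sigma> * n)"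
    have E4: "cmod E \<le> 4 * y" using e\<sigma> \<sigma>(1) by (simp add: E_def norm_mult)
    have \<sigma>e: "of_real \<sigma> * e = \<i> * n + E"
    proof -
      have "E = of_real \<sigma> * e - \<i> * of_real (\<sigma> * \<sigma>) * n" by (simp add: E_def algebra_simps)
      then show ?thesis unfolding \<sigma>(2) by simp
    qed
    have "\<sigma> * Im (cnj P * e) = Im (cnj P * (of_real \<sigma> * e))" by (simp add: algebra_simps)
    also have "\<dots> = Re (cnj P * n) + Im (cnj P * E)" unfolding \<sigma>e by (simp add: algebra_simps)
    finally have i1: "\<sigma> * Im (cnj P * e) = Re (cnj P * n) + Im (cnj P * E)" .
    have "\<bar>Im (cnj P * E)\<bar> \<le> cmod P * cmod E"
      using abs_Im_le_cmod[of "cnj P * E"] by (simp add: norm_mult del: times_complex.simps)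
    also have "\<dots> \<le> 1 * (4 * y)" using P(2) E4 by (intro mult_mono) auto
    finally have i2: "\<bar>Im (cnj P * E)\<bar> \<le> 4 * y" by simp
    have Pv: "cmod (v - P) \<le> y" using \<tau>0 \<tau>y e1 unfolding P(1) by (simp add: norm_mult)
    have "\<bar>Re (cnj (v - P) * n)\<bar> \<le> cmod (v - P)"
      using abs_Re_le_cmod[of "cnj (v - P) * n"] n
      by (simp only: norm_mult complex_mod_cnj mult_1_right)
    moreover have "Re (cnj (v - P) * n) = Re (cnj v * n) - Re (cnj P * n)" by (simp add: algebra_simps)
    ultimately have i3: "\<bar>Re (cnj v * n) - Re (cnj P * n)\<bar> \<le> y" using Pv by linarith
    have i: "\<bar>\<sigma> * Im (cnj P * e) - Re (cnj v * n)\<bar> \<le> 5 * y" using i1 i2 i3 by linarith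
    have v1: "cmod v \<le> 1"
    proof -
      have "0 < 22 * y / r" using y R by simp
      then show ?thesis using v2 small by linarith
    qed
    have P2: "1 - (cmod P)\<^sup>2 \<le> 1 - (cmod v)\<^sup>2 + 2 * y"
    proof -
      have "cmod v - cmod P \<le> y" using norm_triangle_ineq2[of v P] Pv by linarith
      then have "(cmod v - cmod P) * (cmod v + cmod P) \<le> y * 2"
      proof (cases "cmod v \<le> cmod P")
        case True
        then have "(cmod v - cmod P) * (cmod v + cmod P) \<le> 0" by (intro mult_nonpos_nonneg) auto
        then show ?thesis using y by linarith
      next
        case False
        then show ?thesis using \<open>cmod v - cmod P \<le> y\<close> v1 P(2) y by (intro mult_mono) auto
      qed
      then show ?thesis by (simp add: power2_eq_square algebra_simps)
    qed
    have P0: "0 \<le> 1 - (cmod P)\<^sup>2" using P(2) by (simp add: abs_square_le_1)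
    have q: "d\<^sup>2 - s\<^sup>2 \<ge> d\<^sup>2 * (1 - y\<^sup>2)"
    proof -
      have "s\<^sup>2 \<le> (d * y)\<^sup>2" using sdy s(1) by (intro power_mono) auto
      then show ?thesis by (simp add: power_mult_distrib algebra_simps)
    qed
    have y2: "0 < 1 - y\<^sup>2" "y\<^sup>2 \<le> y / 8"
    proof -
      show "y\<^sup>2 \<le> y / 8" using y mult_left_mono[of y "1/8" y] by (simp add: power2_eq_square)
      then show "0 < 1 - y\<^sup>2" using y by linarith
    qed
    have d2pos: "0 < d\<^sup>2 * (1 - y\<^sup>2)" using w(2) y2 by simp
    have "\<sigma> * x = 2 * s * \<bar>Im (w * cnj n)\<bar> / (L + (d\<^sup>2 - s\<^sup>2))"
      unfolding \<sigma>(3) x_def by (simp add: mult_ac del: times_complex.simps)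
    moreover have "\<dots> \<le> 2 * s * d / (2 * (d\<^sup>2 * (1 - y\<^sup>2)))"
      using abs_Im_le_cmod[of "w * cnj n"] wn s(1) L q d2pos
      by (intro frac_le mult_left_mono) (auto simp del: times_complex.simps)
    moreover have "0 \<le> 2 * s * \<bar>Im (w * cnj n)\<bar> / (L + (d\<^sup>2 - s\<^sup>2))"
      using s(1) L q d2pos by (intro divide_nonneg_nonneg mult_nonneg_nonneg) auto
    moreover have "2 * s * d / (2 * (d\<^sup>2 * (1 - y\<^sup>2))) = s / (d * (1 - y\<^sup>2))"
      using w(2) y2 by (simp add: power2_eq_square)
    ultimately have x0: "0 \<le> \<sigma> * x" and x1: "\<sigma> * x \<le> s / (d * (1 - y\<^sup>2))" by linarith+
    define k where "k = \<sigma> * (x / \<tau>)"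
    have k0: "0 \<le> k" using x0 \<tau>0 by (simp add: k_def)
    have Rk: "R * k \<le> 1 + 8 * y"
    proof -
      \<comment> \<open>The factors below 1 are the losses in the estimate of \<open>R * k\<close>:
        \<open>1 - y\<^sup>2\<close> stems from the denominator of \<open>x\<close>,
        \<open>1 - 2 * y\<close> from \<open>\<tau>\<close>, and \<open>1 - y\<^sup>2 / 2\<close>
        from \<open>2 * R - s\<close> in place of \<open>2 * R\<close>. For
        \<open>y \<le> 1 / 8\<close> the factor \<open>1 + 8 * y\<close> makes up for them.\<close>
      have A: "(1 - y\<^sup>2) * (1 - 2 * y) * (1 - y\<^sup>2 / 2) * (1 + 8 * y) \<ge> 1"
      proof -
        have "(1 - y\<^sup>2) * (1 - y\<^sup>2 / 2) \<ge> 1 - y / 4"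
        proof -
          have "(1 - y\<^sup>2) * (1 - y\<^sup>2 / 2) = 1 - 3 / 2 * y\<^sup>2 + (y\<^sup>2)\<^sup>2 / 2"
            by (simp add: field_simps power2_eq_square)
          then show ?thesis using y2(2) zero_le_power2[of "y\<^sup>2"] y by linarith
        qed
        then have "(1 - y\<^sup>2) * (1 - y\<^sup>2 / 2) * ((1 - 2 * y) * (1 + 8 * y)) \<ge> (1 - y / 4) * ((1 - 2 * y) * (1 + 8 * y))"
          using y by (intro mult_right_mono) auto
        moreover have "(1 - y / 4) * ((1 - 2 * y) * (1 + 8 * y)) = 1 + y * (23 / 4) - y\<^sup>2 * (35 / 2) + y\<^sup>2 * (4 * y)"
          by (simp add: algebra_simps power2_eq_square)
        moreover have "0 \<le> y\<^sup>2 * (4 * y)" using y by simp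
        moreover have "y\<^sup>2 * (35 / 2) \<le> y * (23 / 4)" using y2(2) y by linarith
        ultimately show ?thesis by (simp add: mult_ac)
      qed
      have "R * s * (2 - y\<^sup>2) \<le> d\<^sup>2"
      proof -
        have "d * y \<le> (y * R) * y"
          using dR R y by (intro mult_right_mono) (auto simp: divide_le_eq)
        then have "s \<le> R * y\<^sup>2" using sdy by (simp add: power2_eq_square mult_ac)
        then have "s * (R * (2 - y\<^sup>2)) \<le> s * (2 * R - s)" using s(1) by (intro mult_left_mono) (auto simp: algebra_simps)
        then show ?thesis using s(2) by (simp add: mult_ac)
      qed
      then have s2: "R * s * (1 - y\<^sup>2 / 2) \<le> d\<^sup>2 / 2" by (simp add: algebra_simps)
      have "\<sigma> * x * (d * (1 - y\<^sup>2)) \<le> s" using x1 w(2) y2 by (simp add: pos_le_divide_eq)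
      moreover have kx: "k * \<tau> = \<sigma> * x" using \<tau>0 by (simp add: k_def)
      ultimately have "k * ((1 - 2 * y) * d / 2) * (d * (1 - y\<^sup>2)) \<le> s" unfolding \<tau> by simp
      then have "R * (1 - y\<^sup>2 / 2) * (k * ((1 - 2 * y) * d / 2) * (d * (1 - y\<^sup>2))) \<le> R * (1 - y\<^sup>2 / 2) * s"
        using R y2 by (intro mult_left_mono) auto
      also have "\<dots> \<le> d\<^sup>2 / 2" using s2 by (simp add: mult_ac)
      finally have "d\<^sup>2 / 2 * (R * k * ((1 - y\<^sup>2) * (1 - 2 * y) * (1 - y\<^sup>2 / 2))) \<le> d\<^sup>2 / 2 * 1"
        by (simp add: power2_eq_square mult_ac)
      then have "R * k * ((1 - y\<^sup>2) * (1 - 2 * y) * (1 - y\<^sup>2 / 2)) \<le> 1"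
        using w(2) by (subst (asm) mult_le_cancel_left_pos) auto
      then have "R * k * ((1 - y\<^sup>2) * (1 - 2 * y) * (1 - y\<^sup>2 / 2)) * (1 + 8 * y) \<le> 1 * (1 + 8 * y)"
        using y by (intro mult_right_mono) auto
      moreover have "R * k * 1 \<le> R * k * ((1 - y\<^sup>2) * (1 - 2 * y) * (1 - y\<^sup>2 / 2) * (1 + 8 * y))"
        using A R k0 by (intro mult_left_mono) auto
      ultimately show ?thesis by (simp add: mult_ac)
    qed
    have up: "(1 - (cmod P)\<^sup>2) * k \<le> (1 - (cmod v)\<^sup>2) / R + 12 * y / r"
    proof -
      have "(1 - (cmod P)\<^sup>2) * (R * k) \<le> (1 - (cmod v)\<^sup>2 + 2 * y) * (1 + 8 * y)"
        using P2 P0 Rk k0 R by (intro mult_mono) auto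
      also have "\<dots> = (1 - (cmod v)\<^sup>2) + 10 * y - (cmod v)\<^sup>2 * (8 * y) + 16 * y\<^sup>2"
        by (simp add: algebra_simps power2_eq_square)
      also have "\<dots> \<le> (1 - (cmod v)\<^sup>2) + 12 * y"
      proof -
        have "0 \<le> (cmod v)\<^sup>2 * (8 * y)" using y by simp
        then show ?thesis using y2(2) by linarith
      qed
      finally have "(1 - (cmod P)\<^sup>2) * k \<le> ((1 - (cmod v)\<^sup>2) + 12 * y) / R"
        using R by (simp add: pos_le_divide_eq mult_ac)
      also have "\<dots> = (1 - (cmod v)\<^sup>2) / R + 12 * y / R" by (simp add: add_divide_distrib)
      also have "12 * y / R \<le> 12 * y / r" using R y by (intro divide_left_mono) auto
      finally show ?thesis by simp
    qed
    have \<kappa>v: "(1 - (cmod v)\<^sup>2) / R + 2 * Re (cnj v * n) = (1 - (cmod c)\<^sup>2 + R\<^sup>2) / R"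
    proof -
      have nn: "(Re n)\<^sup>2 + (Im n)\<^sup>2 = 1" using n by (metis cmod_power2 one_power2)
      have "(1 - (cmod v)\<^sup>2) + 2 * R * Re (cnj v * n) = 1 - (cmod c)\<^sup>2 + R\<^sup>2"
      proof -
        have "Re v = Re c + R * Re n" "Im v = Im c + R * Im n" by (auto simp: v)
        moreover have "Re (cnj v * n) = Re v * Re n + Im v * Im n" by simp
        ultimately show ?thesis using nn unfolding cmod_power2 by algebra
      qed
      then show ?thesis using R by (simp add: field_simps)
    qed
    have "\<bar>Re (cnj v * n)\<bar> \<le> cmod v"
      using abs_Re_le_cmod[of "cnj v * n"] n by (simp add: norm_mult del: times_complex.simps)
    then have low: "- cmod v \<le> Re (cnj v * n)" by linarith
    have yr: "y \<le> y / r" using y R by (simp add: le_divide_eq mult_left_le)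
    define \<kappa>' where "\<kappa>' = (1 - (cmod P)\<^sup>2) * k + 2 * (\<sigma> * Im (cnj P * e))"
    \<comment> \<open>This is the origin of 22 in \<open>small\<close>: 12 from the Euclidean
      curvature in \<open>up\<close>, and 10 as twice the error \<open>5 * y\<close> made in
      \<open>i\<close> by replacing \<open>P\<close> and \<open>e\<close> by \<open>v\<close> and
      \<open>\<i> * \<sigma> * n\<close>.\<close>
    have "\<kappa>' \<le> (1 - (cmod c)\<^sup>2 + R\<^sup>2) / R + 12 * y / r + 10 * y"
      using up \<kappa>v i unfolding \<kappa>'_def by linarith
    moreover have "12 * y / r = 12 * (y / r)" and y22: "22 * y / r = 22 * (y / r)" by simp_all
    ultimately have "\<kappa>' < 2" using \<kappa> small yr by linarith
    moreover have "- 2 < \<kappa>'"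
    proof -
      have "0 \<le> (1 - (cmod P)\<^sup>2) * k" using P0 k0 by simp
      moreover have "10 * y < \<eta>" using small yr y y22 by linarith
      ultimately show ?thesis using i low v2 unfolding \<kappa>'_def by linarith
    qed
    ultimately have "\<bar>\<sigma> * \<kappa>'\<bar> < 2" unfolding abs_mult \<sigma>(1) by linarith
    moreover have "\<sigma> * \<kappa>' = (1 - (cmod P)\<^sup>2) * (x / \<tau>) + 2 * Im (cnj P * e)"
    proof -
      have "\<sigma> * \<kappa>' = (\<sigma> * \<sigma>) * ((1 - (cmod P)\<^sup>2) * (x / \<tau>) + 2 * Im (cnj P * e))"
        unfolding \<kappa>'_def k_def by (simp only: distrib_left mult_ac)
      then show ?thesis unfolding \<sigma>(2) by simp
    qed
    ultimately show ?thesis unfolding x_def by simp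
  qed
qed

text \<open>For short \<open>w\<close> this means that \<open>m\<close> is almost on the circle and
  that the direction of \<open>w\<close> is almost tangent to it.\<close>

definition near_circle :: "real \<Rightarrow> complex \<Rightarrow> complex \<Rightarrow> complex \<Rightarrow> real \<Rightarrow> bool" where
  "near_circle C m w c R \<longleftrightarrow> \<bar>(cmod (m - c))\<^sup>2 - R\<^sup>2\<bar> \<le> C * (cmod w)\<^sup>2 \<and>
     \<bar>Re ((m - c) * cnj w)\<bar> \<le> C * (cmod w)\<^sup>2"

text \<open>For \<open>R, R' \<ge> 0\<close> this says that the distance of the centres is neither \<open>R + R'\<close> nor
  \<open>\<bar>R - R'\<bar>\<close>.\<close>

definition nontangent :: "complex \<Rightarrow> real \<Rightarrow> complex \<Rightarrow> real \<Rightarrow> bool" where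
  "nontangent c R c' R' \<longleftrightarrow> ((dist c c')\<^sup>2 - R\<^sup>2 - R'\<^sup>2)\<^sup>2 \<noteq> 4 * R\<^sup>2 * R'\<^sup>2"

text \<open>Two points on the circles seen from \<open>m\<close> in nearly the same or opposite directions would force
  tangency: with \<open>p = m - c\<close> and \<open>q = m - c'\<close> one has
  \<open>(\<bar>p - q\<bar>\<^sup>2 - \<bar>p\<bar>\<^sup>2 - \<bar>q\<bar>\<^sup>2)\<^sup>2 = 4 \<bar>p\<bar>\<^sup>2 \<bar>q\<bar>\<^sup>2 - 4 Im (p (cnj q))\<^sup>2\<close>.\<close>

lemma not_near_both:
  assumes nt: "nontangent c R c' R'" and C: "0 \<le> C"
  shows "\<exists>h>0. \<forall>m w. 0 < cmod w \<and> cmod w \<le> h \<longrightarrow> \<not> (near_circle C m w c R \<and> near_circle C m w c' R')"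
proof -
  \<comment> \<open>\<open>nontangent\<close> says that \<open>F\<close> is nonzero at the exact
    squared radii with \<open>i = 0\<close>. By continuity it is nonzero nearby, whereas the
    identity above makes it vanish at the values that come from \<open>p\<close> and
    \<open>q\<close> with \<open>i = Im (p * cnj q)\<close>.\<close>
  define F where "F = (\<lambda>(x, y, i). ((dist c c')\<^sup>2 - x - y)\<^sup>2 - 4 * x * y + 4 * i\<^sup>2 :: real)"
  have "continuous (at (R\<^sup>2, R'\<^sup>2, 0)) F"
    unfolding F_def case_prod_unfold by (intro continuous_intros)
  moreover have "F (R\<^sup>2, R'\<^sup>2, 0) \<noteq> 0" using nt by (simp add: F_def nontangent_def)
  ultimately obtain \<epsilon> where \<epsilon>: "\<epsilon> > 0" "\<And>z. dist (R\<^sup>2, R'\<^sup>2, 0) z < \<epsilon> \<Longrightarrow> F z \<noteq> 0"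
    using continuous_at_avoid[of "(R\<^sup>2, R'\<^sup>2, 0)" F 0] by metis
  define B where "B = 2 + R\<^sup>2 + R'\<^sup>2 + 2 * C"
  have B: "B \<ge> 2" using C by (simp add: B_def)
  define h where "h = min 1 (\<epsilon> / (4 * (1 + C * B)))"
  have CB: "0 < 4 * (1 + C * B)" using C B by (simp add: add_pos_nonneg)
  have h: "h > 0" "h \<le> 1" using \<epsilon>(1) CB by (auto simp: h_def)
  show ?thesis
  proof (intro exI[of _ h] conjI allI impI notI h(1); elim conjE)
    fix m w assume w: "0 < cmod w" "cmod w \<le> h" and n1: "near_circle C m w c R" and n2: "near_circle C m w c' R'"
    define d p q where "d = cmod w" and "p = m - c" and "q = m - c'"
    have d: "0 < d" "d \<le> h" "d \<le> 1" using w h by (auto simp: d_def)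
    have dd: "d\<^sup>2 \<le> d" using d by (simp add: power2_eq_square mult_left_le)
    have p1: "\<bar>(cmod p)\<^sup>2 - R\<^sup>2\<bar> \<le> C * d\<^sup>2" "\<bar>Re (p * cnj w)\<bar> \<le> C * d\<^sup>2"
      and q1: "\<bar>(cmod q)\<^sup>2 - R'\<^sup>2\<bar> \<le> C * d\<^sup>2" "\<bar>Re (q * cnj w)\<bar> \<le> C * d\<^sup>2"
      using n1 n2 unfolding near_circle_def p_def q_def d_def by auto
    have Cd: "C * d\<^sup>2 \<le> C * d" "C * d \<le> C" using C d dd by (auto intro: mult_left_mono mult_left_le)
    have bound: "cmod z \<le> 1 + r\<^sup>2 + C" if "\<bar>(cmod z)\<^sup>2 - r\<^sup>2\<bar> \<le> C * d\<^sup>2" for z and r :: real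
    proof -
      have "2 * cmod z \<le> 1 + (cmod z)\<^sup>2" using sum_squares_bound[of 1 "cmod z"] by simp
      moreover have "0 \<le> (cmod z)\<^sup>2" "0 \<le> r\<^sup>2" by auto
      ultimately show ?thesis using that Cd C by linarith
    qed
    have pb: "cmod p \<le> 1 + R\<^sup>2 + C" and qb: "cmod q \<le> 1 + R'\<^sup>2 + C" using bound p1(1) q1(1) by auto
    define i where "i = Im (p * cnj q)"
    \<comment> \<open>Inserting \<open>w * cnj w\<close> expresses \<open>i\<close> through the
      components of \<open>p\<close> and \<open>q\<close> along \<open>w\<close>, which are
      small.\<close>
    have "d\<^sup>2 * i = Im ((w * cnj w) * (p * cnj q))"
      by (simp add: complex_norm_square[symmetric] d_def i_def)
    also have "(w * cnj w) * (p * cnj q) = (p * cnj w) * cnj (q * cnj w)" by (simp add: mult_ac)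
    also have "Im \<dots> = Im (p * cnj w) * Re (q * cnj w) - Re (p * cnj w) * Im (q * cnj w)"
      by (simp only: times_complex.simps cnj.simps)
    finally have "d\<^sup>2 * \<bar>i\<bar> = \<bar>Im (p * cnj w) * Re (q * cnj w) - Re (p * cnj w) * Im (q * cnj w)\<bar>"
      by (metis abs_mult abs_power2)
    also have "\<dots> \<le> \<bar>Im (p * cnj w)\<bar> * \<bar>Re (q * cnj w)\<bar> + \<bar>Re (p * cnj w)\<bar> * \<bar>Im (q * cnj w)\<bar>"
      by (metis abs_mult abs_triangle_ineq4)
    also have "\<dots> \<le> (cmod p * d) * (C * d\<^sup>2) + (C * d\<^sup>2) * (cmod q * d)"
      using abs_Im_le_cmod[of "p * cnj w"] abs_Im_le_cmod[of "q * cnj w"] p1 q1 C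
      by (intro add_mono mult_mono) (auto simp: norm_mult d_def simp del: times_complex.simps)
    also have "\<dots> = d\<^sup>2 * (C * d * (cmod p + cmod q))" by (simp add: algebra_simps)
    finally have "\<bar>i\<bar> \<le> C * d * (cmod p + cmod q)" using d(1) by simp
    also have "\<dots> \<le> C * d * B" using pb qb C d(1) unfolding B_def by (intro mult_left_mono) auto
    finally have i: "\<bar>i\<bar> \<le> C * d * B" .
    have "C * d * 1 \<le> C * d * B" using C B d by (intro mult_left_mono) auto
    moreover have "C * d * B < \<epsilon> / 3"
    proof -
      have "C * d * B \<le> h * (C * B)" using d(2) C B by (simp add: mult_ac mult_left_mono)
      also have "\<dots> \<le> \<epsilon> / (4 * (1 + C * B)) * (C * B)" using C B by (intro mult_right_mono) (auto simp: h_def)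
      also have "\<dots> \<le> \<epsilon> / (4 * (1 + C * B)) * (1 + C * B)" using \<epsilon>(1) CB by (intro mult_left_mono) auto
      also have "\<dots> = \<epsilon> / 4" using CB by (simp add: field_simps)
      finally show ?thesis using \<epsilon>(1) by linarith
    qed
    ultimately have sm: "\<bar>(cmod p)\<^sup>2 - R\<^sup>2\<bar> < \<epsilon> / 3" "\<bar>(cmod q)\<^sup>2 - R'\<^sup>2\<bar> < \<epsilon> / 3" "\<bar>i\<bar> < \<epsilon> / 3"
      using p1 q1 i Cd by auto
    have "dist (R\<^sup>2, R'\<^sup>2, 0) ((cmod p)\<^sup>2, (cmod q)\<^sup>2, i) \<le> dist (R\<^sup>2) ((cmod p)\<^sup>2) + (dist (R'\<^sup>2) ((cmod q)\<^sup>2) + dist 0 i)"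
      unfolding dist_Pair_Pair
      by (rule order_trans[OF sqrt_sum_squares_le_sum]) (auto intro: order_trans[OF sqrt_sum_squares_le_sum_abs])
    also have "\<dots> < \<epsilon>" using sm by (simp add: dist_real_def abs_minus_commute)
    finally have "F ((cmod p)\<^sup>2, (cmod q)\<^sup>2, i) \<noteq> 0" by (rule \<epsilon>(2))
    moreover have "(dist c c')\<^sup>2 = (cmod (p - q))\<^sup>2" by (simp add: p_def q_def dist_norm norm_minus_commute)
    moreover have "((a - x)\<^sup>2 + (b - y)\<^sup>2 - (a\<^sup>2 + b\<^sup>2) - (x\<^sup>2 + y\<^sup>2))\<^sup>2 - 4 * (a\<^sup>2 + b\<^sup>2) * (x\<^sup>2 + y\<^sup>2)
        + 4 * (b * x - a * y)\<^sup>2 = 0" for a b x y :: real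
      by algebra
    moreover have "Im (p * cnj q) = Im p * Re q - Re p * Im q" by simp
    ultimately show False
      unfolding F_def i_def cmod_power2 minus_complex.simps prod.case by metis
  qed
qed

section \<open>Obstacle-free points nearest to the midpoint of a short chord\<close>

lemma between_points:
  fixes m w c :: complex and A :: real
  shows "A \<le> cmod (m + w - c) \<Longrightarrow> A \<le> cmod (m - w - c) \<Longrightarrow> 0 \<le> A \<Longrightarrow>
      2 * \<bar>Re ((m - c) * cnj w)\<bar> \<le> (cmod (m - c))\<^sup>2 + (cmod w)\<^sup>2 - A\<^sup>2"
    and "cmod (m + w - c) \<le> A \<Longrightarrow> cmod (m - w - c) \<le> A \<Longrightarrow>
      2 * \<bar>Re ((m - c) * cnj w)\<bar> \<le> A\<^sup>2 - (cmod (m - c))\<^sup>2 - (cmod w)\<^sup>2"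
proof -
  have e: "(cmod (m + w - c))\<^sup>2 = (cmod (m - c))\<^sup>2 + (cmod w)\<^sup>2 + 2 * Re ((m - c) * cnj w)"
    "(cmod (m - w - c))\<^sup>2 = (cmod (m - c))\<^sup>2 + (cmod w)\<^sup>2 - 2 * Re ((m - c) * cnj w)"
    unfolding cmod_power2 by (simp_all add: power2_eq_square algebra_simps)
  show "2 * \<bar>Re ((m - c) * cnj w)\<bar> \<le> (cmod (m - c))\<^sup>2 + (cmod w)\<^sup>2 - A\<^sup>2"
    if "A \<le> cmod (m + w - c)" "A \<le> cmod (m - w - c)" "0 \<le> A"
    using power_mono[OF that(1,3), of 2] power_mono[OF that(2,3), of 2] unfolding e by linarith
  show "2 * \<bar>Re ((m - c) * cnj w)\<bar> \<le> A\<^sup>2 - (cmod (m - c))\<^sup>2 - (cmod w)\<^sup>2"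
    if "cmod (m + w - c) \<le> A" "cmod (m - w - c) \<le> A"
    using power_mono[OF that(1) norm_ge_zero, of 2] power_mono[OF that(2) norm_ge_zero, of 2] unfolding e by linarith
qed

definition obstacle_free :: "real \<Rightarrow> (complex \<times> real) set \<Rightarrow> complex set" where
  "obstacle_free \<rho> S = {z. cmod z \<le> \<rho> \<and> (\<forall>(c, R)\<in>S. R \<le> cmod (z - c))}"

lemma compact_obstacle_free: "compact (obstacle_free \<rho> S)"
proof -
  have "obstacle_free \<rho> S = cball 0 \<rho> \<inter> (\<Inter>(c, R)\<in>S. {z. R \<le> cmod (z - c)})"
    by (auto simp: obstacle_free_def)
  moreover have "closed {z. R \<le> cmod (z - c)}" for c :: complex and R
    by (intro closed_Collect_le continuous_intros)
  ultimately show ?thesis by (auto intro!: closed_INT)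
qed

text \<open>If the midpoint \<open>m\<close> lies in an obstacle, the candidate is its radial
  projection \<open>x\<close> to that circle; its distance \<open>s\<close> from \<open>m\<close> is
  of order \<open>(cmod w)\<^sup>2\<close>, because the ends of the chord are outside. If
  \<open>x\<close> violated another constraint, the outer circle included, then \<open>m\<close>
  would be close to two circles and \<open>w\<close> almost tangent to both, against
  \<open>not_near_both\<close>. So \<open>x\<close> is obstacle-free, and every other point outside
  the obstacle is farther from \<open>m\<close>.\<close>

lemma nearest_to_midpoint:
  fixes S :: "(complex \<times> real) set"
  assumes S: "finite S" "\<And>c R. (c, R) \<in> S \<Longrightarrow> r \<le> R \<and> R \<le> 1" "(0, \<rho>) \<notin> S"
    and r: "0 < r" and \<rho>: "0 < \<rho>" "\<rho> \<le> 1"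
    and nt: "\<And>c R c' R'. (c, R) \<in> S \<Longrightarrow> (c', R') \<in> insert (0, \<rho>) S \<Longrightarrow> (c, R) \<noteq> (c', R') \<Longrightarrow> nontangent c R c' R'"
  obtains h where "0 < h"
    "\<And>m w v. cmod w \<le> h \<Longrightarrow> m - w \<in> obstacle_free \<rho> S \<Longrightarrow> m + w \<in> obstacle_free \<rho> S \<Longrightarrow>
       v \<in> obstacle_free \<rho> S \<Longrightarrow> (\<And>z. z \<in> obstacle_free \<rho> S \<Longrightarrow> cmod (v - m) \<le> cmod (z - m)) \<Longrightarrow>
       v = m \<or> (\<exists>c R n s. (c, R) \<in> S \<and> cmod n = 1 \<and> v = c + of_real R * n \<and> m = v - of_real s * n \<and> 0 \<le> s \<and>
         s * (2 * R - s) \<le> (cmod w)\<^sup>2 \<and> s \<le> (cmod w)\<^sup>2 / R \<and> \<bar>Re (cnj n * w)\<bar> \<le> (cmod w)\<^sup>2 / R)"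
proof -
  \<comment> \<open>Chosen so that \<open>u\<^sup>2 + 2 * u + d\<^sup>2 \<le> C * d\<^sup>2\<close>
    for \<open>u = d\<^sup>2 / r\<close> and \<open>d \<le> 1\<close>. Here \<open>u\<close> bounds
    \<open>s\<close>, and \<open>u\<^sup>2 + 2 * u\<close> bounds the change of the square of a
    radius at most 1 that grows by \<open>u\<close>.\<close>
  define C where "C = 2 / r + 1 / r\<^sup>2 + 1"
  have C1: "C \<ge> 1" using r by (simp add: C_def)
  define T where "T = {(x, y). x \<in> S \<and> y \<in> insert (0, \<rho>) S \<and> x \<noteq> y}"
  have "finite T" by (rule finite_subset[of _ "S \<times> insert (0, \<rho>) S"]) (use S(1) in \<open>auto simp: T_def\<close>)
  have "\<forall>t\<in>T. \<exists>h>0. \<forall>m w. 0 < cmod w \<and> cmod w \<le> h \<longrightarrow>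
     \<not> (near_circle C m w (fst (fst t)) (snd (fst t)) \<and> near_circle C m w (fst (snd t)) (snd (snd t)))"
    using C1 by (intro ballI not_near_both) (auto simp: T_def intro!: nt)
  then obtain H where H: "\<And>t. t \<in> T \<Longrightarrow> H t > 0"
    "\<And>t m w. t \<in> T \<Longrightarrow> 0 < cmod w \<Longrightarrow> cmod w \<le> H t \<Longrightarrow>
     \<not> (near_circle C m w (fst (fst t)) (snd (fst t)) \<and> near_circle C m w (fst (snd t)) (snd (snd t)))"
    by metis
  \<comment> \<open>The entry \<open>r / 2\<close> keeps \<open>m\<close> at distance at least
    \<open>R / 2\<close> from the centre, so that the radial projection exists and the tangential
    estimate can be divided by this distance.\<close>
  define h where "h = Min (insert 1 (insert (r / 2) (H ` T)))"
  have h: "0 < h" "h \<le> 1" "h \<le> r / 2" "\<And>t. t \<in> T \<Longrightarrow> h \<le> H t"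
  proof -
    have fin: "finite (insert 1 (insert (r / 2) (H ` T)))" using \<open>finite T\<close> by simp
    show "0 < h" using \<open>finite T\<close> H(1) r by (auto simp: h_def)
    show "h \<le> 1" "h \<le> r / 2" "\<And>t. t \<in> T \<Longrightarrow> h \<le> H t"
      unfolding h_def by (rule Min_le[OF fin], blast)+
  qed
  show ?thesis
  proof (rule that[OF h(1)])
    fix m w v :: complex
    assume w: "cmod w \<le> h" and pm: "m - w \<in> obstacle_free \<rho> S" "m + w \<in> obstacle_free \<rho> S"
      and v: "v \<in> obstacle_free \<rho> S" and near: "\<And>z. z \<in> obstacle_free \<rho> S \<Longrightarrow> cmod (v - m) \<le> cmod (z - m)"
    define d where "d = cmod w"
    show "v = m \<or> (\<exists>c R n s. (c, R) \<in> S \<and> cmod n = 1 \<and> v = c + of_real R * n \<and> m = v - of_real s * n \<and> 0 \<le> s \<and>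
         s * (2 * R - s) \<le> (cmod w)\<^sup>2 \<and> s \<le> (cmod w)\<^sup>2 / R \<and> \<bar>Re (cnj n * w)\<bar> \<le> (cmod w)\<^sup>2 / R)"
    proof (cases "m \<in> obstacle_free \<rho> S")
      case True
      from near[OF this] show ?thesis by simp
    next
      case False
      have "m = (1 / 2) *\<^sub>R (m - w) + (1 / 2) *\<^sub>R (m + w)"
        by (simp add: complex_eq_iff field_simps)
      moreover have "m - w \<in> cball 0 \<rho>" "m + w \<in> cball 0 \<rho>" using pm by (auto simp: obstacle_free_def)
      ultimately have "m \<in> cball 0 \<rho>" using convexD[OF convex_cball, of "m - w" 0 \<rho> "m + w" "1/2" "1/2"] by simp
      then have m\<rho>: "cmod m \<le> \<rho>" by simp
      then obtain c R where cR: "(c, R) \<in> S" "cmod (m - c) < R" using False by (auto simp: obstacle_free_def not_le)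
      have R: "r \<le> R" "R \<le> 1" "0 < R" using S(2)[OF cR(1)] r by auto
      have "w \<noteq> 0" using False pm by auto
      then have d: "0 < d" "d \<le> h" "d \<le> 1" using w h by (auto simp: d_def)
      have out: "R' \<le> cmod (m + w - c')" "R' \<le> cmod (m - w - c')" if "(c', R') \<in> S" for c' R'
        using pm that by (auto simp: obstacle_free_def)
      define b where "b = cmod (m - c)"
      have t1: "2 * \<bar>Re ((m - c) * cnj w)\<bar> \<le> b\<^sup>2 + d\<^sup>2 - R\<^sup>2"
        using between_points(1)[OF out[OF cR(1)]] R by (simp add: b_def d_def)
      have b: "b < R" "0 \<le> b" using cR by (auto simp: b_def)
      have b2: "b\<^sup>2 < R\<^sup>2" using b by (intro power_strict_mono) auto
      have lowb: "R\<^sup>2 - b\<^sup>2 \<le> d\<^sup>2" using t1 by linarith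
      have "d\<^sup>2 \<le> (R / 2)\<^sup>2" using d h R by (intro power_mono) auto
      moreover have "(R / 2)\<^sup>2 = R\<^sup>2 / 4" by (simp add: power_divide)
      ultimately have "(R / 2)\<^sup>2 \<le> b\<^sup>2" using lowb zero_le_power2[of R] by linarith
      then have bR: "R / 2 \<le> b" using b(2) by (rule power2_le_imp_le)
      then have b0: "0 < b" using R by linarith
      define n where "n = (m - c) / of_real b"
      define s where "s = R - b"
      define x where "x = c + of_real R * n"
      have n1: "cmod n = 1" using b0 by (simp add: n_def norm_divide b_def)
      have mc: "m = c + of_real b * n" using b0 by (simp add: n_def)
      have mx: "m = x - of_real s * n" by (simp add: mc x_def s_def algebra_simps)
      have s0: "0 < s" using b by (simp add: s_def)
      have sR: "s * (2 * R - s) \<le> d\<^sup>2" using lowb by (simp add: s_def power2_eq_square algebra_simps)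
      have sd: "s \<le> d\<^sup>2 / R"
      proof -
        have "s * R \<le> s * (2 * R - s)" using s0 b by (intro mult_left_mono) (auto simp: s_def)
        then show ?thesis using sR R by (simp add: le_divide_eq)
      qed
      have sdr: "s \<le> d\<^sup>2 / r"
        using sd R r divide_left_mono[of r R "d\<^sup>2"] by (simp add: order_trans)
      have xm: "cmod (x - m) = s" using mx n1 s0 by (simp add: norm_mult)
      define u where "u = d\<^sup>2 / r"
      have u: "0 \<le> u" "u\<^sup>2 + 2 * u + d\<^sup>2 \<le> C * d\<^sup>2"
      proof -
        show "0 \<le> u" using r by (simp add: u_def)
        have "d\<^sup>2 \<le> 1" using d by (simp add: power_le_one)
        then have "d\<^sup>2 * d\<^sup>2 \<le> d\<^sup>2 * 1" by (intro mult_left_mono) auto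
        then have "d\<^sup>2 * d\<^sup>2 / r\<^sup>2 \<le> d\<^sup>2 / r\<^sup>2" by (intro divide_right_mono) auto
        then show "u\<^sup>2 + 2 * u + d\<^sup>2 \<le> C * d\<^sup>2"
          by (simp add: u_def C_def power_divide algebra_simps power2_eq_square)
      qed
      have nc: "near_circle C m w c R"
      proof -
        have "d\<^sup>2 \<le> C * d\<^sup>2" using mult_right_mono[OF C1, of "d\<^sup>2"] by simp
        then show ?thesis
          unfolding near_circle_def d_def[symmetric] b_def[symmetric] using t1 lowb b2 by linarith
      qed
      have excl: "\<not> near_circle C m w c' R'" if "(c', R') \<in> insert (0, \<rho>) S" "(c', R') \<noteq> (c, R)" for c' R'
      proof
        assume n2: "near_circle C m w c' R'"
        have t: "((c, R), (c', R')) \<in> T" using that cR(1) by (auto simp: T_def)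
        have "cmod w \<le> H ((c, R), (c', R'))" using w h(4)[OF t] by linarith
        from H(2)[OF t _ this, of m] show False using \<open>w \<noteq> 0\<close> nc n2 by simp
      qed
      have xX: "x \<in> obstacle_free \<rho> S"
        unfolding obstacle_free_def mem_Collect_eq
      proof (intro conjI ballI, rule ccontr)
        assume "\<not> cmod x \<le> \<rho>"
        then have a: "\<rho> < cmod m + u"
          using norm_triangle_ineq2[of x m] xm sdr unfolding u_def by linarith
        have t: "2 * \<bar>Re ((m - 0) * cnj w)\<bar> \<le> \<rho>\<^sup>2 - (cmod (m - 0))\<^sup>2 - (cmod w)\<^sup>2"
          using pm by (intro between_points(2)) (auto simp: obstacle_free_def)
        have "\<rho>\<^sup>2 \<le> (cmod m + u)\<^sup>2" using a \<rho> by (intro power_mono) auto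
        moreover have "cmod m * u \<le> 1 * u" using m\<rho> \<rho> u by (intro mult_right_mono) auto
        ultimately have "\<rho>\<^sup>2 - (cmod m)\<^sup>2 \<le> u\<^sup>2 + 2 * u" by (simp add: power2_sum)
        moreover have "0 \<le> d\<^sup>2" by simp
        ultimately have "near_circle C m w 0 \<rho>"
          using t u(2) unfolding near_circle_def d_def diff_zero by linarith
        moreover have "(0, \<rho>) \<noteq> (c, R)" using cR(1) S(3) by auto
        ultimately show False using excl by blast
      next
        fix cR' assume "cR' \<in> S"
        moreover obtain c' R' where cR'_def: "cR' = (c', R')" by (cases cR')
        ultimately have cR': "(c', R') \<in> S" by simp
        have R': "0 < R'" "R' \<le> 1" using S(2)[OF cR'] r by auto
        have "R' \<le> cmod (x - c')"
        proof (cases "(c', R') = (c, R)")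
          case True
          then show ?thesis using R n1 by (simp add: x_def norm_mult)
        next
          case ne: False
          show ?thesis
          proof (rule ccontr)
            assume "\<not> R' \<le> cmod (x - c')"
            then have a: "cmod (m - c') \<le> R' + u"
              using norm_triangle_ineq[of "m - x" "x - c'"] xm sdr unfolding u_def by (simp add: norm_minus_commute)
            have t: "2 * \<bar>Re ((m - c') * cnj w)\<bar> \<le> (cmod (m - c'))\<^sup>2 + (cmod w)\<^sup>2 - R'\<^sup>2"
              using between_points(1)[OF out[OF cR']] R' by simp
            have "(cmod (m - c'))\<^sup>2 \<le> (R' + u)\<^sup>2" using a by (intro power_mono) auto
            moreover have "R' * u \<le> 1 * u" using R' u by (intro mult_right_mono) auto
            ultimately have "(cmod (m - c'))\<^sup>2 - R'\<^sup>2 \<le> u\<^sup>2 + 2 * u" by (simp add: power2_sum)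
            moreover have "0 \<le> d\<^sup>2" "0 \<le> u\<^sup>2" by auto
            ultimately have "near_circle C m w c' R'"
              using t u unfolding near_circle_def d_def by linarith
            then show False using excl[of c' R'] cR' ne by auto
          qed
        qed
        then show "case cR' of (c, R) \<Rightarrow> R \<le> cmod (x - c)" by (simp add: cR'_def)
      qed
      \<comment> \<open>A step \<open>z\<close> of length at most \<open>s\<close> from
        \<open>m\<close> can reach the circle, whose distance from \<open>m\<close> is
        \<open>s\<close>, only radially.\<close>
      have "v = x"
      proof -
        define z where "z = v - m"
        have z: "cmod z \<le> s" using near[OF xX] xm by (simp add: z_def)
        have "R \<le> cmod (v - c)" using v cR(1) by (auto simp: obstacle_free_def)
        moreover have "v - c = z + of_real b * n" by (simp add: z_def mc)
        ultimately have "R\<^sup>2 \<le> (cmod (z + of_real b * n))\<^sup>2" using R by (intro power_mono) auto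
        also have "\<dots> = (cmod z)\<^sup>2 + 2 * b * Re (cnj n * z) + b\<^sup>2 * (cmod n)\<^sup>2"
          unfolding cmod_power2 by (simp add: power2_eq_square algebra_simps)
        finally have "R\<^sup>2 - b\<^sup>2 \<le> (cmod z)\<^sup>2 + 2 * b * Re (cnj n * z)" using n1 by simp
        moreover have zs: "(cmod z)\<^sup>2 \<le> s\<^sup>2" using z by (intro power_mono) auto
        moreover have "R\<^sup>2 - b\<^sup>2 = s\<^sup>2 + 2 * b * s" by (simp add: s_def power2_eq_square algebra_simps)
        ultimately have "2 * b * s \<le> 2 * b * Re (cnj n * z)" by linarith
        then have ge: "s \<le> Re (cnj n * z)" using b0 by simp
        have "(cmod (z - of_real s * n))\<^sup>2 = (cmod z)\<^sup>2 - 2 * s * Re (cnj n * z) + s\<^sup>2 * (cmod n)\<^sup>2"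
          unfolding cmod_power2 by (simp add: power2_eq_square algebra_simps)
        also have "\<dots> \<le> 0"
        proof -
          have "2 * s * s \<le> 2 * s * Re (cnj n * z)" using ge s0 by (intro mult_left_mono) auto
          moreover have "s\<^sup>2 * (cmod n)\<^sup>2 = s * s" "s\<^sup>2 = s * s" using n1 by (simp_all add: power2_eq_square)
          ultimately show ?thesis using zs by linarith
        qed
        finally have "z = of_real s * n" by simp
        then show ?thesis using mx by (simp add: z_def algebra_simps)
      qed
      moreover have "\<bar>Re (cnj n * w)\<bar> \<le> d\<^sup>2 / R"
      proof -
        have "Re ((m - c) * cnj w) = b * Re (cnj n * w)" by (simp add: mc algebra_simps)
        then have "2 * (b * \<bar>Re (cnj n * w)\<bar>) \<le> d\<^sup>2" using t1 b2 b0 by (simp add: abs_mult)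
        moreover have "R / 2 * \<bar>Re (cnj n * w)\<bar> \<le> b * \<bar>Re (cnj n * w)\<bar>" using bR by (intro mult_right_mono) auto
        ultimately have "\<bar>Re (cnj n * w)\<bar> * R \<le> d\<^sup>2" by (simp add: mult.commute)
        then show ?thesis using R by (simp only: pos_le_divide_eq)
      qed
      ultimately show ?thesis
        using cR(1) n1 x_def mx s0 sR sd unfolding d_def by (metis less_imp_le)
    qed
  qed
qed

subsection \<open>Admissible arcs in horocyclically convex domains\<close>

lemma finite_common_bound:
  fixes f :: "'a \<Rightarrow> real"
  assumes "finite S" "\<And>x. x \<in> S \<Longrightarrow> 0 < f x"
  obtains e where "0 < e" "e \<le> 1" "\<And>x. x \<in> S \<Longrightarrow> e \<le> f x"
proof (rule that[of "Min (insert 1 (f ` S))"])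
  show "0 < Min (insert 1 (f ` S))" using assms by auto
  show "Min (insert 1 (f ` S)) \<le> 1" "\<And>x. x \<in> S \<Longrightarrow> Min (insert 1 (f ` S)) \<le> f x"
    using assms(1) by (auto intro!: Min_le simp del: Min_insert)
qed

section \<open>Covering the boundary by enlarged horodisks\<close>

lemma horodisk_dest:
  assumes "horodisk H"
  obtains c r where "H = ball c r" "0 < r" "r < 1" "cmod c = 1 - r"
proof -
  obtain c r \<zeta> where r: "0 < r" and H: "H = ball c r" and sub: "ball c r \<subseteq> ball 0 1"
    and \<zeta>: "sphere c r \<inter> sphere 0 1 = {\<zeta>}"
    using assms unfolding horodisk_def by blast
  have "dist c 0 + r \<le> 1" using sub r ball_subset_ball_iff[of c r 0 1] by auto
  then have le: "cmod c \<le> 1 - r" by simp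
  have "\<zeta> \<in> sphere c r" "\<zeta> \<in> sphere 0 1" using \<zeta> by auto
  then have "dist c \<zeta> = r" "cmod \<zeta> = 1" by auto
  then have "1 \<le> cmod c + r" using norm_triangle_ineq2[of \<zeta> c] by (simp add: dist_norm norm_minus_commute)
  then have cr: "cmod c = 1 - r" using le by simp
  \<comment> \<open>With \<open>r = 1\<close> the two circles would coincide and share more than one
    point.\<close>
  have "r \<noteq> 1"
  proof
    assume "r = 1"
    then have "c = 0" using cr by simp
    then have "sphere 0 1 = {\<zeta>}" using \<zeta> \<open>r = 1\<close> by simp
    moreover have "(1::complex) \<in> sphere 0 1" "(-1::complex) \<in> sphere 0 1" by auto
    ultimately have "(1::complex) = \<zeta>" "(-1::complex) = \<zeta>" by blast+
    then show False by (metis one_neq_neg_one)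
  qed
  moreover have "r \<le> 1" using cr norm_ge_zero[of c] by linarith
  ultimately show ?thesis using that[OF H r _ cr] by simp
qed

text \<open>The circle of radius \<open>R'\<close> about \<open>c\<close> has hyperbolic curvature
  \<open>(1 - (cmod c)\<^sup>2 + R'\<^sup>2) / R'\<close>. For a horodisk of radius \<open>r\<close>
  one has \<open>cmod c = 1 - r\<close>, so enlarging it concentrically to a radius of at most 1
  lowers this value below 2. Being open, \<open>G\<close> misses the closed horodisk too, which
  leaves a gap to the compact set \<open>L\<close>. A whole range of radii is offered because they
  are adjusted later.\<close>

lemma enlarged_horodisk:
  assumes "horo_convex G" "open G" "G \<subseteq> ball 0 1" "compact L" "L \<noteq> {}" "L \<subseteq> G"
    and \<omega>: "\<omega> \<in> frontier G" "cmod \<omega> < 1"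
  obtains c R \<tau> where "0 < \<tau>" "0 < R" "\<omega> \<in> ball c R"
    "\<And>R'. R \<le> R' \<Longrightarrow> R' \<le> R + \<tau> \<Longrightarrow> R' \<le> 1 \<and> 1 - (cmod c)\<^sup>2 + R'\<^sup>2 < 2 * R' \<and> (\<forall>z\<in>L. R' \<le> cmod (z - c))"
proof -
  obtain H where H: "horodisk H" "\<omega> \<in> frontier H" "G \<inter> H = {}"
    using assms(1) \<omega> unfolding horo_convex_def by (metis IntI dist_0_norm mem_ball)
  obtain c r where cr: "H = ball c r" "0 < r" "r < 1" "cmod c = 1 - r" using horodisk_dest[OF H(1)] .
  have \<omega>c: "dist c \<omega> = r" using H(2) cr by simp
  have "G \<inter> closure H = {}" using H(3) assms(2) by (simp add: open_Int_closure_eq_empty)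
  then have out: "r < cmod (z - c)" if "z \<in> L" for z
    using that assms(6) cr(1,2) by (force simp: dist_norm norm_minus_commute)
  have "continuous_on L (\<lambda>z. cmod (z - c))" by (intro continuous_intros)
  then obtain z0 where z0: "z0 \<in> L" "\<And>z. z \<in> L \<Longrightarrow> cmod (z0 - c) \<le> cmod (z - c)"
    using continuous_attains_inf[OF assms(4,5)] by metis
  define \<epsilon> where "\<epsilon> = min (cmod (z0 - c) - r) (1 - r)"
  have \<epsilon>: "0 < \<epsilon>" using out[OF z0(1)] cr by (simp add: \<epsilon>_def)
  show ?thesis
  proof (rule that[of "\<epsilon> / 2" "r + \<epsilon> / 2" c])
    show "\<omega> \<in> ball c (r + \<epsilon> / 2)" using \<omega>c \<epsilon> by simp
    fix R' assume R': "r + \<epsilon> / 2 \<le> R'" "R' \<le> r + \<epsilon> / 2 + \<epsilon> / 2"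
    have le: "R' \<le> 1" "R' \<le> cmod (z0 - c)" using R' by (auto simp: \<epsilon>_def min_def split: if_splits)
    have "r < R'" using R' \<epsilon> by linarith
    then have "(1 - R')\<^sup>2 < (1 - r)\<^sup>2" using le by (intro power_strict_mono) auto
    then have "1 - (cmod c)\<^sup>2 + R'\<^sup>2 < 2 * R'" unfolding cr(4) by (simp add: power2_eq_square algebra_simps)
    then show "R' \<le> 1 \<and> 1 - (cmod c)\<^sup>2 + R'\<^sup>2 < 2 * R' \<and> (\<forall>z\<in>L. R' \<le> cmod (z - c))"
      using le z0(2) by (meson order_trans)
  qed (use \<epsilon> cr in auto)
qed

lemma tangentD:
  assumes "\<not> nontangent c R c' R'" "0 \<le> R" "0 \<le> R'"
  shows "dist c c' = R + R' \<or> dist c c' = \<bar>R - R'\<bar>"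
proof -
  let ?D = "(dist c c')\<^sup>2"
  have "(?D - (R + R')\<^sup>2) * (?D - (R - R')\<^sup>2) = (?D - R\<^sup>2 - R'\<^sup>2)\<^sup>2 - 4 * R\<^sup>2 * R'\<^sup>2" by algebra
  also have "\<dots> = 0" using assms(1) by (simp add: nontangent_def)
  finally have "?D = (R + R')\<^sup>2 \<or> ?D = (R - R')\<^sup>2" by simp
  then show ?thesis
  proof
    assume d: "?D = (R + R')\<^sup>2"
    have "dist c c' = R + R'" by (rule power2_eq_imp_eq[OF d]) (use assms(2,3) in simp_all)
    then show ?thesis ..
  next
    assume "?D = (R - R')\<^sup>2"
    then have d: "?D = \<bar>R - R'\<bar>\<^sup>2" unfolding power2_abs .
    have "dist c c' = \<bar>R - R'\<bar>" by (rule power2_eq_imp_eq[OF d]) simp_all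
    then show ?thesis ..
  qed
qed

lemma finite_avoid:
  fixes A :: "real set"
  assumes "finite A" "a < b"
  obtains x where "a < x" "x < b" "x \<notin> A"
proof -
  have "infinite ({a<..<b} - A)" using assms by (simp add: infinite_Ioo)
  then have "{a<..<b} - A \<noteq> {}" by (metis finite.emptyI)
  then obtain x where "x \<in> {a<..<b} - A" by blast
  then show ?thesis using that[of x] by simp
qed

text \<open>The radii of a finite cover are multiplied by a common factor \<open>1 + t\<close>.
  Unlike a common summand, a factor also changes the differences of radii, so that external and
  internal tangencies both occur for finitely many \<open>t\<close> only. The growth also creates
  the margin \<open>\<delta>\<close> between the obstacles and the covering disks.\<close>

lemma exists_obstacles:
  assumes G: "horo_convex G" "open G" "G \<subseteq> ball 0 1" and L: "compact L" "L \<noteq> {}" "L \<subseteq> G"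
  obtains S r \<eta> \<delta> \<rho> where "finite S" "0 < r" "r \<le> 1" "0 < \<eta>" "0 < \<delta>" "0 < \<rho>" "\<rho> + \<delta> < 1" "2 * \<rho> \<le> 2 - \<eta>"
    "\<And>c R. (c, R) \<in> S \<Longrightarrow> r \<le> R \<and> R \<le> 1 \<and> (1 - (cmod c)\<^sup>2 + R\<^sup>2) / R \<le> 2 - \<eta>"
    "\<And>c R c' R'. (c, R) \<in> S \<Longrightarrow> (c', R') \<in> insert (0, \<rho>) S \<Longrightarrow> (c, R) \<noteq> (c', R') \<Longrightarrow> nontangent c R c' R'"
    "(0, \<rho>) \<notin> S" "L \<subseteq> obstacle_free \<rho> S"
    "\<And>z. cmod z \<le> \<rho> + \<delta> \<Longrightarrow> (\<And>c R. (c, R) \<in> S \<Longrightarrow> R - \<delta> \<le> cmod (z - c)) \<Longrightarrow> z \<notin> frontier G"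
proof -
  obtain zm where zm: "zm \<in> L" "\<And>z. z \<in> L \<Longrightarrow> cmod z \<le> cmod zm"
    using continuous_attains_sup[OF L(1,2), of cmod] continuous_on_norm_id by blast
  define \<rho>0 \<rho>1 where "\<rho>0 = cmod zm" and "\<rho>1 = (1 + \<rho>0) / 2"
  have \<rho>01: "0 \<le> \<rho>0" "\<rho>0 < \<rho>1" "\<rho>1 < 1" using zm(1) L(3) G(3) by (auto simp: \<rho>0_def \<rho>1_def)
  define K where "K = frontier G \<inter> cball 0 \<rho>1"
  have "compact K" unfolding K_def by (simp add: closed_Int_compact)
  define good where "good = (\<lambda>c R. R \<le> 1 \<and> 1 - (cmod c)\<^sup>2 + R\<^sup>2 < 2 * R \<and> (\<forall>z\<in>L. R \<le> cmod (z - c)))"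
  have "\<exists>c R \<tau>. 0 < \<tau> \<and> 0 < R \<and> \<omega> \<in> ball c R \<and> (\<forall>R'. R \<le> R' \<and> R' \<le> R + \<tau> \<longrightarrow> good c R')" if "\<omega> \<in> K" for \<omega>
  proof -
    have "\<omega> \<in> frontier G" "cmod \<omega> < 1" using that \<rho>01 by (auto simp: K_def)
    from enlarged_horodisk[OF G L this] show ?thesis unfolding good_def by metis
  qed
  then obtain c R \<tau> where cover: "\<And>\<omega>. \<omega> \<in> K \<Longrightarrow> 0 < \<tau> \<omega>" "\<And>\<omega>. \<omega> \<in> K \<Longrightarrow> 0 < R \<omega>" "\<And>\<omega>. \<omega> \<in> K \<Longrightarrow> \<omega> \<in> ball (c \<omega>) (R \<omega>)"
    "\<And>\<omega> R'. \<omega> \<in> K \<Longrightarrow> R \<omega> \<le> R' \<Longrightarrow> R' \<le> R \<omega> + \<tau> \<omega> \<Longrightarrow> good (c \<omega>) R'"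
    by metis
  obtain \<Omega> where \<Omega>: "\<Omega> \<subseteq> K" "finite \<Omega>" "K \<subseteq> (\<Union>\<omega>\<in>\<Omega>. ball (c \<omega>) (R \<omega>))"
    using compactE_image[OF \<open>compact K\<close>, of K "\<lambda>\<omega>. ball (c \<omega>) (R \<omega>)"] cover(3) by (metis (no_types, lifting) UN_iff open_ball subsetI)
  have \<Omega>K: "\<omega> \<in> K" if "\<omega> \<in> \<Omega>" for \<omega> using that \<Omega>(1) by blast
  obtain t0 where t0: "0 < t0" "\<And>\<omega>. \<omega> \<in> \<Omega> \<Longrightarrow> t0 \<le> \<tau> \<omega>"
    using finite_common_bound[OF \<Omega>(2), of \<tau>] cover(1) \<Omega>K by metis
  \<comment> \<open>The values of \<open>t\<close> at which two scaled circles are tangent. For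
    equal radii the second entry is -1 by division by zero; such circles touch internally only if
    they coincide.\<close>
  define bad where "bad = (\<lambda>(\<omega>, \<omega>'). {dist (c \<omega>) (c \<omega>') / (R \<omega> + R \<omega>') - 1, dist (c \<omega>) (c \<omega>') / \<bar>R \<omega> - R \<omega>'\<bar> - 1})"
  have "finite (\<Union>p\<in>\<Omega> \<times> \<Omega>. bad p)" using \<Omega>(2) by (auto simp: bad_def)
  then obtain t where t: "0 < t" "t < t0" "t \<notin> (\<Union>p\<in>\<Omega> \<times> \<Omega>. bad p)"
    using finite_avoid[OF _ t0(1)] by metis
  define Q where "Q = (\<lambda>\<omega>. (1 + t) * R \<omega>)"
  define S where "S = (\<lambda>\<omega>. (c \<omega>, Q \<omega>)) ` \<Omega>"
  have finS: "finite S" using \<Omega>(2) by (simp add: S_def)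
  have R1: "R \<omega> \<le> 1" if "\<omega> \<in> \<Omega>" for \<omega>
    using cover(4)[OF \<Omega>K[OF that], of "R \<omega>"] cover(1)[OF \<Omega>K[OF that]] by (simp add: good_def)
  have Q: "0 < Q \<omega>" "good (c \<omega>) (Q \<omega>)" if "\<omega> \<in> \<Omega>" for \<omega>
  proof -
    have r: "0 < R \<omega>" using cover(2) \<Omega>K that by blast
    show "0 < Q \<omega>" using r t by (simp add: Q_def)
    have "t * R \<omega> \<le> t" using R1[OF that] t by (intro mult_left_le) auto
    moreover have "Q \<omega> = R \<omega> + t * R \<omega>" by (simp add: Q_def algebra_simps)
    moreover have "0 < t * R \<omega>" using t r by simp
    ultimately have "R \<omega> \<le> Q \<omega>" "Q \<omega> \<le> R \<omega> + \<tau> \<omega>"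
      using t0(2)[OF that] t by linarith+
    then show "good (c \<omega>) (Q \<omega>)" using cover(4)[OF \<Omega>K[OF that]] by blast
  qed
  \<comment> \<open>The radii at which the outer circle would be tangent to an obstacle. Avoiding
    them also keeps \<open>(0, \<rho>)\<close> out of \<open>S\<close>.\<close>
  define bad2 where "bad2 = (\<lambda>(c, R). {cmod c - R, R - cmod c, R + cmod c})"
  have "finite (\<Union>p\<in>S. bad2 p)" using finS by (auto simp: bad2_def)
  then obtain \<rho> where \<rho>: "\<rho>0 < \<rho>" "\<rho> < \<rho>1" "\<rho> \<notin> (\<Union>p\<in>S. bad2 p)"
    using finite_avoid[OF _ \<rho>01(2)] by metis
  obtain \<delta>0 where \<delta>0: "0 < \<delta>0" "\<And>\<omega>. \<omega> \<in> \<Omega> \<Longrightarrow> \<delta>0 \<le> t * R \<omega>"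
    using finite_common_bound[OF \<Omega>(2), of "\<lambda>\<omega>. t * R \<omega>"] cover(2) \<Omega>K t(1) by (metis mult_pos_pos)
  \<comment> \<open>\<open>\<delta>0\<close> keeps the widened free region off the covering disks;
    \<open>\<rho>1 - \<rho>\<close> keeps it in the disk of radius \<open>\<rho>1\<close>, in which
    they cover the boundary.\<close>
  define \<delta> where "\<delta> = min \<delta>0 (\<rho>1 - \<rho>)"
  obtain r where r: "0 < r" "r \<le> 1" "\<And>\<omega>. \<omega> \<in> \<Omega> \<Longrightarrow> r \<le> Q \<omega>"
    using finite_common_bound[OF \<Omega>(2), of Q] Q(1) by metis
  have "0 < 2 - (1 - (cmod (c \<omega>))\<^sup>2 + (Q \<omega>)\<^sup>2) / Q \<omega>" if "\<omega> \<in> \<Omega>" for \<omega>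
    using Q[OF that] by (simp add: good_def divide_less_eq)
  then obtain \<eta>0 where \<eta>0: "0 < \<eta>0" "\<And>\<omega>. \<omega> \<in> \<Omega> \<Longrightarrow> \<eta>0 \<le> 2 - (1 - (cmod (c \<omega>))\<^sup>2 + (Q \<omega>)\<^sup>2) / Q \<omega>"
    using finite_common_bound[OF \<Omega>(2), of "\<lambda>\<omega>. 2 - (1 - (cmod (c \<omega>))\<^sup>2 + (Q \<omega>)\<^sup>2) / Q \<omega>"] by metis
  define \<eta> where "\<eta> = min \<eta>0 (2 - 2 * \<rho>)"
  show ?thesis
  proof (rule that[OF finS r(1,2)])
    show "0 < \<eta>" "0 < \<delta>" "0 < \<rho>" "\<rho> + \<delta> < 1" "2 * \<rho> \<le> 2 - \<eta>"
      using \<eta>0 \<delta>0 \<rho> \<rho>01 by (auto simp: \<eta>_def \<delta>_def min_def)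
    show "r \<le> R' \<and> R' \<le> 1 \<and> (1 - (cmod c')\<^sup>2 + R'\<^sup>2) / R' \<le> 2 - \<eta>" if cR: "(c', R') \<in> S" for c' R'
    proof -
      obtain \<omega> where \<omega>: "\<omega> \<in> \<Omega>" "c' = c \<omega>" "R' = Q \<omega>" using cR by (auto simp: S_def)
      have "(1 - (cmod c')\<^sup>2 + R'\<^sup>2) / R' \<le> 2 - \<eta>" using \<eta>0(2)[OF \<omega>(1)] unfolding \<omega>(2,3) \<eta>_def by linarith
      then show ?thesis using r(3)[OF \<omega>(1)] Q(2)[OF \<omega>(1)] \<omega> by (simp add: good_def)
    qed
    show "nontangent c1 R1 c2 R2" if pr: "(c1, R1) \<in> S" "(c2, R2) \<in> insert (0, \<rho>) S" "(c1, R1) \<noteq> (c2, R2)" for c1 R1 c2 R2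
    proof (rule ccontr)
      assume nt: "\<not> nontangent c1 R1 c2 R2"
      obtain \<omega> where \<omega>: "\<omega> \<in> \<Omega>" "c1 = c \<omega>" "R1 = Q \<omega>" using pr(1) by (auto simp: S_def)
      consider "c2 = 0" "R2 = \<rho>" | \<omega>' where "\<omega>' \<in> \<Omega>" "c2 = c \<omega>'" "R2 = Q \<omega>'" using pr(2) by (auto simp: S_def)
      then show False
      proof cases
        case 1
        have "dist c1 c2 = R1 + R2 \<or> dist c1 c2 = \<bar>R1 - R2\<bar>"
          using tangentD[OF nt] 1 \<omega> Q(1)[OF \<omega>(1)] \<rho> \<rho>01 by simp
        then have "\<rho> \<in> bad2 (c1, R1)" using 1 by (auto simp: bad2_def abs_if split: if_splits)
        then show False using \<rho>(3) pr(1) by blast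
      next
        case 2
        have pos: "0 < R \<omega>" "0 < R \<omega>'" using cover(2) \<Omega>K \<omega>(1) 2(1) by auto
        have "dist c1 c2 = R1 + R2 \<or> dist c1 c2 = \<bar>R1 - R2\<bar>"
          using tangentD[OF nt] 2 \<omega> Q(1)[OF \<omega>(1)] Q(1)[OF 2(1)] by simp
        moreover have "R1 + R2 = (1 + t) * (R \<omega> + R \<omega>')" "R1 - R2 = (1 + t) * (R \<omega> - R \<omega>')"
          using \<omega> 2 by (auto simp: Q_def algebra_simps)
        ultimately have "dist c1 c2 = (1 + t) * (R \<omega> + R \<omega>') \<or> dist c1 c2 = (1 + t) * \<bar>R \<omega> - R \<omega>'\<bar>"
          using t(1) by (simp add: abs_mult)
        then have "t \<in> bad (\<omega>, \<omega>')"
        proof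
          assume "dist c1 c2 = (1 + t) * (R \<omega> + R \<omega>')"
          then have "dist (c \<omega>) (c \<omega>') / (R \<omega> + R \<omega>') = 1 + t" using pos \<omega> 2 by simp
          then show ?thesis by (simp add: bad_def)
        next
          assume d: "dist c1 c2 = (1 + t) * \<bar>R \<omega> - R \<omega>'\<bar>"
          have "R \<omega> \<noteq> R \<omega>'"
          proof
            assume "R \<omega> = R \<omega>'"
            then have "c1 = c2" "R1 = R2" using d \<omega> 2 by (auto simp: Q_def)
            then show False using pr(3) by simp
          qed
          then have "dist (c \<omega>) (c \<omega>') / \<bar>R \<omega> - R \<omega>'\<bar> = 1 + t" using d \<omega> 2 by simp
          then show ?thesis by (simp add: bad_def)
        qed
        then show False using t(3) \<omega>(1) 2(1) by blast
      qed
    qed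
    show "(0, \<rho>) \<notin> S"
    proof
      assume "(0, \<rho>) \<in> S"
      moreover have "\<rho> \<in> bad2 (0, \<rho>)" by (simp add: bad2_def)
      ultimately show False using \<rho>(3) by blast
    qed
    show "L \<subseteq> obstacle_free \<rho> S"
    proof
      fix z assume z: "z \<in> L"
      have "cmod z \<le> \<rho>" using zm(2)[OF z] \<rho>(1) by (simp add: \<rho>0_def)
      moreover have "Q \<omega> \<le> cmod (z - c \<omega>)" if "\<omega> \<in> \<Omega>" for \<omega> using Q(2)[OF that] z by (simp add: good_def)
      ultimately show "z \<in> obstacle_free \<rho> S" by (auto simp: obstacle_free_def S_def)
    qed
    show "z \<notin> frontier G" if z: "cmod z \<le> \<rho> + \<delta>" "\<And>c R. (c, R) \<in> S \<Longrightarrow> R - \<delta> \<le> cmod (z - c)" for z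
    proof
      assume "z \<in> frontier G"
      moreover have "cmod z \<le> \<rho>1" using z(1) by (simp add: \<delta>_def)
      ultimately have "z \<in> K" by (simp add: K_def)
      then obtain \<omega> where \<omega>: "\<omega> \<in> \<Omega>" "z \<in> ball (c \<omega>) (R \<omega>)" using \<Omega>(3) by blast
      have "Q \<omega> - \<delta> \<le> cmod (z - c \<omega>)" by (rule z(2)) (use \<omega>(1) in \<open>auto simp: S_def\<close>)
      moreover have "Q \<omega> = R \<omega> + t * R \<omega>" by (simp add: Q_def algebra_simps)
      moreover have "\<delta> \<le> t * R \<omega>" using \<delta>0(2)[OF \<omega>(1)] by (simp add: \<delta>_def)
      moreover have "cmod (z - c \<omega>) < R \<omega>" using \<omega>(2) by (simp add: dist_norm norm_minus_commute)
      ultimately show False by linarith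
    qed
  qed
qed

section \<open>Joining two points of the domain\<close>

lemma exists_Lipschitz_path:
  fixes G :: "complex set"
  assumes "open G" "connected G" "a \<in> G" "b \<in> G"
  obtains p :: "real \<Rightarrow> complex" and M where "compact (p ` {0..1})" "p ` {0..1} \<subseteq> G" "p 0 = a" "p 1 = b"
    "\<And>s t. s \<in> {0..1} \<Longrightarrow> t \<in> {0..1} \<Longrightarrow> cmod (p s - p t) \<le> M * \<bar>s - t\<bar>"
proof -
  obtain p where p: "polynomial_function p" "path_image p \<subseteq> G" "pathstart p = a" "pathfinish p = b"
    using connected_open_polynomial_connected[OF assms] by blast
  obtain p' where p': "polynomial_function p'" "\<And>x. (p has_vector_derivative p' x) (at x)"
    using has_vector_derivative_polynomial_function[OF p(1)] by metis
  have "compact (p' ` {0..1})"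
    by (intro compact_continuous_image continuous_on_polymonial_function p') auto
  then obtain M where M: "\<And>x. x \<in> {0..1} \<Longrightarrow> cmod (p' x) \<le> M"
    using compact_imp_bounded bounded_iff by (metis imageI)
  have "cmod (p s - p t) \<le> M * \<bar>s - t\<bar>" if "s \<in> {0..1}" "t \<in> {0..1}" for s t
  proof -
    have "norm (p s - p t) \<le> M * norm (s - t)"
    proof (rule differentiable_bound[of "{0..1}" p "\<lambda>x h. h *\<^sub>R p' x"])
      show "(p has_derivative (\<lambda>h. h *\<^sub>R p' x)) (at x within {0..1})" for x
        using p'(2)[of x] by (simp add: has_vector_derivative_def has_derivative_at_withinI)
      show "onorm (\<lambda>h. h *\<^sub>R p' x) \<le> M" if "x \<in> {0..1}" for x
      proof (rule onorm_bound)
        show "0 \<le> M" using M[OF that] norm_ge_zero[of "p' x"] by linarith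
        show "norm (h *\<^sub>R p' x) \<le> M * norm h" for h
          using mult_right_mono[OF M[OF that] abs_ge_zero[of h]] by (simp add: mult.commute)
      qed
    qed (use that in auto)
    then show ?thesis by simp
  qed
  moreover have "compact (p ` {0..1})"
    by (intro compact_continuous_image continuous_on_polymonial_function p) auto
  moreover have "p ` {0..1} \<subseteq> G" "p 0 = a" "p 1 = b"
    using p by (auto simp: path_image_def pathstart_def pathfinish_def)
  ultimately show ?thesis by (intro that[of p M])
qed

text \<open>\<open>A\<close> and \<open>B\<close> are consecutive edges with half sum
  \<open>w\<close> and half difference \<open>q\<close>. Multiplying \<open>g\<close> by
  \<open>cmod A * cmod B\<close> gives \<open>B * cnj A\<close>, whose real and imaginary parts are
  explicit in \<open>w\<close> and \<open>q\<close>.\<close>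

lemma round_sharp_corner:
  fixes v w q :: complex
  assumes small: "cmod q \<le> y * cmod w" and y: "0 < y" "y \<le> 1 / 8" and w: "w \<noteq> 0"
  defines "A \<equiv> w - q" and "B \<equiv> w + q"
  defines "g \<equiv> (B / of_real (cmod B)) / (A / of_real (cmod A))"
  shows "(1 - 2 * y) * cmod w < cmod A" "(1 - 2 * y) * cmod w < cmod B" "g \<noteq> -1"
    "Im g / (1 + Re g) = - 2 * Im (w * cnj q) / (cmod A * cmod B + ((cmod w)\<^sup>2 - (cmod q)\<^sup>2))"
    "(cmod w)\<^sup>2 - (cmod q)\<^sup>2 \<le> cmod A * cmod B"
proof -
  have wp: "0 < cmod w" using w by simp
  have yw: "0 < y * cmod w" using y wp by simp
  show A: "(1 - 2 * y) * cmod w < cmod A"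
    using norm_triangle_ineq2[of w q] small yw unfolding A_def by (simp add: algebra_simps)
  show B: "(1 - 2 * y) * cmod w < cmod B"
    using norm_triangle_ineq2[of w "- q"] small yw unfolding B_def by (simp add: algebra_simps)
  have "0 < (1 - 2 * y) * cmod w" using y wp by simp
  then have p: "0 < cmod A" "0 < cmod B" using A B by linarith+
  have AA: "A * cnj A = of_real (cmod A * cmod A)"
    by (metis complex_norm_square power2_eq_square)
  have A0: "A \<noteq> 0" using p by auto
  have g: "of_real (cmod A * cmod B) * g = B * cnj A"
  proof -
    have "of_real (cmod A * cmod B) * g * A = of_real (cmod A * cmod A) * B"
      using p A0 by (simp add: g_def)
    also have "\<dots> = (B * cnj A) * A" unfolding AA[symmetric] by (simp only: mult_ac)
    finally show ?thesis using A0 by simp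
  qed
  have Re: "Re (B * cnj A) = (cmod w)\<^sup>2 - (cmod q)\<^sup>2" and Im: "Im (B * cnj A) = - 2 * Im (w * cnj q)"
    unfolding A_def B_def cmod_power2 by (simp_all add: power2_eq_square algebra_simps)
  define L where "L = cmod A * cmod B"
  have L: "0 < L" using p by (simp add: L_def)
  have gRe: "L * Re g = (cmod w)\<^sup>2 - (cmod q)\<^sup>2" and gIm: "L * Im g = - 2 * Im (w * cnj q)"
    using arg_cong[OF g, of Re] arg_cong[OF g, of Im] unfolding Re Im L_def by simp_all
  have "cmod q < cmod w"
    using small y wp mult_right_mono[of y "1/8" "cmod w"] by linarith
  then have "(cmod q)\<^sup>2 < (cmod w)\<^sup>2" by (intro power_strict_mono) auto
  then have "0 < L * Re g" using gRe by simp
  then have Rg: "0 < Re g" using L by (simp add: zero_less_mult_iff)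
  then show "g \<noteq> -1" by auto
  have "Im g / (1 + Re g) = (L * Im g) / (L * (1 + Re g))" using L by simp
  also have "L * (1 + Re g) = L + L * Re g" by (simp add: distrib_left)
  finally show "Im g / (1 + Re g) = - 2 * Im (w * cnj q) / (cmod A * cmod B + ((cmod w)\<^sup>2 - (cmod q)\<^sup>2))"
    unfolding gRe gIm unfolding L_def .
  have "Re (B * cnj A) \<le> cmod (B * cnj A)" by (rule complex_Re_le_cmod)
  then show "(cmod w)\<^sup>2 - (cmod q)\<^sup>2 \<le> cmod A * cmod B" unfolding Re by (simp add: norm_mult mult.commute)
qed

lemma arcs_if_horo_convex:
  fixes G :: "complex set"
  assumes G: "open G" "connected G" "G \<subseteq> ball 0 1" "horo_convex G" and ab: "a \<in> G" "b \<in> G" "a \<noteq> b"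
  shows "\<exists>\<Gamma>. admissible_Jordan_arc \<Gamma> a b \<and> \<Gamma> \<subseteq> G"
proof -
  obtain p M where p: "compact (p ` {0..1})" "p ` {0..1} \<subseteq> G" "p 0 = a" "p 1 = b"
    "\<And>s t. s \<in> {0..1} \<Longrightarrow> t \<in> {0..1} \<Longrightarrow> cmod (p s - p t) \<le> M * \<bar>s - t\<bar>"
    using exists_Lipschitz_path[OF G(1,2) ab(1,2)] by metis
  have ne: "p ` {0..1} \<noteq> {}" by simp
  obtain S r \<eta> \<delta> \<rho> where S: "finite S" and r: "0 < r" "r \<le> 1" and \<eta>: "0 < \<eta>" and \<delta>: "0 < \<delta>"
    and \<rho>: "0 < \<rho>" "\<rho> + \<delta> < 1" "2 * \<rho> \<le> 2 - \<eta>"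
    and SR: "\<And>c R. (c, R) \<in> S \<Longrightarrow> r \<le> R \<and> R \<le> 1 \<and> (1 - (cmod c)\<^sup>2 + R\<^sup>2) / R \<le> 2 - \<eta>"
    and nt: "\<And>c R c' R'. (c, R) \<in> S \<Longrightarrow> (c', R') \<in> insert (0, \<rho>) S \<Longrightarrow> (c, R) \<noteq> (c', R') \<Longrightarrow> nontangent c R c' R'"
    and S0: "(0, \<rho>) \<notin> S" and L: "p ` {0..1} \<subseteq> obstacle_free \<rho> S"
    and fr: "\<And>z. cmod z \<le> \<rho> + \<delta> \<Longrightarrow> (\<And>c R. (c, R) \<in> S \<Longrightarrow> R - \<delta> \<le> cmod (z - c)) \<Longrightarrow> z \<notin> frontier G"
  proof (rule exists_obstacles[OF G(4,1,3) p(1) ne p(2)], goal_cases)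
    case (1 S r \<eta> \<delta> \<rho>)
    show ?case by (rule 1(1)[OF 1(2-14)])
  qed
  have SR': "r \<le> R \<and> R \<le> 1" if "(c, R) \<in> S" for c R using SR[OF that] by blast
  have \<rho>1: "\<rho> \<le> 1" using \<rho> \<delta> by linarith
  define X where "X = obstacle_free \<rho> S"
  obtain h0 where h0: "0 < h0"
    "\<And>m w v. cmod w \<le> h0 \<Longrightarrow> m - w \<in> X \<Longrightarrow> m + w \<in> X \<Longrightarrow>
       v \<in> X \<Longrightarrow> (\<And>z. z \<in> X \<Longrightarrow> cmod (v - m) \<le> cmod (z - m)) \<Longrightarrow>
       v = m \<or> (\<exists>c R n s. (c, R) \<in> S \<and> cmod n = 1 \<and> v = c + of_real R * n \<and> m = v - of_real s * n \<and> 0 \<le> s \<and>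
         s * (2 * R - s) \<le> (cmod w)\<^sup>2 \<and> s \<le> (cmod w)\<^sup>2 / R \<and> \<bar>Re (cnj n * w)\<bar> \<le> (cmod w)\<^sup>2 / R)"
  proof (rule nearest_to_midpoint[OF S SR' S0 r(1) \<rho>(1) \<rho>1 nt, folded X_def], goal_cases)
    case (5 h)
    show ?case by (rule 5(1)[OF 5(2-3)])
  qed assumption+
  \<comment> \<open>Both restrictions come from \<open>corner_curvature\<close>; 44 is twice the 22
    there, which makes that inequality strict.\<close>
  define y where "y = min (1 / 8) (\<eta> * r / 44)"
  have y: "0 < y" "y \<le> 1 / 8" using \<eta> r by (auto simp: y_def)
  have y\<eta>: "22 * y / r < \<eta>"
  proof -
    have "44 * y \<le> \<eta> * r" by (simp add: y_def min_def)
    then have "22 * y < \<eta> * r" using y by linarith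
    then show ?thesis using r by (simp add: divide_less_eq)
  qed
  \<comment> \<open>One bound for each use: \<open>h0\<close> for
    \<open>nearest_to_midpoint\<close>, \<open>y * r\<close> for small turns, and
    \<open>\<delta> / 2\<close> because the rounded curve stays within \<open>3 * h / 2\<close> of
    the vertices.\<close>
  define h where "h = min h0 (min (y * r) (\<delta> / 2))"
  have h: "0 < h" "h \<le> h0" "h \<le> y * r" "2 * h \<le> \<delta>" using h0(1) y r \<delta> by (auto simp: h_def min_def)
  obtain N :: nat where N: "M\<^sup>2 / h\<^sup>2 < real N" using reals_Archimedean2 by blast
  have "0 \<le> M\<^sup>2 / h\<^sup>2" by simp
  then have N0: "0 < N" using N by (metis gr0I leD of_nat_0)
  have MN: "M\<^sup>2 / N \<le> h\<^sup>2" using N N0 h(1) by (simp add: divide_less_eq divide_le_eq mult.commute)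
  have pX: "p t \<in> X" if "t \<in> {0..1}" for t using L that unfolding X_def by blast
  obtain v where v0: "v 0 = p 0" and vN: "v N = p 1" and vX: "\<And>j. j \<le> N \<Longrightarrow> v j \<in> X"
    and step: "\<And>j. j < N \<Longrightarrow> (cmod (v (Suc j) - v j))\<^sup>2 \<le> M\<^sup>2 / N"
    and near: "\<And>j z. Suc j < N \<Longrightarrow> z \<in> X \<Longrightarrow>
        cmod (v (Suc j) - (v j + v (Suc (Suc j))) / 2) \<le> cmod (z - (v j + v (Suc (Suc j))) / 2)"
  proof (rule energy_minimizer[OF compact_obstacle_free[of \<rho> S, folded X_def] N0 pX p(5)], goal_cases)
    case (4 v)
    show ?case by (rule 4(1)[OF 4(2-6)])
  qed assumption+
  have steph: "cmod (v (Suc j) - v j) \<le> h" if "j < N" for j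
  proof -
    have "(cmod (v (Suc j) - v j))\<^sup>2 \<le> h\<^sup>2" using step[OF that] MN by linarith
    then show ?thesis by (rule power2_le_imp_le) (use h(1) in simp)
  qed
  define \<Delta> where "\<Delta> = (\<lambda>j. v (Suc j) - v j)"
  define len where "len = (\<lambda>j. cmod (\<Delta> j))"
  define e where "e = (\<lambda>j. \<Delta> j / of_real (len j))"
  define w where "w = (\<lambda>j. (v (Suc (Suc j)) - v j) / 2)"
  define q where "q = (\<lambda>j. (v j + v (Suc (Suc j))) / 2 - v (Suc j))"
  have \<Delta>w: "\<Delta> j = w j - q j" "\<Delta> (Suc j) = w j + q j" for j
    unfolding \<Delta>_def w_def q_def by (simp_all add: complex_eq_iff field_simps)
  have wh: "cmod (w j) \<le> h" if "Suc j < N" for j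
  proof -
    have "w j = (\<Delta> j + \<Delta> (Suc j)) / 2" unfolding \<Delta>w(1)[of j] \<Delta>w(2)[of j] by simp
    then have "cmod (w j) = cmod (\<Delta> j + \<Delta> (Suc j)) / 2" by (simp only: norm_divide norm_numeral)
    also have "\<dots> \<le> (h + h) / 2"
      using steph[of j] steph[of "Suc j"] that unfolding \<Delta>_def
      by (intro divide_right_mono norm_triangle_mono) auto
    finally show ?thesis by simp
  qed
  have local: "q j = 0 \<or> (\<exists>c R n s. (c, R) \<in> S \<and> cmod n = 1 \<and> v (Suc j) = c + of_real R * n \<and> q j = - of_real s * n \<and> 0 \<le> s \<and>
         s * (2 * R - s) \<le> (cmod (w j))\<^sup>2 \<and> s \<le> (cmod (w j))\<^sup>2 / R \<and> \<bar>Re (cnj n * w j)\<bar> \<le> (cmod (w j))\<^sup>2 / R)"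
    if j: "Suc j < N" for j
  proof -
    define m where "m = (v j + v (Suc (Suc j))) / 2"
    have mw: "m - w j = v j" "m + w j = v (Suc (Suc j))"
      unfolding m_def w_def by (simp_all add: complex_eq_iff field_simps)
    have "cmod (w j) \<le> h0" using wh[OF j] h by linarith
    then have "v (Suc j) = m \<or> (\<exists>c R n s. (c, R) \<in> S \<and> cmod n = 1 \<and> v (Suc j) = c + of_real R * n \<and> m = v (Suc j) - of_real s * n \<and> 0 \<le> s \<and>
         s * (2 * R - s) \<le> (cmod (w j))\<^sup>2 \<and> s \<le> (cmod (w j))\<^sup>2 / R \<and> \<bar>Re (cnj n * w j)\<bar> \<le> (cmod (w j))\<^sup>2 / R)"
      by (rule h0(2)) (use vX j near[OF j] in \<open>auto simp: mw m_def[symmetric]\<close>)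
    moreover have "(v (Suc j) = m) = (q j = 0)" "(m = v (Suc j) - of_real s * n) = (q j = - of_real s * n)"
      for s n
      unfolding q_def m_def[symmetric] by (auto simp: algebra_simps)
    ultimately show ?thesis by simp
  qed
  have qy: "cmod (q j) \<le> y * cmod (w j)" if j: "Suc j < N" for j
    using local[OF j]
  proof
    assume "q j = 0"
    then show ?thesis using y by simp
  next
    assume "\<exists>c R n s. (c, R) \<in> S \<and> cmod n = 1 \<and> v (Suc j) = c + of_real R * n \<and> q j = - of_real s * n \<and> 0 \<le> s \<and>
         s * (2 * R - s) \<le> (cmod (w j))\<^sup>2 \<and> s \<le> (cmod (w j))\<^sup>2 / R \<and> \<bar>Re (cnj n * w j)\<bar> \<le> (cmod (w j))\<^sup>2 / R"
    then obtain c R n s where s: "(c, R) \<in> S" "cmod n = 1" "q j = - of_real s * n" "0 \<le> s" "s \<le> (cmod (w j))\<^sup>2 / R"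
      by blast
    have R: "r \<le> R" "0 < R" using SR[OF s(1)] r by auto
    have "cmod (w j) \<le> y * R" using wh[OF j] h(3) mult_left_mono[OF R(1), of y] y by linarith
    then have "cmod (w j) * cmod (w j) \<le> y * R * cmod (w j)" by (intro mult_right_mono) auto
    then have "(cmod (w j))\<^sup>2 / R \<le> y * cmod (w j)" using R by (simp add: divide_le_eq power2_eq_square mult_ac)
    moreover have "cmod (q j) = s" using s by (simp add: norm_mult)
    ultimately show ?thesis using s(5) by linarith
  qed
  \<comment> \<open>A vanishing edge gives \<open>cmod (q j) = cmod (w j)\<close>, which
    \<open>qy\<close> permits only if both are zero. Then the neighbouring edge vanishes too, and
    the defect would spread along the whole polygon and force \<open>a = b\<close>.\<close>
  have w0: "w j = 0" if "Suc j < N" "\<Delta> j = 0 \<or> \<Delta> (Suc j) = 0" for j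
  proof -
    have "cmod (q j) = cmod (w j)"
      using that(2) unfolding \<Delta>w(1)[of j] \<Delta>w(2)[of j] by (metis add_eq_0_iff norm_minus_cancel right_minus_eq)
    then have "(1 - y) * cmod (w j) \<le> 0" using qy[OF that(1)] by (simp add: algebra_simps)
    then show ?thesis using y by (simp add: mult_le_0_iff)
  qed
  have all0: "\<Delta> j = 0 \<longleftrightarrow> \<Delta> 0 = 0" if "j < N" for j
    using that
  proof (induction j)
    case (Suc j)
    have "\<Delta> j = 0 \<longleftrightarrow> \<Delta> (Suc j) = 0"
    proof -
      have "w j = 0 \<and> q j = 0" if "\<Delta> j = 0 \<or> \<Delta> (Suc j) = 0"
        using w0[OF Suc.prems that] qy[OF Suc.prems] by simp
      then show ?thesis unfolding \<Delta>w(1)[of j] \<Delta>w(2)[of j] by auto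
    qed
    then show ?case using Suc by auto
  qed simp
  have \<Delta>0: "\<Delta> j \<noteq> 0" if "j < N" for j
  proof
    assume "\<Delta> j = 0"
    then have z: "\<Delta> i = 0" if "i < N" for i using all0[OF \<open>j < N\<close>] all0[OF that] by blast
    have "v i = v 0" if "i \<le> N" for i
      using that
    proof (induction i)
      case (Suc i)
      then show ?case using z[of i] by (simp add: \<Delta>_def)
    qed simp
    then show False using v0 vN p ab(3) by (metis order_refl)
  qed
  have wne: "w j \<noteq> 0" if "Suc j < N" for j
  proof
    assume "w j = 0"
    then have "\<Delta> j = 0" using qy[OF that] unfolding \<Delta>w(1)[of j] by simp
    then show False using \<Delta>0[of j] that by simp
  qed
  have len0: "0 < len j" if "j < N" for j using \<Delta>0[OF that] by (simp add: len_def)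
  have lenh: "len j \<le> h" if "j < N" for j using steph[OF that] by (simp add: len_def \<Delta>_def)
  have e1: "cmod (e j) = 1" if "j < N" for j using \<Delta>0[OF that] by (simp add: e_def len_def norm_divide)
  \<comment> \<open>\<open>w (j - 1)\<close> belongs to vertex \<open>j\<close>. By
    \<open>round_sharp_corner\<close> both edges there are longer than
    \<open>(1 - 2 * y) * cmod (w (j - 1))\<close>, so cutting off half of this leaves a straight
    part on every edge.\<close>
  define \<tau> where "\<tau> = (\<lambda>j. if 0 < j \<and> j < N then (1 - 2 * y) * cmod (w (j - 1)) / 2 else 0)"
  define g where "g = (\<lambda>j. e (Suc j) / e j)"
  note corner = round_sharp_corner[OF qy y wne, folded \<Delta>w]
  have \<tau>S: "\<tau> (Suc j) = (1 - 2 * y) * cmod (w j) / 2" if "Suc j < N" for j using that by (simp add: \<tau>_def)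
  have \<tau>len: "\<tau> j < len j / 2" "\<tau> (Suc j) < len j / 2" if j: "j < N" for j
  proof -
    show "\<tau> j < len j / 2"
    proof (cases j)
      case 0
      then show ?thesis using len0[OF j] by (simp add: \<tau>_def)
    next
      case (Suc i)
      then show ?thesis using corner(2)[of i] j by (simp add: \<tau>S len_def)
    qed
    show "\<tau> (Suc j) < len j / 2"
    proof (cases "Suc j < N")
      case True
      then show ?thesis using corner(1)[of j] by (simp add: \<tau>S len_def)
    next
      case False
      then show ?thesis using len0[OF j] by (simp add: \<tau>_def)
    qed
  qed
  \<comment> \<open>Edges and rounding arcs may enter the obstacles, but by at most
    \<open>\<delta>\<close>; \<open>fr\<close> keeps this larger set off the boundary of
    \<open>G\<close>.\<close>
  define U where "U = {z. cmod z \<le> \<rho> + \<delta> \<and> (\<forall>(c, R)\<in>S. R - \<delta> \<le> cmod (z - c))}"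
  have close: "z \<in> U" if "j \<le> N" "cmod (z - v j) \<le> \<delta>" for z j
  proof -
    have vj: "cmod (v j) \<le> \<rho>" "\<And>c R. (c, R) \<in> S \<Longrightarrow> R \<le> cmod (v j - c)"
      using vX[OF that(1)] by (auto simp: X_def obstacle_free_def)
    have "cmod z \<le> cmod (v j) + cmod (z - v j)" by (rule norm_triangle_sub)
    then have "cmod z \<le> \<rho> + \<delta>" using vj(1) that(2) by linarith
    moreover have "R - \<delta> \<le> cmod (z - c)" if "(c, R) \<in> S" for c R
      using norm_triangle_ineq2[of "v j - c" "v j - z"] vj(2)[OF that] \<open>cmod (z - v j) \<le> \<delta>\<close>
      by (simp add: norm_minus_commute)
    ultimately show ?thesis unfolding U_def by blast
  qed
  have "chain_to U (v 0) (v N) (e (N - 1))"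
  proof (rule round_polygon[where len = len and \<tau> = \<tau> and g = g])
    show "0 < N" by fact
    show "U \<subseteq> ball 0 1" using \<rho>(2) by (auto simp: U_def)
    show "cmod (e j) = 1" if "j < N" for j by (rule e1[OF that])
    show "v (Suc j) = v j + of_real (len j) * e j" if "j < N" for j
      using len0[OF that] by (simp add: e_def) (simp add: \<Delta>_def)
    show "\<tau> 0 = 0" "\<tau> N = 0" by (auto simp: \<tau>_def)
    show "0 < \<tau> j" if "0 < j" "j < N" for j
      using that wne[of "j - 1"] y by (simp add: \<tau>_def)
    show "\<tau> j + \<tau> (Suc j) < len j" if "j < N" for j using \<tau>len[OF that] by simp
    show "e (Suc j) = e j * g j \<and> g j \<noteq> -1" if "Suc j < N" for j
    proof
      have "e j \<noteq> 0" using e1[of j] that by auto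
      then show "e (Suc j) = e j * g j" by (simp add: g_def)
      show "g j \<noteq> -1" using corner(3)[OF that that] by (simp add: g_def e_def len_def)
    qed
    show "z \<in> U" if "0 < j" "j < N" "cmod (z - v j) \<le> 3 * \<tau> j" for j z
    proof (rule close[of j])
      have "3 * \<tau> j \<le> 3 * (len j / 2)" using \<tau>len(1)[OF that(2)] by simp
      then show "cmod (z - v j) \<le> \<delta>" using that(3) lenh[OF that(2)] h by linarith
    qed (use that in simp)
    show "v j + of_real t * e j \<in> U" if "j < N" "0 \<le> t" "t \<le> len j" for j t
    proof (rule close[of j])
      show "cmod (v j + of_real t * e j - v j) \<le> \<delta>"
        using that e1[OF that(1)] lenh[OF that(1)] h by (simp add: norm_mult)
    qed (use that in simp)
    show "\<bar>(1 - (cmod P)\<^sup>2) * (Im (g j) / (1 + Re (g j)) / \<tau> (Suc j)) + 2 * Im (cnj P * e j)\<bar> < 2"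
      if j: "Suc j < N" and P: "P = v (Suc j) - of_real (\<tau> (Suc j)) * e j" "cmod P < 1" for j P
    proof -
      have gx: "Im (g j) / (1 + Re (g j)) = - 2 * Im (w j * cnj (q j)) / (len j * len (Suc j) + ((cmod (w j))\<^sup>2 - (cmod (q j))\<^sup>2))"
        using corner(4)[OF j j] by (simp only: g_def e_def len_def)
      have Lge: "(cmod (w j))\<^sup>2 - (cmod (q j))\<^sup>2 \<le> len j * len (Suc j)"
        using corner(5)[OF j j] by (simp only: len_def)
      show ?thesis
        using local[OF j]
      proof
        assume "q j = 0"
        then have z: "Im (g j) / (1 + Re (g j)) = 0" using gx by simp
        have "\<bar>Im (cnj P * e j)\<bar> \<le> cmod (cnj P * e j)" by (rule abs_Im_le_cmod)
        also have "\<dots> = cmod P" using e1[of j] j by (simp add: norm_mult)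
        finally show ?thesis unfolding z using P(2) by (simp del: times_complex.simps)
      next
        assume "\<exists>c R n s. (c, R) \<in> S \<and> cmod n = 1 \<and> v (Suc j) = c + of_real R * n \<and> q j = - of_real s * n \<and> 0 \<le> s \<and>
         s * (2 * R - s) \<le> (cmod (w j))\<^sup>2 \<and> s \<le> (cmod (w j))\<^sup>2 / R \<and> \<bar>Re (cnj n * w j)\<bar> \<le> (cmod (w j))\<^sup>2 / R"
        then obtain c R n s where s: "(c, R) \<in> S" "cmod n = 1" "v (Suc j) = c + of_real R * n" "q j = - of_real s * n"
          "0 \<le> s" "s * (2 * R - s) \<le> (cmod (w j))\<^sup>2" "s \<le> (cmod (w j))\<^sup>2 / R" "\<bar>Re (cnj n * w j)\<bar> \<le> (cmod (w j))\<^sup>2 / R"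
          by blast
        have R: "r \<le> R" "R \<le> 1" "(1 - (cmod c)\<^sup>2 + R\<^sup>2) / R \<le> 2 - \<eta>" using SR[OF s(1)] by auto
        have qs: "cmod (q j) = s" using s by (simp add: norm_mult)
        have "cmod (v (Suc j)) \<le> \<rho>" using vX[of "Suc j"] j by (simp add: X_def obstacle_free_def)
        then have v2: "2 * cmod (v (Suc j)) \<le> 2 - \<eta>" using \<rho>(3) by linarith
        have ee: "e j = (w j + of_real s * n) / of_real (cmod (w j + of_real s * n))"
          by (simp add: e_def len_def \<Delta>w(1) s(4))
        have wpos: "0 < cmod (w j)" using wne[OF j] by simp
        have wy: "cmod (w j) \<le> y * r" using wh[OF j] h(3) by linarith
        have num: "- 2 * Im (w j * cnj (q j)) = 2 * s * Im (w j * cnj n)" by (simp add: s(4) algebra_simps)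
        show ?thesis
          unfolding gx num qs
          by (rule corner_curvature[OF s(2,3) refl wpos wy y r(1) R(1,2) s(5,6,7,8) R(3) v2 y\<eta> ee \<tau>S[OF j] P Lge[unfolded qs]])
      qed
    qed
  qed
  then obtain n \<gamma> where ch: "subhoro_chain n \<gamma>" and im: "(\<Union>k<n. path_image (\<gamma> k)) \<subseteq> U"
    and ends: "\<gamma> 0 0 = v 0" "\<gamma> (n - 1) 1 = v N"
    unfolding chain_to_def by blast
  define \<Gamma> where "\<Gamma> = (\<Union>k<n. path_image (\<gamma> k))"
  have adm: "admissible_Jordan_arc \<Gamma> a b"
    using admissible_Jordan_arc_of_chain[OF ch] ends v0 vN p(3,4) by (simp add: \<Gamma>_def)
  have "Jordan_arc \<Gamma> a b" using adm unfolding admissible_Jordan_arc_def by (rule conjunct1)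
  then obtain \<alpha> where \<alpha>: "arc \<alpha>" "path_image \<alpha> = \<Gamma>" "pathstart \<alpha> = a"
    unfolding Jordan_arc_def by metis
  have "connected \<Gamma>" using \<alpha> connected_arc_image by blast
  moreover have "\<Gamma> \<inter> G \<noteq> {}" using \<alpha> ab(1) pathstart_in_path_image[of \<alpha>] by auto
  moreover have "\<Gamma> \<inter> frontier G = {}"
  proof -
    have "z \<notin> frontier G" if "z \<in> \<Gamma>" for z
    proof (rule fr)
      have "z \<in> U" using that im unfolding \<Gamma>_def by blast
      then show "cmod z \<le> \<rho> + \<delta>" "\<And>c R. (c, R) \<in> S \<Longrightarrow> R - \<delta> \<le> cmod (z - c)" by (auto simp: U_def)
    qed
    then show ?thesis by blast
  qed
  ultimately have "\<Gamma> \<subseteq> G" using connected_Int_frontier[of \<Gamma> G] by blast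
  then show ?thesis using adm by blast
qed

theorem theorem1:
  fixes G :: "complex set"
  assumes "open G" and "connected G" and "G \<noteq> {}"
    and "G \<subseteq> ball 0 1"
    and "simply_connected G"
    and "locally connected (frontier G)"
  shows "horo_convex G \<longleftrightarrow>
    (\<forall>a\<in>G. \<forall>b\<in>G. a \<noteq> b \<longrightarrow> (\<exists>\<Gamma>. admissible_Jordan_arc \<Gamma> a b \<and> \<Gamma> \<subseteq> G))"
proof
  assume "horo_convex G"
  then show "\<forall>a\<in>G. \<forall>b\<in>G. a \<noteq> b \<longrightarrow> (\<exists>\<Gamma>. admissible_Jordan_arc \<Gamma> a b \<and> \<Gamma> \<subseteq> G)"
    by (intro ballI impI arcs_if_horo_convex[OF assms(1,2,4)])
next
  assume *: "\<forall>a\<in>G. \<forall>b\<in>G. a \<noteq> b \<longrightarrow> (\<exists>\<Gamma>. admissible_Jordan_arc \<Gamma> a b \<and> \<Gamma> \<subseteq> G)"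
  show "horo_convex G"
    by (rule horo_convex_if_arcs[OF assms(1,2,4,5) *[rule_format]])
qed

end
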